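(* Let $1\le n\le3$, let $p,q>0$ and $\alpha,\beta\in[0,1)$ be such that $\min\{p+\alpha,q+\beta\}>1$. Assume that $u_0=v_0=0$ and that $u_1,v_1\in L^1\cap H^1$ satisfy $$M_u:=\int_{\mathbb R^n}u_1(x)\,dx>0,\qquad M_v:=\int_{\mathbb R^n}v_1(x)\,dx>0 .$$ If $$\frac{1+\max\{q-\alpha,p-\beta\}}{pq-(1-\alpha)(1-\beta)}>\frac n2,$$ then there is no global (in time) mild solution of the Cauchy problem $$\begin{cases} u_{tt}-\Delta u+u_t=|u|^{\alpha}|v|^{p}, & x\in\mathbb R^n,\ t>0,\\ v_{tt}-\Delta v+v_t=|u|^{q}|v|^{\beta}, & x\in\mathbb R^n,\ t>0,\\ (u,u_t,v,v_t)(0,x)=(u_0,u_1,v_0,v_1)(x), & x\in\mathbb R^n.\end{cases}$$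
   Context: All functions are real-valued and all function spaces are over $\mathbb R^n$. Kernel: $\mathcal K(t,x)$ is defined by its spatial Fourier transform, $\widehat{\mathcal K}(t,\xi)=\dfrac{e^{-t/2}\sinh\left(t\sqrt{1/4-|\xi|^2}\right)}{\sqrt{1/4-|\xi|^2}}$ if $|\xi|<1/2$, $\widehat{\mathcal K}(t,\xi)=\dfrac{e^{-t/2}\sin\left(t\sqrt{|\xi|^2-1/4}\right)}{\sqrt{|\xi|^2-1/4}}$ if $|\xi|>1/2$, and $\widehat{\mathcal K}(t,\xi)=te^{-t/2}$ if $|\xi|=1/2$; convolution $\ast_x$ with $\mathcal K(t,\cdot)$ (resp. $\partial_t\mathcal K(t,\cdot)$) is the Fourier multiplier with symbol $\widehat{\mathcal K}(t,\xi)$ (resp. $\partial_t\widehat{\mathcal K}(t,\xi)$). For $w\in\{u,v\}$ put $w^{\rm lin}(t,x)=(\mathcal K(t,x)+\partial_t\mathcal K(t,x))\ast_x w_0(x)+\mathcal K(t,x)\ast_x w_1(x)$. Mild solution: let $T\in(0,\infty]$. A pair $(u,v)\in(\mathcal C([0,T);L^2))^2$ is a (local in time) mild solution if $F_u:=|u|^\alpha|v|^p$ and $F_v:=|u|^q|v|^\beta$ belong to $L^1_{\rm loc}([0,T);L^2)$ and $$u(t,x)=u^{\rm lin}(t,x)+\int_0^t\mathcal K(t-s,x)\ast_x F_u(s,x)\,ds,\qquad v(t,x)=v^{\rm lin}(t,x)+\int_0^t\mathcal K(t-s,x)\ast_x F_v(s,x)\,ds .$$ If $T=\infty$, the mild solution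 is called global (in time). *)

theory Defs
  imports "HOL-Analysis.Analysis"
begin

section \<open>The Hilbert space of real-valued square integrable functions\<close>

definition square_integrable :: "('a::euclidean_space \<Rightarrow> 'b::real_normed_vector) \<Rightarrow> bool" where
  "square_integrable f \<longleftrightarrow> f \<in> borel_measurable lborel \<and> integrable lborel (\<lambda>x. (norm (f x))\<^sup>2)"

lemma square_integrable_measurable [measurable_dest]:
  "square_integrable f \<Longrightarrow> f \<in> borel_measurable lborel"
  by (simp add: square_integrable_def)

lemma square_integrable_0: "square_integrable (\<lambda>x. 0)"
  by (simp add: square_integrable_def)

lemma square_integrable_mult:
  fixes f g :: "'a::euclidean_space \<Rightarrow> real"
  assumes "square_integrable f" "square_integrable g"
  shows "integrable lborel (\<lambda>x. f x * g x)"
proof (rule Bochner_Integration.integrable_bound)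
  show "integrable lborel (\<lambda>x. (norm (f x))\<^sup>2 + (norm (g x))\<^sup>2)"
    using assms by (simp add: square_integrable_def)
  show "(\<lambda>x. f x * g x) \<in> borel_measurable lborel"
    using assms by measurable
  have "\<bar>a * b\<bar> \<le> a\<^sup>2 + b\<^sup>2" for a b :: real
  proof -
    have "2 * (\<bar>a\<bar> * \<bar>b\<bar>) \<le> a\<^sup>2 + b\<^sup>2"
      using sum_squares_bound[of "\<bar>a\<bar>" "\<bar>b\<bar>"] by simp
    moreover have "0 \<le> \<bar>a\<bar> * \<bar>b\<bar>" by simp
    ultimately show ?thesis unfolding abs_mult by linarith
  qed
  then show "AE x in lborel. norm (f x * g x) \<le> norm ((norm (f x))\<^sup>2 + (norm (g x))\<^sup>2)"
    by (simp add: abs_mult)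
qed

lemma square_integrable_add:
  fixes f g :: "'a::euclidean_space \<Rightarrow> real"
  assumes "square_integrable f" "square_integrable g"
  shows "square_integrable (\<lambda>x. f x + g x)"
proof -
  have "(\<lambda>x. f x + g x) \<in> borel_measurable lborel"
    using assms by measurable
  moreover have "integrable lborel (\<lambda>x. (f x)\<^sup>2 + (g x)\<^sup>2 + 2 * (f x * g x))"
    using assms square_integrable_mult[OF assms] by (simp add: square_integrable_def)
  ultimately show ?thesis
    by (simp add: square_integrable_def power2_sum mult.assoc)
qed

lemma square_integrable_scale:
  fixes f :: "'a::euclidean_space \<Rightarrow> real"
  assumes "square_integrable f"
  shows "square_integrable (\<lambda>x. c * f x)"
proof -
  have "(\<lambda>x. c * f x) \<in> borel_measurable lborel"
    using assms by measurable
  then show ?thesis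
    using assms by (simp add: square_integrable_def power_mult_distrib)
qed

lemma square_integrable_minus:
  fixes f :: "'a::euclidean_space \<Rightarrow> real"
  assumes "square_integrable f"
  shows "square_integrable (\<lambda>x. - f x)"
  using assms by (simp add: square_integrable_def)

lemma square_integrable_diff:
  fixes f g :: "'a::euclidean_space \<Rightarrow> real"
  assumes "square_integrable f" "square_integrable g"
  shows "square_integrable (\<lambda>x. f x - g x)"
  using square_integrable_add[OF assms(1) square_integrable_minus[OF assms(2)]] by simp

definition L2_eq :: "('a::euclidean_space \<Rightarrow> real) \<Rightarrow> ('a \<Rightarrow> real) \<Rightarrow> bool" where
  "L2_eq f g \<longleftrightarrow> square_integrable f \<and> square_integrable g \<and> (AE x in lborel. f x = g x)"

lemma part_equivp_L2_eq: "part_equivp L2_eq"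
proof (rule part_equivpI)
  show "\<exists>f. L2_eq f f"
    using square_integrable_0 by (intro exI[of _ "\<lambda>x. 0"]) (simp add: L2_eq_def)
  show "symp L2_eq"
    by (auto simp: symp_def L2_eq_def elim: AE_mp)
  show "transp L2_eq"
    by (auto simp: transp_def L2_eq_def)
qed

quotient_type (overloaded) 'a L2 = "'a::euclidean_space \<Rightarrow> real" / partial: "L2_eq"
  morphisms L2_fun L2_of
  by (rule part_equivp_L2_eq)

text \<open>\<^term>\<open>L2_fun w\<close> is an arbitrary representative of the class \<^term>\<open>w\<close>;
  \<^term>\<open>L2_of f\<close> is the class of \<^term>\<open>f\<close>, meaningful only for square integrable \<^term>\<open>f\<close>.\<close>

lemma L2_eq_L2_fun: "L2_eq (L2_fun u) (L2_fun u)"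
  using Quotient_L2 by (rule Quotient_rep_reflp)

lemma square_integrable_L2_fun [simp]: "square_integrable (L2_fun u)"
  using L2_eq_L2_fun[of u] by (simp add: L2_eq_def)

lemma L2_of_L2_fun [simp]: "L2_of (L2_fun u) = u"
  using Quotient_L2 by (rule Quotient_abs_rep)

lemma L2_of_eq_iff:
  assumes "square_integrable f" "square_integrable g"
  shows "L2_of f = L2_of g \<longleftrightarrow> (AE x in lborel. f x = g x)"
  using Quotient_rel[OF Quotient_L2, of f g] assms by (auto simp: L2_eq_def)

lemma L2_fun_L2_of:
  assumes "square_integrable f"
  shows "AE x in lborel. L2_fun (L2_of f) x = f x"
  using L2_of_eq_iff[of "L2_fun (L2_of f)" f] assms by simp

instantiation L2 :: (euclidean_space) real_vector
begin

lift_definition zero_L2 :: "'a L2" is "\<lambda>x. 0"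
  by (simp add: L2_eq_def square_integrable_0)
lift_definition plus_L2 :: "'a L2 \<Rightarrow> 'a L2 \<Rightarrow> 'a L2" is "\<lambda>f g x. f x + g x"
  by (auto simp: L2_eq_def square_integrable_add)
lift_definition uminus_L2 :: "'a L2 \<Rightarrow> 'a L2" is "\<lambda>f x. - f x"
  by (auto simp: L2_eq_def square_integrable_minus)
lift_definition minus_L2 :: "'a L2 \<Rightarrow> 'a L2 \<Rightarrow> 'a L2" is "\<lambda>f g x. f x - g x"
  by (auto simp: L2_eq_def square_integrable_diff)
lift_definition scaleR_L2 :: "real \<Rightarrow> 'a L2 \<Rightarrow> 'a L2" is "\<lambda>c f x. c * f x"
  by (auto simp: L2_eq_def square_integrable_scale)
instance
proof
  fix u v w :: "'a L2" and a b :: real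
  show "u + v + w = u + (v + w)" "u + v = v + u" "0 + u = u" "- u + u = 0" "u - v = u + - v"
    by (transfer; auto simp: L2_eq_def algebra_simps square_integrable_add
        square_integrable_diff square_integrable_minus square_integrable_0)+
  show "a *\<^sub>R (u + v) = a *\<^sub>R u + a *\<^sub>R v" "(a + b) *\<^sub>R u = a *\<^sub>R u + b *\<^sub>R u"
    "a *\<^sub>R b *\<^sub>R u = (a * b) *\<^sub>R u" "1 *\<^sub>R u = u"
    by (transfer; auto simp: L2_eq_def algebra_simps square_integrable_add square_integrable_scale)+
qed

end

instantiation L2 :: (euclidean_space) real_inner
begin

lift_definition inner_L2 :: "'a L2 \<Rightarrow> 'a L2 \<Rightarrow> real" is "\<lambda>f g. \<integral>x. f x * g x \<partial>lborel"
proof -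
  fix f f' g g' :: "'a \<Rightarrow> real"
  assume "L2_eq f f'" "L2_eq g g'"
  then have m: "f \<in> borel_measurable lborel" "f' \<in> borel_measurable lborel"
      "g \<in> borel_measurable lborel" "g' \<in> borel_measurable lborel"
    and ae: "AE x in lborel. f x = f' x" "AE x in lborel. g x = g' x"
    by (auto simp: L2_eq_def square_integrable_def)
  from ae have "AE x in lborel. f x * g x = f' x * g' x"
    by eventually_elim simp
  then show "(\<integral>x. f x * g x \<partial>lborel) = (\<integral>x. f' x * g' x \<partial>lborel)"
    using m by (intro integral_cong_AE borel_measurable_times)
qed

definition norm_L2 :: "'a L2 \<Rightarrow> real" where "norm_L2 u = sqrt (inner u u)"
definition sgn_L2 :: "'a L2 \<Rightarrow> 'a L2" where "sgn_L2 u = u /\<^sub>R norm u"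
definition dist_L2 :: "'a L2 \<Rightarrow> 'a L2 \<Rightarrow> real" where "dist_L2 u v = norm (u - v)"
definition uniformity_L2 :: "('a L2 \<times> 'a L2) filter" where
  "uniformity_L2 = (INF e\<in>{0<..}. principal {(x, y). dist x y < e})"
definition open_L2 :: "'a L2 set \<Rightarrow> bool" where
  "open_L2 U \<longleftrightarrow> (\<forall>x\<in>U. \<forall>\<^sub>F (x', y) in uniformity. x' = x \<longrightarrow> y \<in> U)"

instance
proof
  fix u v w :: "'a L2" and a b :: real
  show "inner u v = inner v u"
    by transfer (simp add: mult.commute)
  show "inner (u + v) w = inner u w + inner v w"
    by transfer (simp add: L2_eq_def distrib_right square_integrable_mult)
  show "inner (a *\<^sub>R u) v = a * inner u v"
    by transfer (simp add: mult.assoc)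
  show "0 \<le> inner u u"
    by transfer simp
  show "inner u u = 0 \<longleftrightarrow> u = 0"
  proof (transfer, goal_cases)
    case (1 u)
    then have "integrable lborel (\<lambda>x. u x * u x)"
      by (simp add: L2_eq_def square_integrable_mult)
    from integral_nonneg_eq_0_iff_AE[OF this] 1 show ?case
      by (simp add: L2_eq_def square_integrable_0)
  qed
qed (simp_all add: norm_L2_def sgn_L2_def dist_L2_def uniformity_L2_def open_L2_def)

end

lemma L2_of_0: "L2_of (\<lambda>x. 0) = 0"
  by (simp add: zero_L2.abs_eq)

lemma L2_of_add:
  assumes "square_integrable f" "square_integrable g"
  shows "L2_of (\<lambda>x. f x + g x) = L2_of f + L2_of g"
  using plus_L2.abs_eq[of f g] assms by (simp add: L2_eq_def)

lemma L2_of_diff: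
  assumes "square_integrable f" "square_integrable g"
  shows "L2_of (\<lambda>x. f x - g x) = L2_of f - L2_of g"
  using minus_L2.abs_eq[of f g] assms by (simp add: L2_eq_def)

lemma L2_of_scaleR:
  assumes "square_integrable f"
  shows "L2_of (\<lambda>x. c * f x) = c *\<^sub>R L2_of f"
  using scaleR_L2.abs_eq[of f c] assms by (simp add: L2_eq_def)

lemma norm_L2_of:
  assumes "square_integrable f"
  shows "norm (L2_of f) = sqrt (\<integral>x. (f x)\<^sup>2 \<partial>lborel)"
  using inner_L2.abs_eq[of f f] assms by (simp add: L2_eq_def norm_L2_def power2_eq_square)


subsection \<open>Separability\<close>

text \<open>Needed for the Bochner integral of \<^typ>\<open>'a L2\<close>-valued functions.\<close>

lemma norm_L2_of_squared:
  assumes "square_integrable f"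
  shows "(norm (L2_of f))\<^sup>2 = (\<integral>x. (f x)\<^sup>2 \<partial>lborel)"
  using norm_L2_of[OF assms] by simp

lemma square_integrable_indicator:
  assumes "A \<in> sets borel" "emeasure lborel A < \<infinity>"
  shows "square_integrable (indicator A :: 'a::euclidean_space \<Rightarrow> real)"
proof -
  have *: "(\<lambda>x. (indicator A x :: real)\<^sup>2) = indicator A"
    by (auto simp: indicator_def fun_eq_iff)
  then show ?thesis
    using assms by (simp add: square_integrable_def)
qed



lemma L2_of_sum:
  assumes "finite I" "\<And>i. i \<in> I \<Longrightarrow> square_integrable (f i)"
  shows "square_integrable (\<lambda>x. \<Sum>i\<in>I. f i x) \<and>
    L2_of (\<lambda>x. \<Sum>i\<in>I. f i x) = (\<Sum>i\<in>I. L2_of (f i))"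
  using assms
proof (induction I rule: finite_induct)
  case empty
  then show ?case by (simp add: square_integrable_0 L2_of_0)
next
  case (insert i I)
  then show ?case
    using L2_of_add[of "f i" "\<lambda>x. \<Sum>i\<in>I. f i x"]
      square_integrable_add[of "f i" "\<lambda>x. \<Sum>i\<in>I. f i x"] by simp
qed

lemma dist_L2_indicator:
  assumes "A \<in> sets borel" "B \<in> sets borel" "A \<subseteq> B" "emeasure lborel B < \<infinity>"
  shows "dist (L2_of (indicator A)) (L2_of (indicator B :: 'a::euclidean_space \<Rightarrow> real))
    = sqrt (measure lborel (B - A))"
proof -
  have "emeasure lborel A < \<infinity>"
    using assms emeasure_mono[of A B lborel] by (simp add: le_less_trans)
  then have A: "square_integrable (indicator A :: 'a \<Rightarrow> real)"
    and B: "square_integrable (indicator B :: 'a \<Rightarrow> real)"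
    using assms by (auto intro: square_integrable_indicator)
  have "(\<lambda>x. (indicator A x - indicator B x :: real)\<^sup>2) = indicator (B - A)"
    using assms(3) by (auto simp: indicator_def fun_eq_iff)
  then show ?thesis
    using assms norm_L2_of[OF square_integrable_diff[OF A B]]
    by (simp add: dist_norm L2_of_diff[OF A B])
qed

lemma countable_rational_span:
  fixes S :: "'b::real_normed_vector set"
  assumes "countable S"
  obtains D where "countable D" "S \<subseteq> closure D" "subspace (closure D)"
proof
  define D where "D = (\<lambda>l. \<Sum>(q, s)\<leftarrow>l. q *\<^sub>R s) ` lists (\<rat> \<times> S)"
  have D_add: "x + y \<in> D" if "x \<in> D" "y \<in> D" for x y
  proof -
    from that obtain l m where "l \<in> lists (\<rat> \<times> S)" "m \<in> lists (\<rat> \<times> S)"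
      "x = (\<Sum>(q, s)\<leftarrow>l. q *\<^sub>R s)" "y = (\<Sum>(q, s)\<leftarrow>m. q *\<^sub>R s)"
      by (auto simp: D_def)
    then show ?thesis
      unfolding D_def by (intro image_eqI[of _ _ "l @ m"]) auto
  qed
  have D_scale: "q *\<^sub>R x \<in> D" if "x \<in> D" "q \<in> \<rat>" for x q
  proof -
    from that obtain l where l: "l \<in> lists (\<rat> \<times> S)" "x = (\<Sum>(q, s)\<leftarrow>l. q *\<^sub>R s)"
      by (auto simp: D_def)
    have "q *\<^sub>R (\<Sum>(r, s)\<leftarrow>l. r *\<^sub>R s) = (\<Sum>(r, s)\<leftarrow>map (\<lambda>(r, s). (q * r, s)) l. r *\<^sub>R s)"
      by (induction l) (auto simp: scaleR_add_right)
    moreover have "map (\<lambda>(r, s). (q * r, s)) l \<in> lists (\<rat> \<times> S)"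
      using l(1) that(2) by (auto simp: in_lists_conv_set)
    ultimately show ?thesis
      using l(2) unfolding D_def by blast
  qed
  show "countable D"
    unfolding D_def using assms by (intro countable_image countable_lists countable_SIGMA countable_rat)
  have "S \<subseteq> D"
  proof
    fix s assume "s \<in> S"
    then show "s \<in> D"
      unfolding D_def by (intro image_eqI[of _ _ "[(1, s)]"]) auto
  qed
  then show "S \<subseteq> closure D"
    using closure_subset by blast
  have "0 \<in> D"
    unfolding D_def by (intro image_eqI[of _ _ "[]"]) auto
  show "subspace (closure D)"
  proof (rule subspaceI)
    show "0 \<in> closure D"
      using \<open>0 \<in> D\<close> closure_subset by blast
  next
    fix x y assume "x \<in> closure D" "y \<in> closure D"
    then obtain f g where "\<And>n. f n \<in> D" "f \<longlonglongrightarrow> x" "\<And>n. g n \<in> D" "g \<longlonglongrightarrow> y"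
      by (auto simp: closure_sequential)
    then show "x + y \<in> closure D"
      unfolding closure_sequential
      by (intro exI[of _ "\<lambda>n. f n + g n"]) (auto intro: D_add tendsto_add)
  next
    fix c :: real and x assume "x \<in> closure D"
    then obtain f where f: "\<And>n. f n \<in> D" "f \<longlonglongrightarrow> x"
      by (auto simp: closure_sequential)
    have "c \<in> closure \<rat>"
      by (simp add: Rats_closure_real)
    then obtain q where q: "\<And>n. q n \<in> \<rat>" "q \<longlonglongrightarrow> c"
      by (auto simp: closure_sequential)
    show "c *\<^sub>R x \<in> closure D"
      unfolding closure_sequential
      using f q by (intro exI[of _ "\<lambda>n. q n *\<^sub>R f n"]) (auto intro: D_scale tendsto_scaleR)
  qed
qed

lemma closed_subspace_L2_eq_UNIV:
  fixes V :: "'a::euclidean_space L2 set"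
  assumes V: "subspace V" "closed V"
  assumes ind: "\<And>A. A \<in> sets borel \<Longrightarrow> emeasure lborel A < \<infinity> \<Longrightarrow> L2_of (indicator A) \<in> V"
  shows "V = UNIV"
proof -
  have simple: "square_integrable s \<Longrightarrow> L2_of s \<in> V"
    if s: "simple_function lborel s" "integrable lborel (\<lambda>x. (s x)\<^sup>2)" for s :: "'a \<Rightarrow> real"
  proof -
    define A where "A y = s -` {y}" for y
    have A_sets: "A y \<in> sets borel" for y
      using simple_functionD(2)[OF s(1), of "{y}"] by (simp add: A_def)
    have A_fin: "emeasure lborel (A y) < \<infinity>" if "y \<noteq> 0" for y
    proof -
      have "integrable lborel (\<lambda>x. indicator (A y) x * y\<^sup>2)"
      proof (rule Bochner_Integration.integrable_bound[OF s(2)])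
        show "(\<lambda>x. indicator (A y) x * y\<^sup>2) \<in> borel_measurable lborel"
          using A_sets[of y] by simp
      qed (auto simp: A_def indicator_def)
      then have "integrable lborel (\<lambda>x. (indicator (A y) x * y\<^sup>2) * (1 / y\<^sup>2))"
        by (rule integrable_mult_left)
      then have "integrable lborel (indicator (A y) :: 'a \<Rightarrow> real)"
        using that by simp
      then show ?thesis
        by (simp add: integrable_indicator_iff A_sets)
    qed
    define I where "I = range s - {0}"
    have fin: "finite I"
      using simple_functionD(1)[OF s(1)] by (simp add: I_def)
    have s_eq: "s = (\<lambda>x. \<Sum>y\<in>I. y * indicator (A y) x)"
    proof
      fix x
      have "(\<Sum>y\<in>I. y * indicator (A y) x) = (\<Sum>y\<in>I. if s x = y then y else 0)"
        by (intro sum.cong) (auto simp: A_def)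
      also have "\<dots> = s x"
        using fin by (auto simp: I_def sum.delta)
      finally show "s x = (\<Sum>y\<in>I. y * indicator (A y) x)" ..
    qed
    have sq: "square_integrable (indicator (A y) :: 'a \<Rightarrow> real)" if "y \<in> I" for y
      using that by (intro square_integrable_indicator A_sets A_fin) (auto simp: I_def)
    have "L2_of s = L2_of (\<lambda>x. \<Sum>y\<in>I. y * indicator (A y) x)"
      by (rule arg_cong[OF s_eq])
    also have "\<dots> = (\<Sum>y\<in>I. L2_of (\<lambda>x. y * indicator (A y) x))"
      using L2_of_sum[OF fin square_integrable_scale[OF sq]] by (rule conjunct2)
    also have "\<dots> = (\<Sum>y\<in>I. y *\<^sub>R L2_of (indicator (A y)))"
      by (intro sum.cong refl L2_of_scaleR sq)
    also have "\<dots> \<in> V"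
      by (intro subspace_sum[OF V(1)] subspace_scale[OF V(1)] ind A_sets A_fin) (auto simp: I_def)
    finally show ?thesis .
  qed
  have "u \<in> V" for u :: "'a L2"
  proof -
    define f where "f = L2_fun u"
    have f: "square_integrable f" by (simp add: f_def)
    then have fm [measurable]: "f \<in> borel_measurable lborel"
      and fi: "integrable lborel (\<lambda>x. (f x)\<^sup>2)"
      by (auto simp: square_integrable_def)
    obtain F where F: "\<And>i. simple_function lborel (F i)" "\<And>x. (\<lambda>i. F i x) \<longlonglongrightarrow> f x"
      and Fle: "\<And>i x. \<bar>F i x\<bar> \<le> 2 * \<bar>f x\<bar>"
      using borel_measurable_implies_sequence_metric[OF fm, of 0] by auto
    have Fm [measurable]: "F i \<in> borel_measurable lborel" for i
      using F(1) by (rule borel_measurable_simple_function)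
    have Fi: "integrable lborel (\<lambda>x. (F i x)\<^sup>2)" for i
    proof (rule Bochner_Integration.integrable_bound)
      show "integrable lborel (\<lambda>x. 4 * (f x)\<^sup>2)"
        using fi by simp
      show "AE x in lborel. norm ((F i x)\<^sup>2) \<le> norm (4 * (f x)\<^sup>2)"
      proof (intro AE_I2)
        fix x
        have "\<bar>F i x\<bar>\<^sup>2 \<le> (2 * \<bar>f x\<bar>)\<^sup>2"
          using Fle by (intro power_mono) auto
        then show "norm ((F i x)\<^sup>2) \<le> norm (4 * (f x)\<^sup>2)"
          by (simp add: power_mult_distrib)
      qed
    qed measurable
    have Fs: "square_integrable (F i)" for i
      using Fm[of i] Fi[of i] by (simp add: square_integrable_def)
    have "(\<lambda>i. \<integral>x. (F i x - f x)\<^sup>2 \<partial>lborel) \<longlonglongrightarrow> (\<integral>x. 0 \<partial>(lborel :: 'a measure))"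
    proof (rule integral_dominated_convergence)
      show "integrable lborel (\<lambda>x. 9 * (f x)\<^sup>2)"
        using fi by simp
      show "AE x in lborel. (\<lambda>i. (F i x - f x)\<^sup>2) \<longlonglongrightarrow> 0"
      proof (intro AE_I2)
        fix x
        have "(\<lambda>i. (F i x - f x)\<^sup>2) \<longlonglongrightarrow> (f x - f x)\<^sup>2"
          by (intro tendsto_intros F)
        then show "(\<lambda>i. (F i x - f x)\<^sup>2) \<longlonglongrightarrow> 0" by simp
      qed
      show "AE x in lborel. norm ((F i x - f x)\<^sup>2) \<le> 9 * (f x)\<^sup>2" for i
      proof (intro AE_I2)
        fix x
        have "\<bar>F i x - f x\<bar> \<le> 3 * \<bar>f x\<bar>"
          using Fle[of i x] by linarith
        then have "\<bar>F i x - f x\<bar>\<^sup>2 \<le> (3 * \<bar>f x\<bar>)\<^sup>2"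
          by (intro power_mono) auto
        then show "norm ((F i x - f x)\<^sup>2) \<le> 9 * (f x)\<^sup>2"
          by (simp add: power_mult_distrib)
      qed
    qed measurable
    moreover have "(\<integral>x. (F i x - f x)\<^sup>2 \<partial>lborel) = (norm (L2_of (F i) - u))\<^sup>2" for i
    proof -
      have "L2_of f = u" by (simp add: f_def)
      then have "L2_of (\<lambda>x. F i x - f x) = L2_of (F i) - u"
        by (simp only: L2_of_diff[OF Fs f])
      then show ?thesis
        by (simp only: norm_L2_of_squared[OF square_integrable_diff[OF Fs f], symmetric])
    qed
    ultimately have "(\<lambda>i. (norm (L2_of (F i) - u))\<^sup>2) \<longlonglongrightarrow> 0"
      by (simp only: integral_zero)
    then have "(\<lambda>i. sqrt ((norm (L2_of (F i) - u))\<^sup>2)) \<longlonglongrightarrow> sqrt 0"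
      by (intro tendsto_real_sqrt)
    then have "(\<lambda>i. L2_of (F i)) \<longlonglongrightarrow> u"
      by (subst tendsto_dist_iff) (simp add: dist_norm)
    with V(2) simple[OF F(1) Fi Fs] show ?thesis
      by (rule closed_sequentially)
  qed
  then show ?thesis by auto
qed

lemma L2_countable_dense:
  "\<exists>D :: 'a::euclidean_space L2 set. countable D \<and> closure D = UNIV"
proof -
  obtain \<U> :: "'a set set" where \<U>: "countable \<U>" "topological_basis \<U>"
    using ex_countable_basis by blast
  define S where "S = (\<lambda>\<F>. L2_of (indicator (\<Union>\<F>) :: 'a \<Rightarrow> real)) ` {\<F>. finite \<F> \<and> \<F> \<subseteq> \<U>}"
  have "countable S"
    unfolding S_def by (intro countable_image countable_Collect_finite_subset \<U>)
  then obtain D where D: "countable D" "S \<subseteq> closure D" "subspace (closure D)"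
    by (rule countable_rational_span)
  have op: "L2_of (indicator U) \<in> closure D" if U: "open U" "emeasure lborel U < \<infinity>" for U :: "'a set"
  proof -
    obtain \<V> where \<V>: "\<V> \<subseteq> \<U>" "\<Union>\<V> = U"
      using topological_basisE \<U>(2) U(1) by (metis topological_basis_def)
    show ?thesis
    proof (cases "\<V> = {}")
      case True
      then have "L2_of (indicator U :: 'a \<Rightarrow> real) \<in> S"
        unfolding S_def using \<V> by (intro image_eqI[of _ _ "{}"]) auto
      then show ?thesis using D by auto
    next
      case False
      have "countable \<V>" using \<V>(1) \<U>(1) countable_subset by blast
      define V where "V n = \<Union>(from_nat_into \<V> ` {..<n})" for n
      have "from_nat_into \<V> n \<in> \<U>" for n
        using from_nat_into[OF False] \<V>(1) by auto
      then have VS: "L2_of (indicator (V n) :: 'a \<Rightarrow> real) \<in> closure D" for n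
      proof -
        have "L2_of (indicator (V n) :: 'a \<Rightarrow> real) \<in> S"
          unfolding S_def V_def using \<open>\<And>n. from_nat_into \<V> n \<in> \<U>\<close>
          by (intro image_eqI[of _ _ "from_nat_into \<V> ` {..<n}"]) auto
        then show ?thesis using D(2) by blast
      qed
      have Vo: "open (V n)" for n
        unfolding V_def using \<open>\<And>n. from_nat_into \<V> n \<in> \<U>\<close> topological_basis_open[OF \<U>(2)] by auto
      have VU: "V n \<subseteq> U" for n
        unfolding V_def using from_nat_into[OF False] \<V>(2) by blast
      have Un: "(\<Inter>n. U - V n) = {}"
      proof -
        have "\<exists>n. x \<in> V n" if x: "x \<in> U" for x
        proof -
          obtain W where W: "W \<in> \<V>" "x \<in> W" using x \<V>(2) by blast
          obtain k where "from_nat_into \<V> k = W"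
            using from_nat_into_surj[OF \<open>countable \<V>\<close> W(1)] by blast
          then have "x \<in> V (Suc k)" unfolding V_def using W by auto
          then show ?thesis ..
        qed
        then show ?thesis by auto
      qed
      have "(\<lambda>n. measure lborel (U - V n)) \<longlonglongrightarrow> measure lborel (\<Inter>n. U - V n)"
      proof (rule Lim_measure_decseq)
        show "range (\<lambda>n. U - V n) \<subseteq> sets lborel" using U Vo by auto
        show "decseq (\<lambda>n. U - V n)" unfolding V_def decseq_def by fastforce
        show "emeasure lborel (U - V n) \<noteq> \<infinity>" for n
          using U emeasure_mono[of "U - V n" U lborel] by (auto simp: top_unique less_top)
      qed
      then have "(\<lambda>n. sqrt (measure lborel (U - V n))) \<longlonglongrightarrow> sqrt 0"
        unfolding Un by (intro tendsto_real_sqrt) simp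
      then have "(\<lambda>n. L2_of (indicator (V n) :: 'a \<Rightarrow> real)) \<longlonglongrightarrow> L2_of (indicator U)"
        using Vo VU U by (subst tendsto_dist_iff) (simp add: dist_L2_indicator)
      with closed_closure VS show ?thesis
        by (rule closed_sequentially)
    qed
  qed
  have "L2_of (indicator A) \<in> closure D"
    if A: "A \<in> sets borel" "emeasure lborel A < \<infinity>" for A :: "'a set"
  proof -
    have "\<exists>U. open U \<and> A \<subseteq> U \<and> emeasure lborel (U - A) < ennreal (1 / Suc n)" for n
      using outer_regular_lborel[OF A(1), of "1 / Suc n"] by auto
    then obtain U where U: "\<And>n. open (U n)" "\<And>n. A \<subseteq> U n"
        "\<And>n. emeasure lborel (U n - A) < ennreal (1 / Suc n)"
      by metis
    have Uf: "emeasure lborel (U n) < \<infinity>" for n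
    proof -
      have "emeasure lborel (U n) = emeasure lborel (A \<union> (U n - A))"
        using U(2)[of n] by (simp add: Un_absorb1)
      also have "\<dots> \<le> emeasure lborel A + emeasure lborel (U n - A)"
        using A U(1)[of n] by (intro emeasure_subadditive) auto
      also have "\<dots> < \<infinity>"
        using A(2) less_trans[OF U(3)[of n] ennreal_less_top] by simp
      finally show ?thesis .
    qed
    have Um: "measure lborel (U n - A) \<le> 1 / Suc n" for n
      using U(3)[of n] unfolding measure_def by (intro enn2real_leI) auto
    have "(\<lambda>n. measure lborel (U n - A)) \<longlonglongrightarrow> 0"
      by (rule tendsto_sandwich[OF _ _ tendsto_const LIMSEQ_inverse_real_of_nat])
        (use Um in \<open>auto simp: inverse_eq_divide\<close>)
    then have "(\<lambda>n. sqrt (measure lborel (U n - A))) \<longlonglongrightarrow> sqrt 0"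
      by (intro tendsto_real_sqrt)
    then have "(\<lambda>n. L2_of (indicator (U n) :: 'a \<Rightarrow> real)) \<longlonglongrightarrow> L2_of (indicator A)"
      using U A Uf
      by (subst tendsto_dist_iff, subst dist_commute) (simp add: dist_L2_indicator)
    with closed_closure op[OF U(1) Uf] show ?thesis
      by (rule closed_sequentially)
  qed
  then have "closure D = UNIV"
    by (intro closed_subspace_L2_eq_UNIV D closed_closure)
  then show ?thesis using D(1) by blast
qed

instance L2 :: (euclidean_space) second_countable_topology
proof
  obtain D :: "'a L2 set" where D: "countable D" "closure D = UNIV"
    using L2_countable_dense by blast
  define B where "B = (\<lambda>(d, n). ball d (1 / Suc n)) ` (D \<times> (UNIV :: nat set))"
  have "topological_basis B"
  proof (rule topological_basisI)
    show "open X" if "X \<in> B" for X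
      using that by (auto simp: B_def)
  next
    fix X and x :: "'a L2" assume "open X" "x \<in> X"
    then obtain e where e: "e > 0" "ball x e \<subseteq> X"
      using open_contains_ball by blast
    obtain n where n: "1 / Suc n < e / 2"
      using e(1) nat_approx_posE[of "e / 2"] by auto
    have "x \<in> closure D" using D by simp
    then obtain d where d: "d \<in> D" "dist d x < 1 / Suc n"
      unfolding closure_approachable by (meson of_nat_0_less_iff zero_less_Suc zero_less_divide_1_iff)
    have "ball d (1 / Suc n) \<subseteq> ball x e"
    proof
      fix y assume "y \<in> ball d (1 / Suc n)"
      then have "dist d y < 1 / Suc n" by simp
      then have "dist x y < e"
        using d n dist_triangle[of x y d] by (simp add: dist_commute)
      then show "y \<in> ball x e" by simp
    qed
    then show "\<exists>B'\<in>B. x \<in> B' \<and> B' \<subseteq> X"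
      using d e by (intro bexI[of _ "ball d (1 / Suc n)"]) (auto simp: B_def)
  qed
  moreover have "countable B"
    unfolding B_def using D by auto
  ultimately show "\<exists>B :: 'a L2 set set. countable B \<and> open = generate_topology B"
    using topological_basis_imp_subbasis by blast
qed


section \<open>Fourier multipliers on \<open>L\<^sup>2\<close> and the Sobolev space \<open>H\<^sup>1\<close>\<close>

definition fourier_integral :: "('a::euclidean_space \<Rightarrow> real) \<Rightarrow> 'a \<Rightarrow> complex" where
  "fourier_integral f \<xi> = (\<integral>x. of_real (f x) * cis (- (x \<bullet> \<xi>)) \<partial>lborel)"

text \<open>\<open>has_fourier f g\<close>: the function \<open>g\<close> represents the \<open>L\<^sup>2\<close> (Plancherel) Fourier transform of \<open>f\<close>,
  i.e. it is the \<open>L\<^sup>2\<close>-limit, as \<open>R \<rightarrow> \<infinity>\<close>, of the Fourier integrals of \<open>f\<close> cut off to the ball of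
  radius \<open>R\<close>.  By Plancherel's theorem such a \<open>g\<close> exists for every \<open>f \<in> L\<^sup>2\<close> and is unique almost
  everywhere.\<close>

definition has_fourier :: "('a::euclidean_space \<Rightarrow> real) \<Rightarrow> ('a \<Rightarrow> complex) \<Rightarrow> bool" where
  "has_fourier f g \<longleftrightarrow> square_integrable f \<and> square_integrable g \<and>
    (\<lambda>R::nat. \<integral>\<^sup>+\<xi>. ennreal ((norm (fourier_integral (\<lambda>x. indicator (cball 0 (real R)) x * f x) \<xi>
        - g \<xi>))\<^sup>2) \<partial>lborel) \<longlonglongrightarrow> 0"

text \<open>\<open>has_multiplier m f w\<close>: the Fourier multiplier with symbol \<open>m\<close> maps \<open>f \<in> L\<^sup>2\<close> to \<open>w\<close>.  For a
  bounded, measurable, real and even symbol (the only kind used below) there is exactly one such \<open>w\<close>.\<close>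

definition has_multiplier ::
    "('a::euclidean_space \<Rightarrow> real) \<Rightarrow> ('a \<Rightarrow> real) \<Rightarrow> 'a L2 \<Rightarrow> bool" where
  "has_multiplier m f w \<longleftrightarrow>
    (\<exists>g. has_fourier f g \<and> has_fourier (L2_fun w) (\<lambda>\<xi>. of_real (m \<xi>) * g \<xi>))"

definition in_H1 :: "('a::euclidean_space \<Rightarrow> real) \<Rightarrow> bool" where
  "in_H1 f \<longleftrightarrow>
    (\<exists>g. has_fourier f g \<and> integrable lborel (\<lambda>\<xi>. (1 + (norm \<xi>)\<^sup>2) * (norm (g \<xi>))\<^sup>2))"


section \<open>Mild solutions of the system of damped wave equations\<close>

definition K_hat :: "real \<Rightarrow> 'a::euclidean_space \<Rightarrow> real" where
  "K_hat t \<xi> =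
    (if norm \<xi> < 1 / 2 then
       exp (- t / 2) * sinh (t * sqrt (1 / 4 - (norm \<xi>)\<^sup>2)) / sqrt (1 / 4 - (norm \<xi>)\<^sup>2)
     else if norm \<xi> > 1 / 2 then
       exp (- t / 2) * sin (t * sqrt ((norm \<xi>)\<^sup>2 - 1 / 4)) / sqrt ((norm \<xi>)\<^sup>2 - 1 / 4)
     else t * exp (- t / 2))"

definition dt_K_hat :: "real \<Rightarrow> 'a::euclidean_space \<Rightarrow> real" where
  "dt_K_hat t \<xi> = deriv (\<lambda>\<tau>. K_hat \<tau> \<xi>) t"

definition linear_part ::
    "('a::euclidean_space \<Rightarrow> real) \<Rightarrow> ('a \<Rightarrow> real) \<Rightarrow> real \<Rightarrow> 'a L2 \<Rightarrow> bool" where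
  "linear_part w0 w1 t wlin \<longleftrightarrow>
    (\<exists>a b. has_multiplier (\<lambda>\<xi>. K_hat t \<xi> + dt_K_hat t \<xi>) w0 a \<and>
           has_multiplier (K_hat t) w1 b \<and> wlin = a + b)"

text \<open>\<open>D\<close> is the \<open>L\<^sup>2\<close>-valued Bochner integral \<open>\<integral>\<^sub>0\<^sup>t K(t - s) * F(s) ds\<close>.  The inhomogeneity \<open>F(s)\<close>
  is only required to be in \<open>L\<^sup>2\<close> for almost every \<open>s\<close>, so the integrand \<open>G\<close> is determined almost
  everywhere.\<close>

definition duhamel_part ::
    "(real \<Rightarrow> 'a::euclidean_space \<Rightarrow> real) \<Rightarrow> real \<Rightarrow> 'a L2 \<Rightarrow> bool" where
  "duhamel_part F t D \<longleftrightarrow>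
    (\<exists>G. (AE s in lborel. s \<in> {0..t} \<longrightarrow> has_multiplier (K_hat (t - s)) (F s) (G s)) \<and>
         set_integrable lborel {0..t} G \<and> D = (LINT s:{0..t}|lborel. G s))"

definition time_interval :: "ereal \<Rightarrow> real set" where
  "time_interval T = {t. 0 \<le> t \<and> ereal t < T}"

definition L1loc_L2 :: "ereal \<Rightarrow> (real \<Rightarrow> 'a::euclidean_space \<Rightarrow> real) \<Rightarrow> bool" where
  "L1loc_L2 T F \<longleftrightarrow>
    (AE s in lborel. s \<in> time_interval T \<longrightarrow> square_integrable (F s)) \<and>
    (\<forall>t\<in>time_interval T.
      set_integrable lborel {0..t} (\<lambda>s. if square_integrable (F s) then L2_of (F s) else 0))"

text \<open>\<open>\<bar>x\<bar>\<^sup>a\<close> with the convention \<open>\<bar>x\<bar>\<^sup>0 = 1\<close> also for \<open>x = 0\<close>, whereas \<^term>\<open>0 powr 0 = 0\<close>.\<close>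

definition abs_pow :: "real \<Rightarrow> real \<Rightarrow> real" where
  "abs_pow x a = (if a = 0 then 1 else \<bar>x\<bar> powr a)"

definition mild_solution ::
    "real \<Rightarrow> real \<Rightarrow> real \<Rightarrow> real \<Rightarrow>
     ('a::euclidean_space \<Rightarrow> real) \<Rightarrow> ('a \<Rightarrow> real) \<Rightarrow> ('a \<Rightarrow> real) \<Rightarrow> ('a \<Rightarrow> real) \<Rightarrow>
     ereal \<Rightarrow> (real \<Rightarrow> 'a L2) \<Rightarrow> (real \<Rightarrow> 'a L2) \<Rightarrow> bool" where
  "mild_solution \<alpha> p q \<beta> u0 u1 v0 v1 T u v \<longleftrightarrow>
    (let Fu = (\<lambda>s x. abs_pow (L2_fun (u s) x) \<alpha> * abs_pow (L2_fun (v s) x) p);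
         Fv = (\<lambda>s x. abs_pow (L2_fun (u s) x) q * abs_pow (L2_fun (v s) x) \<beta>)
     in 0 < T \<and>
        continuous_on (time_interval T) u \<and> continuous_on (time_interval T) v \<and>
        L1loc_L2 T Fu \<and> L1loc_L2 T Fv \<and>
        (\<forall>t\<in>time_interval T.
          (\<exists>ulin D. linear_part u0 u1 t ulin \<and> duhamel_part Fu t D \<and> u t = ulin + D) \<and>
          (\<exists>vlin D. linear_part v0 v1 t vlin \<and> duhamel_part Fv t D \<and> v t = vlin + D)))"

definition global_mild_solution ::
    "real \<Rightarrow> real \<Rightarrow> real \<Rightarrow> real \<Rightarrow>
     ('a::euclidean_space \<Rightarrow> real) \<Rightarrow> ('a \<Rightarrow> real) \<Rightarrow> ('a \<Rightarrow> real) \<Rightarrow> ('a \<Rightarrow> real) \<Rightarrow>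
     (real \<Rightarrow> 'a L2) \<Rightarrow> (real \<Rightarrow> 'a L2) \<Rightarrow> bool" where
  "global_mild_solution \<alpha> p q \<beta> u0 u1 v0 v1 u v \<longleftrightarrow> mild_solution \<alpha> p q \<beta> u0 u1 v0 v1 \<infinity> u v"

end

theory Submission
  imports "HOL-Probability.Characteristic_Functions" "HOL-Real_Asymp.Real_Asymp" Defs
begin

text \<open>
  In dimension \<open>n \<le> 3\<close> the multiplier \<open>K_hat t\<close> preserves positivity: for the free wave equation this
  is Kirchhoff's formula, and the damped equation is a positive perturbation of it.  For large \<open>t\<close> the
  multiplier is close to the heat semigroup, so that (using \<open>u\<^sub>1, v\<^sub>1 \<in> L\<^sup>1 \<inter> H\<^sup>1\<close>) both components are at
  least \<open>c t\<^sup>-\<^sup>n\<^sup>/\<^sup>2\<close> on the ball \<open>\<bar>x\<bar> \<le> \<surd>t\<close>.  If \<open>u \<ge> c t\<^sup>-\<^sup>a\<close> and \<open>v \<ge> c t\<^sup>-\<^sup>b\<close> there, then Duhamel's formula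
  improves these bounds to the exponents \<open>a' = \<alpha> a + p b - 1\<close> and \<open>b' = q a + \<beta> b - 1\<close>.  The hypothesis
  guarantees that this map, capped at \<open>n / 2\<close>, has no fixed point, so the exponents decrease
  to \<open>-\<infinity>\<close> and \<open>u\<close> and \<open>v\<close> become arbitrarily large on a fixed ball.  Once they exceed a certain
  constant, iterating Duhamel's formula over time steps \<open>2\<^sup>-\<^sup>k\<close> on shrinking balls (finite speed of
  propagation), with \<open>min (p + \<alpha>) (q + \<beta>) > 1\<close>, forces them to be infinite in finite time.
\<close>

section \<open>Gaussian integrals and translations\<close>

text \<open>The obstacle is that the kernel is a measure and not a function in dimension three, and
  that a mild solution is only a curve of L2 classes whose multipliers are known through their
  Fourier transforms. Hence nothing is evaluated pointwise: every estimate bounds from below the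
  pairing with the indicator of an arbitrary Borel set E in a ball by m * vol E, which amounts to an
  almost everywhere bound by m on that ball. Removing the factor exp (- t / 2) turns the damped
  equation into the wave equation with mass term - b at b = 1 / 4. Its symbol satisfies d/db d/ds
  \<open>oscillator s (z - b)\<close> = s / 2 * \<open>oscillator s (z - b)\<close>. The factor s /
  2 is nonnegative and free of the frequency, so the identity survives pairing and carries
  positivity from b = 0 to b = 1 / 4. H1 is used at high frequencies, where the symbol is bounded by
  a multiple of exp (- t / 64) / |\<xi>| and does not decay faster in \<xi>. The transform of the
  datum is integrable against 1 / |\<xi>| there because |\<xi>|^-4 is integrable at infinity for n
  <= 3.\<close>

lemma lborel_prod_Basis:
  fixes f :: "'a::euclidean_space \<Rightarrow> real \<Rightarrow> complex"
  assumes f: "\<And>b. b \<in> Basis \<Longrightarrow> integrable lborel (f b)"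
  shows "integrable lborel (\<lambda>x. \<Prod>b\<in>Basis. f b (x \<bullet> b))"
    and "(\<integral>x. (\<Prod>b\<in>Basis. f b (x \<bullet> b)) \<partial>lborel) = (\<Prod>b\<in>Basis. \<integral>x. f b x \<partial>lborel)"
proof -
  interpret P: product_sigma_finite "\<lambda>_::'a. lborel :: real measure" ..
  have m: "f b \<in> borel_measurable borel" if "b \<in> Basis" for b
    using borel_measurable_integrable[OF f[OF that]] by simp
  have meas: "(\<lambda>x::'a. \<Prod>b\<in>Basis. f b (x \<bullet> b)) \<in> borel_measurable borel"
    using m by (intro borel_measurable_prod measurable_compose[OF _ m]) auto
  have T: "(\<lambda>y. \<Sum>b\<in>Basis. y b *\<^sub>R b :: 'a) \<in> measurable (Pi\<^sub>M Basis (\<lambda>_. lborel)) borel"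
    by measurable
  have eq: "(\<Prod>b\<in>Basis. f b ((\<Sum>b\<in>Basis. y b *\<^sub>R b :: 'a) \<bullet> b)) = (\<Prod>b\<in>Basis. f b (y b))" for y
    by (intro prod.cong refl) simp
  let ?L = "distr (\<Pi>\<^sub>M b\<in>Basis. lborel) borel (\<lambda>f. \<Sum>b\<in>Basis. f b *\<^sub>R b :: 'a)"
  have "integrable ?L (\<lambda>x. \<Prod>b\<in>Basis. f b (x \<bullet> b))"
    unfolding integrable_distr_eq[OF T meas] eq by (rule P.product_integrable_prod) (auto intro: f)
  then show "integrable lborel (\<lambda>x::'a. \<Prod>b\<in>Basis. f b (x \<bullet> b))"
    unfolding lborel_eq[where 'a='a, symmetric] .
  have "(\<integral>x. (\<Prod>b\<in>Basis. f b (x \<bullet> b)) \<partial>?L) = (\<Prod>b\<in>Basis. \<integral>x. f b x \<partial>lborel)"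
    unfolding integral_distr[OF T meas] eq by (rule P.product_integral_prod) (auto intro: f)
  then show "(\<integral>x. (\<Prod>b\<in>(Basis::'a set). f b (x \<bullet> b)) \<partial>lborel) = (\<Prod>b\<in>Basis. \<integral>x. f b x \<partial>lborel)"
    unfolding lborel_eq[where 'a='a, symmetric] .
qed

lemma borel_measurable_cis [measurable]: "cis \<in> borel_measurable borel"
  by (intro borel_measurable_continuous_onI continuous_intros)

text \<open>A rescaled characteristic function of the standard normal law: with
  \<open>d\<^sup>2 = 2 * \<epsilon>\<close> the substitution of d x for x turns exp (- x^2 / 2) into
  exp (- \<epsilon> x^2), and the frequency c becomes c / d.\<close>

lemma gaussian_fourier_real:
  fixes \<epsilon> c :: real
  assumes \<epsilon>: "\<epsilon> > 0"
  shows "integrable lborel (\<lambda>x. of_real (exp (- \<epsilon> * x\<^sup>2)) * cis (c * x))"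
    and "(\<integral>x. of_real (exp (- \<epsilon> * x\<^sup>2)) * cis (c * x) \<partial>lborel)
      = of_real (sqrt (pi / \<epsilon>) * exp (- c\<^sup>2 / (4 * \<epsilon>)))"
proof -
  define d where "d = sqrt (2 * \<epsilon>)"
  have d: "d > 0" "d\<^sup>2 = 2 * \<epsilon>" using \<epsilon> by (auto simp: d_def)
  define t where "t = c / d"
  let ?g = "\<lambda>x. of_real (std_normal_density x) * cis (t * x)"
  have "integrable lborel std_normal_density" by (rule integrable_normal_density) simp
  then have "integrable lborel (\<lambda>x. complex_of_real (std_normal_density x))"
    by (rule integrable_of_real)
  then have ig: "integrable lborel ?g"
    by (rule Bochner_Integration.integrable_bound) (auto simp: norm_mult)
  have "(\<integral>x. ?g x \<partial>lborel) = char std_normal_distribution t"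
    unfolding char_def
    by (subst integral_density) (auto simp: normal_density_nonneg cis_conv_exp scaleR_conv_of_real mult_ac)
  then have vg: "(\<integral>x. ?g x \<partial>lborel) = of_real (exp (- t\<^sup>2 / 2))"
    by (simp add: char_std_normal_distribution)
  have eq: "of_real (exp (- \<epsilon> * x\<^sup>2)) * cis (c * x) = of_real (sqrt (2 * pi)) * ?g (0 + d * x)" for x
  proof -
    have "(d * x)\<^sup>2 / 2 = \<epsilon> * x\<^sup>2" using d by (simp add: power_mult_distrib)
    then have "std_normal_density (d * x) = exp (- \<epsilon> * x\<^sup>2) / sqrt (2 * pi)"
      by (simp add: std_normal_density_def)
    then have "exp (- \<epsilon> * x\<^sup>2) = sqrt (2 * pi) * std_normal_density (d * x)" by simp
    moreover have "t * (d * x) = c * x" using d by (simp add: t_def)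
    ultimately show ?thesis by (simp only: add_0 of_real_mult mult.assoc)
  qed
  show "integrable lborel (\<lambda>x. of_real (exp (- \<epsilon> * x\<^sup>2)) * cis (c * x))"
    unfolding eq using d by (intro integrable_mult_right lborel_integrable_real_affine[OF ig]) auto
  have "(\<integral>x. ?g x \<partial>lborel) = \<bar>d\<bar> *\<^sub>R (\<integral>x. ?g (0 + d * x) \<partial>lborel)"
    using d by (intro lborel_integral_real_affine) auto
  then have "(\<integral>x. ?g (0 + d * x) \<partial>lborel) = of_real (exp (- t\<^sup>2 / 2) / d)"
    using d unfolding vg by (simp add: scaleR_conv_of_real field_simps)
  moreover have "sqrt (2 * pi) * (exp (- t\<^sup>2 / 2) / d) = sqrt (pi / \<epsilon>) * exp (- c\<^sup>2 / (4 * \<epsilon>))"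
  proof -
    have "t\<^sup>2 / 2 = c\<^sup>2 / (4 * \<epsilon>)" using d by (simp add: t_def power_divide)
    moreover have "sqrt (2 * pi) / d = sqrt (pi / \<epsilon>)"
      unfolding d_def by (subst real_sqrt_divide[symmetric]) simp
    ultimately show ?thesis by (metis times_divide_eq_left times_divide_eq_right minus_divide_left)
  qed
  ultimately show "(\<integral>x. of_real (exp (- \<epsilon> * x\<^sup>2)) * cis (c * x) \<partial>lborel)
      = of_real (sqrt (pi / \<epsilon>) * exp (- c\<^sup>2 / (4 * \<epsilon>)))"
    unfolding eq by (subst integral_mult_right_zero) (metis of_real_mult)
qed

lemma norm_power2_Basis: "(norm (x::'a::euclidean_space))\<^sup>2 = (\<Sum>b\<in>Basis. (x \<bullet> b)\<^sup>2)"
  by (subst power2_norm_eq_inner, subst euclidean_inner, rule sum.cong) (simp_all only: power2_eq_square)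

lemma cis_sum: "finite A \<Longrightarrow> cis (\<Sum>a\<in>A. f a) = (\<Prod>a\<in>A. cis (f a))"
  by (induction A rule: finite_induct) (auto simp flip: cis_mult)

text \<open>Both the Gaussian and the character factor over an orthonormal basis, which reduces the
  integral to one dimension.\<close>

lemma gaussian_fourier:
  fixes y :: "'a::euclidean_space"
  assumes \<epsilon>: "\<epsilon> > 0"
  shows "integrable lborel (\<lambda>\<xi>::'a. of_real (exp (- \<epsilon> * (norm \<xi>)\<^sup>2)) * cis (y \<bullet> \<xi>))"
    and "(\<integral>\<xi>. of_real (exp (- \<epsilon> * (norm \<xi>)\<^sup>2)) * cis (y \<bullet> \<xi>) \<partial>lborel)
      = of_real (sqrt (pi / \<epsilon>) ^ DIM('a) * exp (- (norm y)\<^sup>2 / (4 * \<epsilon>)))"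
proof -
  let ?f = "\<lambda>b x. of_real (exp (- \<epsilon> * x\<^sup>2)) * cis ((y \<bullet> b) * x)"
  have eq: "of_real (exp (- \<epsilon> * (norm \<xi>)\<^sup>2)) * cis (y \<bullet> \<xi>) = (\<Prod>b\<in>Basis. ?f b (\<xi> \<bullet> b))"
    for \<xi> :: 'a
  proof -
    have "exp (- \<epsilon> * (norm \<xi>)\<^sup>2) = (\<Prod>b\<in>Basis. exp (- \<epsilon> * (\<xi> \<bullet> b)\<^sup>2))"
      by (simp add: norm_power2_Basis sum_distrib_left exp_sum[symmetric] sum_negf[symmetric])
    moreover have "cis (y \<bullet> \<xi>) = (\<Prod>b\<in>Basis. cis ((y \<bullet> b) * (\<xi> \<bullet> b)))"
      by (simp add: euclidean_inner[of y \<xi>] cis_sum)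
    ultimately show ?thesis by (simp add: prod.distrib)
  qed
  show "integrable lborel (\<lambda>\<xi>::'a. of_real (exp (- \<epsilon> * (norm \<xi>)\<^sup>2)) * cis (y \<bullet> \<xi>))"
    unfolding eq by (rule lborel_prod_Basis(1), rule gaussian_fourier_real(1)[OF \<epsilon>])
  have "(\<integral>\<xi>. of_real (exp (- \<epsilon> * (norm \<xi>)\<^sup>2)) * cis (y \<bullet> \<xi>) \<partial>lborel)
      = (\<Prod>b\<in>(Basis::'a set). \<integral>x. ?f b x \<partial>lborel)"
    unfolding eq by (rule lborel_prod_Basis(2), rule gaussian_fourier_real(1)[OF \<epsilon>])
  also have "\<dots> = (\<Prod>b\<in>(Basis::'a set). of_real (sqrt (pi / \<epsilon>) * exp (- (y \<bullet> b)\<^sup>2 / (4 * \<epsilon>))))"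
    by (intro prod.cong refl gaussian_fourier_real(2)[OF \<epsilon>])
  also have "\<dots> = of_real (sqrt (pi / \<epsilon>) ^ DIM('a) * (\<Prod>b\<in>(Basis::'a set). exp (- (y \<bullet> b)\<^sup>2 / (4 * \<epsilon>))))"
    by (simp only: of_real_prod[symmetric] prod.distrib prod_constant)
  also have "(\<Prod>b\<in>(Basis::'a set). exp (- (y \<bullet> b)\<^sup>2 / (4 * \<epsilon>))) = exp (- (norm y)\<^sup>2 / (4 * \<epsilon>))"
    by (subst exp_sum[symmetric]) (simp_all add: norm_power2_Basis sum_divide_distrib sum_negf)
  finally show "(\<integral>\<xi>. of_real (exp (- \<epsilon> * (norm \<xi>)\<^sup>2)) * cis (y \<bullet> \<xi>) \<partial>lborel)
      = of_real (sqrt (pi / \<epsilon>) ^ DIM('a) * exp (- (norm y)\<^sup>2 / (4 * \<epsilon>)))" .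
qed

lemma gaussian_integral:
  assumes \<epsilon>: "\<epsilon> > 0"
  shows "integrable lborel (\<lambda>\<xi>::'a::euclidean_space. exp (- \<epsilon> * (norm \<xi>)\<^sup>2))"
    and "(\<integral>\<xi>. exp (- \<epsilon> * (norm (\<xi>::'a))\<^sup>2) \<partial>lborel) = sqrt (pi / \<epsilon>) ^ DIM('a)"
proof -
  note i = gaussian_fourier(1)[OF \<epsilon>, of "0::'a"]
  show "integrable lborel (\<lambda>\<xi>::'a. exp (- \<epsilon> * (norm \<xi>)\<^sup>2))"
    using integrable_Re[OF i] by simp
  show "(\<integral>\<xi>. exp (- \<epsilon> * (norm (\<xi>::'a))\<^sup>2) \<partial>lborel) = sqrt (pi / \<epsilon>) ^ DIM('a)"
    using integral_Re[OF i] gaussian_fourier(2)[OF \<epsilon>, of "0::'a"] by (simp flip: of_real_power)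
qed

lemma lborel_distr_minus: "distr lborel borel (\<lambda>x. x - y) = (lborel :: 'a::euclidean_space measure)"
proof -
  have "(\<lambda>x. x - y) = (+) (- y)" by (simp add: fun_eq_iff)
  then show ?thesis by (simp only: lborel_distr_plus)
qed

lemma AE_lborel_translate:
  fixes y :: "'a::euclidean_space"
  assumes "AE x in lborel. P x"
  shows "AE x in lborel. P (x - y)"
proof -
  have m: "(\<lambda>x. x - y) \<in> measurable lborel borel" by simp
  show ?thesis
    by (rule AE_distrD[OF m]) (use assms in \<open>unfold lborel_distr_minus\<close>)
qed

lemma lborel_translate:
  fixes f :: "'a::euclidean_space \<Rightarrow> 'b::{banach, second_countable_topology}"
  assumes f: "f \<in> borel_measurable borel"
  shows "integrable lborel (\<lambda>x. f (x - y)) \<longleftrightarrow> integrable lborel f"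
    and "(\<integral>x. f (x - y) \<partial>lborel) = (\<integral>x. f x \<partial>lborel)"
proof -
  have m: "(\<lambda>x. x - y) \<in> borel_measurable lborel" by simp
  show "integrable lborel (\<lambda>x. f (x - y)) \<longleftrightarrow> integrable lborel f"
    using integrable_distr_eq[OF m f] unfolding lborel_distr_minus by (rule sym)
  show "(\<integral>x. f (x - y) \<partial>lborel) = (\<integral>x. f x \<partial>lborel)"
    using integral_distr[OF m f] unfolding lborel_distr_minus by (rule sym)
qed

lemma square_integrable_translate:
  assumes "square_integrable f"
  shows "square_integrable (\<lambda>x. f (x - y))"
  using assms lborel_translate(1)[of "\<lambda>x. (norm (f x))\<^sup>2" y]
  by (auto simp: square_integrable_def)

lemma lborel_reflect:
  fixes f :: "'a::euclidean_space \<Rightarrow> real"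
  assumes f: "f \<in> borel_measurable borel"
  shows "integrable lborel (\<lambda>y. f (x - y)) \<longleftrightarrow> integrable lborel f"
    and "(\<integral>y. f (x - y) \<partial>lborel) = (\<integral>y. f y \<partial>lborel)"
proof -
  have eq: "distr lborel borel (\<lambda>y. x - y) = (lborel::'a measure)"
    using lborel_affine[of "-1" x] by (simp add: density_1)
  have m: "(\<lambda>y. x - y) \<in> borel_measurable lborel" by simp
  show "integrable lborel (\<lambda>y. f (x - y)) \<longleftrightarrow> integrable lborel f"
    using integrable_distr_eq[OF m f] unfolding eq by simp
  show "(\<integral>y. f (x - y) \<partial>lborel) = (\<integral>y. f y \<partial>lborel)"
    using integral_distr[OF m f] unfolding eq by simp
qed

section \<open>Plancherel's theorem\<close>

lemma inner_L2_of:
  assumes "square_integrable f" "square_integrable g"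
  shows "inner (L2_of f) (L2_of g) = (\<integral>x. f x * g x \<partial>lborel)"
  using inner_L2.abs_eq[of f g] assms by (simp add: L2_eq_def)

text \<open>Its purpose is the continuity at 0 of the autocorrelation of an L2 function, on which
  the proof of Plancherel's identity rests. The choice of representative is harmless by
  \<open>translate_L2_of\<close>.\<close>

definition translate_L2 :: "'a::euclidean_space \<Rightarrow> 'a L2 \<Rightarrow> 'a L2" where
  "translate_L2 y w = L2_of (\<lambda>x. L2_fun w (x - y))"

lemma translate_L2_of:
  assumes f: "square_integrable f"
  shows "translate_L2 y (L2_of f) = L2_of (\<lambda>x. f (x - y))"
  unfolding translate_L2_def
  using AE_lborel_translate[OF L2_fun_L2_of[OF f], of y] f
  by (subst L2_of_eq_iff) (auto intro: square_integrable_translate)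

lemma translate_L2_diff: "translate_L2 y (w - z) = translate_L2 y w - translate_L2 y z"
proof -
  have "w - z = L2_of (\<lambda>x. L2_fun w x - L2_fun z x)"
    by (subst L2_of_diff) auto
  then have "translate_L2 y (w - z) = L2_of (\<lambda>x. L2_fun w (x - y) - L2_fun z (x - y))"
    by (simp add: translate_L2_of square_integrable_diff)
  also have "\<dots> = translate_L2 y w - translate_L2 y z"
    unfolding translate_L2_def by (intro L2_of_diff square_integrable_translate) auto
  finally show ?thesis .
qed

lemma translate_L2_add: "translate_L2 y (w + z) = translate_L2 y w + translate_L2 y z"
proof -
  have "w + z = L2_of (\<lambda>x. L2_fun w x + L2_fun z x)"
    by (subst L2_of_add) auto
  then have "translate_L2 y (w + z) = L2_of (\<lambda>x. L2_fun w (x - y) + L2_fun z (x - y))"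
    by (simp add: translate_L2_of square_integrable_add)
  also have "\<dots> = translate_L2 y w + translate_L2 y z"
    unfolding translate_L2_def by (intro L2_of_add square_integrable_translate) auto
  finally show ?thesis .
qed

lemma translate_L2_scaleR: "translate_L2 y (c *\<^sub>R w) = c *\<^sub>R translate_L2 y w"
proof -
  have "c *\<^sub>R w = L2_of (\<lambda>x. c * L2_fun w x)"
    by (subst L2_of_scaleR) auto
  then have "translate_L2 y (c *\<^sub>R w) = L2_of (\<lambda>x. c * L2_fun w (x - y))"
    by (simp add: translate_L2_of square_integrable_scale)
  also have "\<dots> = c *\<^sub>R translate_L2 y w"
    unfolding translate_L2_def by (intro L2_of_scaleR square_integrable_translate) auto
  finally show ?thesis .
qed

lemma norm_translate_L2: "norm (translate_L2 y w) = norm w"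
proof -
  have m: "(\<lambda>x. (L2_fun w x)\<^sup>2) \<in> borel_measurable borel"
    using square_integrable_measurable[OF square_integrable_L2_fun[of w]] by simp
  have "norm (translate_L2 y w) = sqrt (\<integral>x. (L2_fun w (x - y))\<^sup>2 \<partial>lborel)"
    unfolding translate_L2_def by (intro norm_L2_of square_integrable_translate) auto
  also have "\<dots> = sqrt (\<integral>x. (L2_fun w x)\<^sup>2 \<partial>lborel)"
    using lborel_translate(2)[OF m] by simp
  also have "\<dots> = norm w"
    using norm_L2_of[of "L2_fun w"] by simp
  finally show ?thesis .
qed

text \<open>Translations are isometries, so |T_y w - w|^2 = 2 <w, w> - 2 <w, T_y w>. Strong
  continuity is thereby reduced to a scalar limit that dominated convergence can handle.\<close>

lemma translate_L2_tendsto_iff: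
  "(\<lambda>y. translate_L2 y w) \<midarrow>0\<rightarrow> w \<longleftrightarrow> (\<lambda>y. inner w (translate_L2 y w)) \<midarrow>0\<rightarrow> inner w w"
proof
  assume "(\<lambda>y. translate_L2 y w) \<midarrow>0\<rightarrow> w"
  then show "(\<lambda>y. inner w (translate_L2 y w)) \<midarrow>0\<rightarrow> inner w w"
    by (intro tendsto_inner tendsto_const)
next
  assume *: "(\<lambda>y. inner w (translate_L2 y w)) \<midarrow>0\<rightarrow> inner w w"
  have eq: "(norm (translate_L2 y w - w))\<^sup>2 = 2 * inner w w - 2 * inner w (translate_L2 y w)" for y
  proof -
    have "inner (translate_L2 y w) (translate_L2 y w) = inner w w"
      by (simp add: norm_translate_L2 flip: power2_norm_eq_inner)
    then show ?thesis
      by (simp add: power2_norm_eq_inner inner_diff inner_commute)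
  qed
  have "(\<lambda>y. sqrt ((norm (translate_L2 y w - w))\<^sup>2)) \<midarrow>0\<rightarrow> sqrt (2 * inner w w - 2 * inner w w)"
    unfolding eq by (intro tendsto_intros *)
  then show "(\<lambda>y. translate_L2 y w) \<midarrow>0\<rightarrow> w"
    by (subst LIM_zero_iff[symmetric], subst tendsto_norm_zero_iff[symmetric]) simp
qed

text \<open>Openness gives the pointwise limit: a point of U stays in U under small shifts, and a
  point outside U, even on the boundary, is killed by the unshifted factor
  \<open>indicator U x\<close>.\<close>

lemma translate_L2_indicator_open:
  fixes U :: "'a::euclidean_space set"
  assumes U: "open U" "emeasure lborel U < \<infinity>"
  shows "(\<lambda>y. translate_L2 y (L2_of (indicator U))) \<midarrow>0\<rightarrow> L2_of (indicator U)"
proof -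
  have Ub: "U \<in> sets borel" using U by simp
  have sq: "square_integrable (indicator U :: 'a \<Rightarrow> real)"
    using U by (intro square_integrable_indicator) auto
  have mI: "(indicator U :: 'a \<Rightarrow> real) \<in> borel_measurable borel" using Ub by simp
  have int: "integrable lborel (indicator U :: 'a \<Rightarrow> real)"
    using U by (simp add: integrable_indicator_iff)
  have eq: "inner (L2_of (indicator U)) (translate_L2 y (L2_of (indicator U)))
      = (\<integral>x. indicator U x * indicator U (x - y) \<partial>lborel)" for y
    unfolding translate_L2_of[OF sq] by (rule inner_L2_of[OF sq square_integrable_translate[OF sq]])
  have "(\<lambda>y. \<integral>x. indicator U x * indicator U (x - y) \<partial>lborel)
      \<midarrow>0\<rightarrow> (\<integral>x. indicator U x * (indicator U x :: real) \<partial>lborel)"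
  proof (rule tendsto_at_iff_sequentially[THEN iffD2], intro allI impI)
    fix X :: "nat \<Rightarrow> 'a" assume X: "\<forall>i. X i \<in> UNIV - {0}" "X \<longlonglongrightarrow> 0"
    show "((\<lambda>y. \<integral>x. indicator U x * indicator U (x - y) \<partial>lborel) \<circ> X) \<longlonglongrightarrow>
        (\<integral>x. indicator U x * (indicator U x :: real) \<partial>lborel)"
      unfolding o_def
    proof (rule integral_dominated_convergence[OF _ _ int])
      show "(\<lambda>x. indicator U x * (indicator U x :: real)) \<in> borel_measurable lborel"
        using mI by measurable
      show "(\<lambda>x. indicator U x * (indicator U (x - X i) :: real)) \<in> borel_measurable lborel" for i
        using mI by (intro borel_measurable_times measurable_compose[OF _ mI]) auto
      show "AE x in lborel. (\<lambda>i. indicator U x * (indicator U (x - X i) :: real))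
          \<longlonglongrightarrow> indicator U x * indicator U x"
      proof (rule AE_I2)
        fix x :: 'a
        show "(\<lambda>i. indicator U x * (indicator U (x - X i) :: real)) \<longlonglongrightarrow> indicator U x * indicator U x"
        proof (cases "x \<in> U")
          case True
          have "(\<lambda>i. x - X i) \<longlonglongrightarrow> x - 0" by (intro tendsto_intros X)
          then have "\<forall>\<^sub>F i in sequentially. x - X i \<in> U"
            using U True by (auto dest: topological_tendstoD)
          then have "\<forall>\<^sub>F i in sequentially. indicator U x * (indicator U (x - X i) :: real) = indicator U x * indicator U x"
            using True by (auto elim!: eventually_mono)
          then show ?thesis by (rule tendsto_eventually)
        qed simp
      qed
      show "AE x in lborel. norm (indicator U x * (indicator U (x - X i) :: real)) \<le> indicator U x" for i
        by (auto simp: indicator_def)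
    qed
  qed
  then show ?thesis
    unfolding translate_L2_tendsto_iff eq inner_L2_of[OF sq sq] .
qed

text \<open>Because translations are isometries, the vectors at which they are continuous form a
  closed subspace. It contains the indicators of open sets of finite measure, by outer regularity
  those of all Borel sets of finite measure, and hence everything.\<close>

lemma translate_L2_continuous: "(\<lambda>y. translate_L2 y (w :: 'a::euclidean_space L2)) \<midarrow>0\<rightarrow> w"
proof -
  define V where "V = {w :: 'a L2. (\<lambda>y. translate_L2 y w) \<midarrow>0\<rightarrow> w}"
  have V_sub: "subspace V"
  proof (rule subspaceI)
    have "translate_L2 y 0 = 0" for y :: 'a
      using norm_translate_L2[of y 0] by simp
    then show "0 \<in> V" by (simp add: V_def)
  qed (auto simp: V_def translate_L2_add translate_L2_scaleR intro!: tendsto_add tendsto_scaleR)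
  have V_closed: "closed V"
    unfolding closed_sequential_limits
  proof (intro allI impI, elim conjE)
    fix z w assume z: "\<forall>n::nat. z n \<in> V" "z \<longlonglongrightarrow> w"
    show "w \<in> V"
      unfolding V_def mem_Collect_eq
    proof (rule tendstoI)
      fix e :: real assume "e > 0"
      then have "e / 3 > 0" by simp
      from metric_LIMSEQ_D[OF z(2) this] obtain n where n: "dist (z n) w < e / 3" by blast
      have "(\<lambda>y. translate_L2 y (z n)) \<midarrow>0\<rightarrow> z n" using z by (simp add: V_def)
      from tendstoD[OF this \<open>e / 3 > 0\<close>] show "\<forall>\<^sub>F y in at 0. dist (translate_L2 y w) w < e"
      proof eventually_elim
        case (elim y)
        have "dist (translate_L2 y w) (translate_L2 y (z n)) = dist w (z n)"
          by (simp add: dist_norm norm_translate_L2 flip: translate_L2_diff)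
        then show ?case
          using elim n dist_triangle[of "translate_L2 y w" w "translate_L2 y (z n)"]
            dist_triangle[of "translate_L2 y (z n)" w "z n"] by (simp add: dist_commute)
      qed
    qed
  qed
  have "V = UNIV"
  proof (rule closed_subspace_L2_eq_UNIV[OF V_sub V_closed])
    fix A :: "'a set" assume A: "A \<in> sets borel" "emeasure lborel A < \<infinity>"
    have "\<exists>U. open U \<and> A \<subseteq> U \<and> emeasure lborel (U - A) < ennreal (1 / Suc n)" for n
      using outer_regular_lborel[OF A(1), of "1 / Suc n"] by auto
    then obtain U where U: "\<And>n. open (U n)" "\<And>n. A \<subseteq> U n"
        "\<And>n. emeasure lborel (U n - A) < ennreal (1 / Suc n)"
      by metis
    have Uf: "emeasure lborel (U n) < \<infinity>" for n
    proof -
      have "emeasure lborel (U n) = emeasure lborel (A \<union> (U n - A))"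
        using U(2)[of n] by (simp add: Un_absorb1)
      also have "\<dots> \<le> emeasure lborel A + emeasure lborel (U n - A)"
        using A U(1)[of n] by (intro emeasure_subadditive) auto
      also have "\<dots> < \<infinity>"
        using A(2) less_trans[OF U(3)[of n] ennreal_less_top] by simp
      finally show ?thesis .
    qed
    have Um: "measure lborel (U n - A) \<le> 1 / Suc n" for n
      using U(3)[of n] unfolding measure_def by (intro enn2real_leI) auto
    have "(\<lambda>n. measure lborel (U n - A)) \<longlonglongrightarrow> 0"
      by (rule tendsto_sandwich[OF _ _ tendsto_const LIMSEQ_inverse_real_of_nat])
        (use Um in \<open>auto simp: inverse_eq_divide\<close>)
    then have "(\<lambda>n. sqrt (measure lborel (U n - A))) \<longlonglongrightarrow> sqrt 0"
      by (intro tendsto_real_sqrt)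
    then have "(\<lambda>n. L2_of (indicator (U n) :: 'a \<Rightarrow> real)) \<longlonglongrightarrow> L2_of (indicator A)"
      using U A Uf
      by (subst tendsto_dist_iff, subst dist_commute) (simp add: dist_L2_indicator)
    moreover have "L2_of (indicator (U n)) \<in> V" for n
      unfolding V_def using translate_L2_indicator_open[OF U(1) Uf] by simp
    ultimately show "L2_of (indicator A) \<in> V"
      using closed_sequentially[OF V_closed, of "\<lambda>n. L2_of (indicator (U n))"] by blast
  qed
  then show ?thesis by (auto simp: V_def)
qed

section \<open>Fubini's theorem and Gaussian regularisation\<close>

lemma integrable_pair_mult:
  fixes f :: "'a::euclidean_space \<Rightarrow> 'c::{real_normed_field, banach, second_countable_topology}"
    and g :: "'b::euclidean_space \<Rightarrow> 'c"
  assumes f: "integrable lborel f" and g: "integrable lborel g"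
  shows "integrable (lborel \<Otimes>\<^sub>M lborel) (\<lambda>(x, y). f x * g y)"
proof (rule lborel_pair.Fubini_integrable)
  have [measurable]: "f \<in> borel_measurable borel" "g \<in> borel_measurable borel"
    using f g by (auto dest: borel_measurable_integrable)
  show "(\<lambda>(x, y). f x * g y) \<in> borel_measurable (lborel \<Otimes>\<^sub>M lborel)" by measurable
  show "integrable lborel (\<lambda>x. \<integral>y. norm (case (x, y) of (x, y) \<Rightarrow> f x * g y) \<partial>lborel)"
    using f g by (simp add: norm_mult)
  show "AE x in lborel. integrable lborel (\<lambda>y. case (x, y) of (x, y) \<Rightarrow> f x * g y)"
    using g by simp
qed

lemma borel_measurable_cnj [measurable]: "cnj \<in> borel_measurable borel"
  by (intro borel_measurable_continuous_onI continuous_intros)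

lemma fourier_integral_measurable:
  fixes f :: "'a::euclidean_space \<Rightarrow> real"
  assumes f: "f \<in> borel_measurable borel"
  shows "fourier_integral f \<in> borel_measurable borel"
proof -
  have [measurable]: "f \<in> borel_measurable borel" by fact
  have "(\<lambda>\<xi>. \<integral>x. of_real (f x) * cis (- (x \<bullet> \<xi>)) \<partial>lborel) \<in> borel_measurable borel"
    by measurable
  then show ?thesis by (simp add: fourier_integral_def[abs_def])
qed

lemma integrable_mult_cis:
  fixes \<Phi> :: "'a \<Rightarrow> complex"
  assumes \<Phi>: "integrable M \<Phi>" and g: "g \<in> borel_measurable M"
  shows "integrable M (\<lambda>x. \<Phi> x * cis (g x))"
proof (rule Bochner_Integration.integrable_bound[OF \<Phi>])
  show "(\<lambda>x. \<Phi> x * cis (g x)) \<in> borel_measurable M"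
    using borel_measurable_integrable[OF \<Phi>] measurable_compose[OF g borel_measurable_cis] by simp
qed (simp add: norm_mult)

lemma fourier_integrand_integrable:
  fixes f :: "'a::euclidean_space \<Rightarrow> real"
  assumes f: "integrable lborel f"
  shows "integrable lborel (\<lambda>x. of_real (f x) * cis (- (x \<bullet> \<xi>)))"
  using f by (intro integrable_mult_cis integrable_of_real) auto

lemma norm_fourier_integral_le:
  fixes f :: "'a::euclidean_space \<Rightarrow> real"
  assumes f: "integrable lborel f"
  shows "norm (fourier_integral f \<xi>) \<le> (\<integral>x. \<bar>f x\<bar> \<partial>lborel)"
proof -
  have "norm (fourier_integral f \<xi>) \<le> (\<integral>x. norm (complex_of_real (f x) * cis (- (x \<bullet> \<xi>))) \<partial>lborel)"
    unfolding fourier_integral_def by (rule integral_norm_bound)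
  then show ?thesis by (simp add: norm_mult)
qed

text \<open>Fubini's theorem moves the transform from \<open>f\<close> to \<open>\<Phi>\<close>. The
  latter is complex because it will be a Gaussian times a character, or a Gaussian times a
  conjugated transform.\<close>

lemma fourier_multiplication:
  fixes f :: "'a::euclidean_space \<Rightarrow> real"
  assumes f: "integrable lborel f" and \<Phi>: "integrable lborel \<Phi>"
  shows "(\<integral>\<xi>. \<Phi> \<xi> * fourier_integral f \<xi> \<partial>lborel)
    = (\<integral>x. of_real (f x) * (\<integral>\<xi>. \<Phi> \<xi> * cis (- (x \<bullet> \<xi>)) \<partial>lborel) \<partial>lborel)"
proof -
  have "integrable (lborel \<Otimes>\<^sub>M lborel) (\<lambda>z. (case z of (x, \<xi>) \<Rightarrow> complex_of_real (f x) * \<Phi> \<xi>) * cis (- (fst z \<bullet> snd z)))"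
    by (intro integrable_mult_cis integrable_pair_mult \<Phi> integrable_of_real f) measurable
  then have i: "integrable (lborel \<Otimes>\<^sub>M lborel) (\<lambda>(x, \<xi>). complex_of_real (f x) * \<Phi> \<xi> * cis (- (x \<bullet> \<xi>)))"
    by (simp add: case_prod_unfold)
  have "(\<integral>\<xi>. \<Phi> \<xi> * fourier_integral f \<xi> \<partial>lborel)
      = (\<integral>\<xi>. (\<integral>x. complex_of_real (f x) * \<Phi> \<xi> * cis (- (x \<bullet> \<xi>)) \<partial>lborel) \<partial>lborel)"
    unfolding fourier_integral_def
    by (intro Bochner_Integration.integral_cong refl)
      (simp add: mult_ac flip: integral_mult_right_zero)
  also have "\<dots> = (\<integral>x. (\<integral>\<xi>. complex_of_real (f x) * \<Phi> \<xi> * cis (- (x \<bullet> \<xi>)) \<partial>lborel) \<partial>lborel)"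
    using lborel_pair.Fubini_integral[OF i] .
  finally show ?thesis by (simp add: mult.assoc)
qed

text \<open>This is (2 pi)^n times the heat kernel at time \<epsilon>, the normalisation in which it
  is the Fourier transform of exp (- \<epsilon> |\<xi>|^2).\<close>

definition gauss_kernel :: "real \<Rightarrow> 'a::euclidean_space \<Rightarrow> real" where
  "gauss_kernel \<epsilon> y = sqrt (pi / \<epsilon>) ^ DIM('a) * exp (- (norm y)\<^sup>2 / (4 * \<epsilon>))"

lemma gauss_kernel_nonneg: "\<epsilon> > 0 \<Longrightarrow> gauss_kernel \<epsilon> y \<ge> 0"
  by (simp add: gauss_kernel_def)

lemma gauss_kernel_le: "\<epsilon> > 0 \<Longrightarrow> gauss_kernel \<epsilon> (y::'a::euclidean_space) \<le> sqrt (pi / \<epsilon>) ^ DIM('a)"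
  by (simp add: gauss_kernel_def mult_left_le)

lemma gauss_kernel_measurable [measurable]: "gauss_kernel \<epsilon> \<in> borel_measurable borel"
  unfolding gauss_kernel_def[abs_def] by measurable

lemma gauss_kernel_integral:
  assumes "\<epsilon> > 0"
  shows "integrable lborel (gauss_kernel \<epsilon> :: 'a::euclidean_space \<Rightarrow> real)"
    and "(\<integral>y. gauss_kernel \<epsilon> (y::'a) \<partial>lborel) = (2 * pi) ^ DIM('a)"
proof -
  have e: "1 / (4 * \<epsilon>) > 0" using assms by simp
  have eq: "gauss_kernel \<epsilon> = (\<lambda>y::'a. sqrt (pi / \<epsilon>) ^ DIM('a) * exp (- (1 / (4 * \<epsilon>)) * (norm y)\<^sup>2))"
    by (simp add: gauss_kernel_def fun_eq_iff)
  show "integrable lborel (gauss_kernel \<epsilon> :: 'a::euclidean_space \<Rightarrow> real)"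
    unfolding eq by (intro integrable_mult_right gaussian_integral(1) e)
  have "(\<integral>y. gauss_kernel \<epsilon> (y::'a) \<partial>lborel)
      = sqrt (pi / \<epsilon>) ^ DIM('a) * sqrt (pi / (1 / (4 * \<epsilon>))) ^ DIM('a)"
    unfolding eq using gaussian_integral(2)[OF e, where 'a='a] by simp
  also have "\<dots> = sqrt ((2 * pi)\<^sup>2) ^ DIM('a)"
    using assms by (simp add: power2_eq_square mult_ac flip: power_mult_distrib real_sqrt_mult)
  also have "sqrt ((2 * pi)\<^sup>2) = 2 * pi" by (subst real_sqrt_abs) simp
  finally show "(\<integral>y. gauss_kernel \<epsilon> (y::'a) \<partial>lborel) = (2 * pi) ^ DIM('a)" .
qed

lemma integrable_convolution_integrand:
  fixes f g :: "'a::euclidean_space \<Rightarrow> real"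
  assumes f: "integrable lborel f" and g: "integrable lborel g"
  shows "integrable (lborel \<Otimes>\<^sub>M lborel) (\<lambda>(x, y). f x * g (x - y))"
proof (rule lborel_pair.Fubini_integrable)
  have [measurable]: "f \<in> borel_measurable borel" "g \<in> borel_measurable borel"
    using f g by (auto dest: borel_measurable_integrable)
  show "(\<lambda>(x, y). f x * g (x - y)) \<in> borel_measurable (lborel \<Otimes>\<^sub>M lborel)" by measurable
  have "(\<integral>y. norm (f x * g (x - y)) \<partial>lborel) = \<bar>f x\<bar> * (\<integral>y. \<bar>g y\<bar> \<partial>lborel)" for x
  proof -
    have "(\<integral>y. norm (f x * g (x - y)) \<partial>lborel) = \<bar>f x\<bar> * (\<integral>y. \<bar>g (x - y)\<bar> \<partial>lborel)"
      by (simp add: abs_mult)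
    also have "(\<integral>y. \<bar>g (x - y)\<bar> \<partial>lborel) = (\<integral>y. \<bar>g y\<bar> \<partial>lborel)"
      by (rule lborel_reflect(2)) measurable
    finally show ?thesis .
  qed
  then show "integrable lborel (\<lambda>x. \<integral>y. norm (case (x, y) of (x, y) \<Rightarrow> f x * g (x - y)) \<partial>lborel)"
    using f by simp
  show "AE x in lborel. integrable lborel (\<lambda>y. case (x, y) of (x, y) \<Rightarrow> f x * g (x - y))"
    using g lborel_reflect(1)[of g] by simp
qed

text \<open>The Gaussian weight makes the frequency integral converge absolutely for L1 functions,
  and on the space side it becomes the heat semigroup. This serves twice: with
  \<open>\<phi> = f\<close> for Plancherel, and with an indicator for the main term of
  \<open>heat_spreading\<close>.\<close>

lemma gaussian_pairing:
  fixes f \<phi> :: "'a::euclidean_space \<Rightarrow> real"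
  assumes f: "integrable lborel f" and \<phi>: "integrable lborel \<phi>" and \<epsilon>: "\<epsilon> > 0"
  shows "(\<integral>\<xi>. of_real (exp (- \<epsilon> * (norm \<xi>)\<^sup>2)) * (fourier_integral f \<xi> * cnj (fourier_integral \<phi> \<xi>)) \<partial>lborel)
    = of_real (\<integral>x. f x * (\<integral>y. \<phi> y * gauss_kernel \<epsilon> (x - y) \<partial>lborel) \<partial>lborel)"
proof -
  have [measurable]: "f \<in> borel_measurable borel" and \<phi>m [measurable]: "\<phi> \<in> borel_measurable borel"
    using f \<phi> by (auto dest: borel_measurable_integrable)
  note [measurable] = fourier_integral_measurable[OF \<phi>m]
  let ?E = "\<lambda>\<xi>::'a. exp (- \<epsilon> * (norm \<xi>)\<^sup>2)"
  let ?F = "fourier_integral f" and ?G = "fourier_integral \<phi>"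
  let ?C = "\<integral>x. \<bar>\<phi> x\<bar> \<partial>lborel"
  have iE: "integrable lborel ?E" by (rule gaussian_integral(1)[OF \<epsilon>])
  have GC: "norm (?G \<xi>) \<le> ?C" for \<xi> by (rule norm_fourier_integral_le[OF \<phi>])
  have C: "?C \<ge> 0" by simp
  define \<Phi> where "\<Phi> \<xi> = of_real (?E \<xi>) * cnj (?G \<xi>)" for \<xi>
  have i\<Phi>: "integrable lborel \<Phi>"
  proof (rule Bochner_Integration.integrable_bound)
    show "integrable lborel (\<lambda>\<xi>. ?E \<xi> * ?C)" using iE by simp
    show "AE \<xi> in lborel. norm (\<Phi> \<xi>) \<le> norm (?E \<xi> * ?C)"
      using GC C by (auto simp: \<Phi>_def norm_mult abs_mult intro!: mult_left_mono)
  qed (unfold \<Phi>_def, measurable)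
  have iG: "integrable lborel (\<lambda>\<xi>. complex_of_real (?E \<xi>) * cis (x \<bullet> \<xi>))" for x
    by (rule gaussian_fourier(1)[OF \<epsilon>])
  have inner: "(\<integral>\<xi>. \<Phi> \<xi> * cis (- (x \<bullet> \<xi>)) \<partial>lborel) = of_real (\<integral>y. \<phi> y * gauss_kernel \<epsilon> (x - y) \<partial>lborel)" for x
  proof -
    have "(\<integral>\<xi>. (complex_of_real (?E \<xi>) * cis (x \<bullet> \<xi>)) * ?G \<xi> \<partial>lborel)
        = (\<integral>y. of_real (\<phi> y) * (\<integral>\<xi>. (complex_of_real (?E \<xi>) * cis (x \<bullet> \<xi>)) * cis (- (y \<bullet> \<xi>)) \<partial>lborel) \<partial>lborel)"
      by (rule fourier_multiplication[OF \<phi> iG])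
    also have "\<dots> = (\<integral>y. of_real (\<phi> y * gauss_kernel \<epsilon> (x - y)) \<partial>lborel)"
    proof (intro Bochner_Integration.integral_cong refl)
      fix y
      have "(\<integral>\<xi>. (complex_of_real (?E \<xi>) * cis (x \<bullet> \<xi>)) * cis (- (y \<bullet> \<xi>)) \<partial>lborel)
          = (\<integral>\<xi>. complex_of_real (?E \<xi>) * cis ((x - y) \<bullet> \<xi>) \<partial>lborel)"
        by (intro Bochner_Integration.integral_cong refl) (simp add: mult.assoc cis_mult inner_diff_left)
      also have "\<dots> = of_real (gauss_kernel \<epsilon> (x - y))"
        unfolding gaussian_fourier(2)[OF \<epsilon>] gauss_kernel_def ..
      finally show "of_real (\<phi> y) * (\<integral>\<xi>. (complex_of_real (?E \<xi>) * cis (x \<bullet> \<xi>)) * cis (- (y \<bullet> \<xi>)) \<partial>lborel)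
          = of_real (\<phi> y * gauss_kernel \<epsilon> (x - y))" by simp
    qed
    also have "\<dots> = of_real (\<integral>y. \<phi> y * gauss_kernel \<epsilon> (x - y) \<partial>lborel)"
      by (rule integral_complex_of_real)
    finally have "cnj (\<integral>\<xi>. (complex_of_real (?E \<xi>) * cis (x \<bullet> \<xi>)) * ?G \<xi> \<partial>lborel)
        = of_real (\<integral>y. \<phi> y * gauss_kernel \<epsilon> (x - y) \<partial>lborel)" by simp
    moreover have "cnj (\<integral>\<xi>. (complex_of_real (?E \<xi>) * cis (x \<bullet> \<xi>)) * ?G \<xi> \<partial>lborel)
        = (\<integral>\<xi>. \<Phi> \<xi> * cis (- (x \<bullet> \<xi>)) \<partial>lborel)"
      unfolding Bochner_Integration.integral_cnj[symmetric]
      by (intro Bochner_Integration.integral_cong refl) (simp add: \<Phi>_def cis_cnj mult_ac)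
    ultimately show ?thesis by simp
  qed
  have "(\<integral>\<xi>. of_real (?E \<xi>) * (?F \<xi> * cnj (?G \<xi>)) \<partial>lborel) = (\<integral>\<xi>. \<Phi> \<xi> * ?F \<xi> \<partial>lborel)"
    by (intro Bochner_Integration.integral_cong refl) (simp add: \<Phi>_def mult_ac)
  also have "\<dots> = (\<integral>x. of_real (f x) * of_real (\<integral>y. \<phi> y * gauss_kernel \<epsilon> (x - y) \<partial>lborel) \<partial>lborel)"
    unfolding fourier_multiplication[OF f i\<Phi>] inner ..
  also have "\<dots> = of_real (\<integral>x. f x * (\<integral>y. \<phi> y * gauss_kernel \<epsilon> (x - y) \<partial>lborel) \<partial>lborel)"
    by (simp flip: of_real_mult)
  finally show ?thesis .
qed

text \<open>Replacing y by x - y in the heat pairing exposes the autocorrelation of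
  \<open>f\<close>, on which the Gaussian then acts as an approximate identity.\<close>

lemma plancherel_regularized:
  fixes f :: "'a::euclidean_space \<Rightarrow> real"
  assumes f: "integrable lborel f" and \<epsilon>: "\<epsilon> > 0"
  shows "integrable lborel (\<lambda>\<xi>. exp (- \<epsilon> * (norm \<xi>)\<^sup>2) * (norm (fourier_integral f \<xi>))\<^sup>2)"
    and "(\<integral>\<xi>. exp (- \<epsilon> * (norm \<xi>)\<^sup>2) * (norm (fourier_integral f \<xi>))\<^sup>2 \<partial>lborel)
      = (\<integral>y. gauss_kernel \<epsilon> y * (\<integral>x. f x * f (x - y) \<partial>lborel) \<partial>lborel)"
proof -
  have fm [measurable]: "f \<in> borel_measurable borel"
    using f by (auto dest: borel_measurable_integrable)
  note [measurable] = fourier_integral_measurable[OF fm]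
  let ?E = "\<lambda>\<xi>::'a. exp (- \<epsilon> * (norm \<xi>)\<^sup>2)"
  let ?F = "fourier_integral f"
  let ?C = "\<integral>x. \<bar>f x\<bar> \<partial>lborel"
  have iE: "integrable lborel ?E" by (rule gaussian_integral(1)[OF \<epsilon>])
  have FC: "norm (?F \<xi>) \<le> ?C" for \<xi> by (rule norm_fourier_integral_le[OF f])
  have C: "?C \<ge> 0" by simp
  show "integrable lborel (\<lambda>\<xi>. ?E \<xi> * (norm (?F \<xi>))\<^sup>2)"
  proof (rule Bochner_Integration.integrable_bound)
    show "integrable lborel (\<lambda>\<xi>. ?E \<xi> * ?C\<^sup>2)" using iE by simp
    show "AE \<xi> in lborel. norm (?E \<xi> * (norm (?F \<xi>))\<^sup>2) \<le> norm (?E \<xi> * ?C\<^sup>2)"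
      using FC C by (auto simp: abs_mult intro!: mult_left_mono power_mono)
  qed measurable
  have "of_real (\<integral>\<xi>. ?E \<xi> * (norm (?F \<xi>))\<^sup>2 \<partial>lborel) = (\<integral>\<xi>. of_real (?E \<xi>) * (?F \<xi> * cnj (?F \<xi>)) \<partial>lborel)"
    unfolding integral_complex_of_real[symmetric]
    by (intro Bochner_Integration.integral_cong refl) (simp add: complex_norm_square del: of_real_power)
  also have "\<dots> = of_real (\<integral>x. f x * (\<integral>y. f y * gauss_kernel \<epsilon> (x - y) \<partial>lborel) \<partial>lborel)"
    by (rule gaussian_pairing[OF f f \<epsilon>])
  finally have "(\<integral>\<xi>. ?E \<xi> * (norm (?F \<xi>))\<^sup>2 \<partial>lborel)
      = (\<integral>x. f x * (\<integral>y. f y * gauss_kernel \<epsilon> (x - y) \<partial>lborel) \<partial>lborel)"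
    by (simp only: of_real_eq_iff)
  also have "\<dots> = (\<integral>x. (\<integral>y. f x * f (x - y) * gauss_kernel \<epsilon> y \<partial>lborel) \<partial>lborel)"
  proof (intro Bochner_Integration.integral_cong refl)
    fix x
    have "(\<integral>y. f y * gauss_kernel \<epsilon> (x - y) \<partial>lborel) = (\<integral>y. f (x - y) * gauss_kernel \<epsilon> (x - (x - y)) \<partial>lborel)"
      by (rule lborel_reflect(2)[symmetric]) measurable
    then show "f x * (\<integral>y. f y * gauss_kernel \<epsilon> (x - y) \<partial>lborel) = (\<integral>y. f x * f (x - y) * gauss_kernel \<epsilon> y \<partial>lborel)"
      by (simp add: mult.assoc)
  qed
  also have "\<dots> = (\<integral>y. (\<integral>x. f x * f (x - y) * gauss_kernel \<epsilon> y \<partial>lborel) \<partial>lborel)"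
  proof (rule lborel_pair.Fubini_integral[symmetric])
    show "integrable (lborel \<Otimes>\<^sub>M lborel) (\<lambda>(x, y). f x * f (x - y) * gauss_kernel \<epsilon> y)"
    proof (rule Bochner_Integration.integrable_bound)
      show "integrable (lborel \<Otimes>\<^sub>M lborel) (\<lambda>z. (case z of (x, y) \<Rightarrow> f x * f (x - y)) * sqrt (pi / \<epsilon>) ^ DIM('a))"
        by (intro integrable_mult_left integrable_convolution_integrand f)
      show "AE z in lborel \<Otimes>\<^sub>M lborel. norm (case z of (x, y) \<Rightarrow> f x * f (x - y) * gauss_kernel \<epsilon> y)
          \<le> norm ((case z of (x, y) \<Rightarrow> f x * f (x - y)) * sqrt (pi / \<epsilon>) ^ DIM('a))"
      proof (rule AE_I2)
        fix z :: "'a \<times> 'a"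
        obtain x y where z: "z = (x, y)" by force
        have "\<bar>f x * f (x - y)\<bar> * \<bar>gauss_kernel \<epsilon> y\<bar> \<le> \<bar>f x * f (x - y)\<bar> * \<bar>sqrt (pi / \<epsilon>) ^ DIM('a)\<bar>"
          using gauss_kernel_nonneg[OF \<epsilon>, of y] gauss_kernel_le[OF \<epsilon>, of y] by (intro mult_left_mono) auto
        then show "norm (case z of (x, y) \<Rightarrow> f x * f (x - y) * gauss_kernel \<epsilon> y)
          \<le> norm ((case z of (x, y) \<Rightarrow> f x * f (x - y)) * sqrt (pi / \<epsilon>) ^ DIM('a))"
          by (simp add: z abs_mult)
      qed
    qed measurable
  qed
  also have "\<dots> = (\<integral>y. gauss_kernel \<epsilon> y * (\<integral>x. f x * f (x - y) \<partial>lborel) \<partial>lborel)"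
    by (simp add: mult.commute)
  finally show "(\<integral>\<xi>. ?E \<xi> * (norm (?F \<xi>))\<^sup>2 \<partial>lborel)
      = (\<integral>y. gauss_kernel \<epsilon> y * (\<integral>x. f x * f (x - y) \<partial>lborel) \<partial>lborel)" .
qed

section \<open>Removal of the regularisation\<close>

text \<open>The autocorrelation is the inner product of a class with its translate: the limit is
  strong continuity of translations, the bound is Cauchy-Schwarz.\<close>

lemma autocorrelation:
  fixes f :: "'a::euclidean_space \<Rightarrow> real"
  assumes f: "square_integrable f"
  shows "(\<lambda>y. \<integral>x. f x * f (x - y) \<partial>lborel) \<midarrow>0\<rightarrow> (\<integral>x. (f x)\<^sup>2 \<partial>lborel)"
    and "\<bar>\<integral>x. f x * f (x - y) \<partial>lborel\<bar> \<le> (\<integral>x. (f x)\<^sup>2 \<partial>lborel)"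
proof -
  have eq: "(\<integral>x. f x * f (x - y) \<partial>lborel) = inner (L2_of f) (translate_L2 y (L2_of f))" for y
    unfolding translate_L2_of[OF f] by (rule inner_L2_of[OF f square_integrable_translate[OF f], symmetric])
  have eq0: "(\<integral>x. (f x)\<^sup>2 \<partial>lborel) = inner (L2_of f) (L2_of f)"
    unfolding inner_L2_of[OF f f] power2_eq_square ..
  show "(\<lambda>y. \<integral>x. f x * f (x - y) \<partial>lborel) \<midarrow>0\<rightarrow> (\<integral>x. (f x)\<^sup>2 \<partial>lborel)"
    unfolding eq eq0 using translate_L2_continuous by (intro tendsto_intros)
  show "\<bar>\<integral>x. f x * f (x - y) \<partial>lborel\<bar> \<le> (\<integral>x. (f x)\<^sup>2 \<partial>lborel)"
    unfolding eq eq0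
    using Cauchy_Schwarz_ineq2[of "L2_of f" "translate_L2 y (L2_of f)"]
    by (simp add: norm_translate_L2 flip: power2_norm_eq_inner power2_eq_square)
qed

text \<open>Half of the exponent stays in the kernel at \<open>2 * \<epsilon>\<close>, whose total
  mass does not depend on \<epsilon>; the other half is exponentially small away from the origin.
  This controls the tails of the approximate identity.\<close>

lemma gauss_kernel_split:
  assumes "\<epsilon> > 0"
  shows "gauss_kernel \<epsilon> (y::'a::euclidean_space)
    = sqrt 2 ^ DIM('a) * exp (- (norm y)\<^sup>2 / (8 * \<epsilon>)) * gauss_kernel (2 * \<epsilon>) y"
proof -
  have "sqrt 2 ^ DIM('a) * sqrt (pi / (2 * \<epsilon>)) ^ DIM('a) = sqrt (pi / \<epsilon>) ^ DIM('a)"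
    by (simp flip: power_mult_distrib real_sqrt_mult)
  moreover have "exp (- (norm y)\<^sup>2 / (8 * \<epsilon>)) * exp (- (norm y)\<^sup>2 / (4 * (2 * \<epsilon>))) = exp (- (norm y)\<^sup>2 / (4 * \<epsilon>))"
    using assms by (simp add: field_simps flip: exp_add)
  moreover have "a * b * (c * d) = (a * c) * (b * d)" for a b c d :: real by simp
  ultimately show ?thesis
    unfolding gauss_kernel_def by (simp only:)
qed

lemma gauss_kernel_approximate_identity:
  fixes h :: "'a::euclidean_space \<Rightarrow> real"
  assumes h: "h \<in> borel_measurable borel" "\<And>y. \<bar>h y\<bar> \<le> C" and lim: "h \<midarrow>0\<rightarrow> h 0"
  shows "(\<lambda>k. \<integral>y. gauss_kernel (1 / real (Suc k)) y * h y \<partial>lborel) \<longlonglongrightarrow> (2 * pi) ^ DIM('a) * h 0"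
proof -
  have [measurable]: "h \<in> borel_measurable borel" by fact
  define P where "P = (2 * pi) ^ DIM('a)"
  have P: "P > 0" by (simp add: P_def)
  define l where "l = h 0"
  define D where "D = \<bar>C\<bar> + \<bar>l\<bar>"
  have D: "D \<ge> 0" by (simp add: D_def)
  have hD: "\<bar>h y - l\<bar> \<le> D" for y using h(2)[of y] by (simp add: D_def)
  define e where "e k = 1 / real (Suc k)" for k
  have e: "e k > 0" for k by (simp add: e_def)
  have iG: "integrable lborel (\<lambda>y::'a. gauss_kernel (c * e k) y)" if "c > 0" for k c
    using gauss_kernel_integral(1)[of "c * e k"] e that by simp
  have iGh: "integrable lborel (\<lambda>y::'a. gauss_kernel (e k) y * h y)" for k
  proof (rule Bochner_Integration.integrable_bound)
    show "integrable lborel (\<lambda>y::'a. gauss_kernel (e k) y * C)" using iG[of 1 k] by simp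
    have "C \<ge> 0" using h(2)[of 0] by simp
    then show "AE y in lborel. norm (gauss_kernel (e k) y * h y) \<le> norm (gauss_kernel (e k) y * C)"
      using h(2) gauss_kernel_nonneg[OF e] by (auto simp: abs_mult intro!: mult_left_mono)
  qed measurable
  \<comment> \<open>Within \<delta> of 0 the oscillation \<eta> is integrated against the mass P.
    Beyond \<delta> the split kernel leaves the factor exp (- \<delta>^2 / 8)^(k + 1), since the
    parameter is 1 / (k + 1).\<close>
  have key: "\<bar>(\<integral>y. gauss_kernel (e k) y * h y \<partial>lborel) - P * l\<bar>
      \<le> P * \<eta> + D * (sqrt 2 ^ DIM('a) * exp (- \<delta>\<^sup>2 / 8) ^ Suc k) * P"
    if \<delta>: "\<delta> > 0" "\<And>y. norm y < \<delta> \<Longrightarrow> \<bar>h y - l\<bar> \<le> \<eta>" and \<eta>: "\<eta> > 0" for \<delta> \<eta> k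
  proof -
    let ?r = "sqrt 2 ^ DIM('a) * exp (- \<delta>\<^sup>2 / 8) ^ Suc k"
    have r: "?r = sqrt 2 ^ DIM('a) * exp (- \<delta>\<^sup>2 / (8 * e k))"
    proof -
      have "exp (- \<delta>\<^sup>2 / 8) ^ Suc k = exp (real (Suc k) * (- \<delta>\<^sup>2 / 8))"
        by (rule exp_of_nat_mult[symmetric])
      also have "real (Suc k) * (- \<delta>\<^sup>2 / 8) = - \<delta>\<^sup>2 / (8 * e k)"
        by (simp add: e_def)
      finally show ?thesis by simp
    qed
    have "P * l = (\<integral>y. gauss_kernel (e k) (y::'a) * l \<partial>lborel)"
      using gauss_kernel_integral(2)[OF e[of k], where 'a='a] by (simp add: P_def)
    then have "(\<integral>y. gauss_kernel (e k) y * h y \<partial>lborel) - P * l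
        = (\<integral>y. gauss_kernel (e k) y * h y \<partial>lborel) - (\<integral>y. gauss_kernel (e k) (y::'a) * l \<partial>lborel)"
      by (rule arg_cong)
    also have "\<dots> = (\<integral>y. gauss_kernel (e k) y * (h y - l) \<partial>lborel)"
      unfolding right_diff_distrib using iGh[of k] iG[of 1 k]
      by (intro Bochner_Integration.integral_diff[symmetric]) auto
    finally have "\<bar>(\<integral>y. gauss_kernel (e k) y * h y \<partial>lborel) - P * l\<bar>
        = norm (\<integral>y. gauss_kernel (e k) y * (h y - l) \<partial>lborel)" unfolding real_norm_def by (rule arg_cong)
    also have "\<dots> \<le> (\<integral>y. gauss_kernel (e k) y * \<eta> + D * ?r * gauss_kernel (2 * e k) (y::'a) \<partial>lborel)"
    proof (rule Bochner_Integration.integral_norm_bound_integral)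
      show "integrable lborel (\<lambda>y. gauss_kernel (e k) y * (h y - l))"
        using iGh[of k] iG[of 1 k] by (simp add: right_diff_distrib)
      show "integrable lborel (\<lambda>y::'a. gauss_kernel (e k) y * \<eta> + D * ?r * gauss_kernel (2 * e k) y)"
        using iG[of 1 k] iG[of 2 k] by simp
      fix y :: 'a
      have G: "gauss_kernel (e k) y \<ge> 0" "gauss_kernel (2 * e k) y \<ge> 0"
        using gauss_kernel_nonneg[OF e] gauss_kernel_nonneg[of "2 * e k" y] e[of k] by auto
      show "norm (gauss_kernel (e k) y * (h y - l)) \<le> gauss_kernel (e k) y * \<eta> + D * ?r * gauss_kernel (2 * e k) y"
      proof (cases "norm y < \<delta>")
        case True
        have "\<bar>gauss_kernel (e k) y * (h y - l)\<bar> \<le> gauss_kernel (e k) y * \<eta>"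
          using \<delta>(2) True G by (auto simp: abs_mult intro!: mult_left_mono)
        moreover have "0 \<le> D * ?r * gauss_kernel (2 * e k) y" using D G by simp
        ultimately show ?thesis unfolding real_norm_def by linarith
      next
        case False
        then have "\<delta> \<le> norm y" by simp
        then have "\<delta>\<^sup>2 \<le> (norm y)\<^sup>2" using \<delta>(1) by (intro power_mono) auto
        then have "exp (- (norm y)\<^sup>2 / (8 * e k)) \<le> exp (- \<delta>\<^sup>2 / (8 * e k))"
          using e[of k] by (simp add: divide_right_mono)
        then have "gauss_kernel (e k) y \<le> ?r * gauss_kernel (2 * e k) y"
          unfolding gauss_kernel_split[OF e[of k], of y] r using G
          by (intro mult_right_mono mult_left_mono) auto
        then have "gauss_kernel (e k) y * \<bar>h y - l\<bar> \<le> (?r * gauss_kernel (2 * e k) y) * D"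
          using hD[of y] D G by (intro mult_mono) auto
        moreover have "gauss_kernel (e k) y * \<eta> \<ge> 0" using G \<eta> by simp
        ultimately show ?thesis using G by (simp add: abs_mult mult_ac)
      qed
    qed
    also have "\<dots> = P * \<eta> + D * ?r * P"
      using iG[of 1 k] iG[of 2 k] gauss_kernel_integral(2)[OF e[of k], where 'a='a]
        gauss_kernel_integral(2)[of "2 * e k", where 'a='a] e[of k] by (simp add: P_def)
    finally show ?thesis .
  qed
  show ?thesis
    unfolding P_def[symmetric] e_def[symmetric] l_def[symmetric]
  proof (rule tendstoI)
    fix x :: real assume x: "x > 0"
    define \<eta> where "\<eta> = x / (2 * P)"
    have \<eta>: "\<eta> > 0" using x P by (simp add: \<eta>_def)
    from LIM_D[OF lim \<eta>] obtain \<delta> where \<delta>0: "\<delta> > 0" "\<And>y. y \<noteq> 0 \<Longrightarrow> norm y < \<delta> \<Longrightarrow> \<bar>h y - l\<bar> < \<eta>"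
      by (auto simp: l_def)
    have \<delta>: "\<delta> > 0" "\<And>y. norm y < \<delta> \<Longrightarrow> \<bar>h y - l\<bar> \<le> \<eta>"
    proof -
      show "\<bar>h y - l\<bar> \<le> \<eta>" if "norm y < \<delta>" for y
        using \<delta>0(2)[of y] that \<eta> by (cases "y = 0") (auto simp: l_def)
    qed (rule \<delta>0)
    have "(\<lambda>k. D * (sqrt 2 ^ DIM('a) * exp (- \<delta>\<^sup>2 / 8) ^ Suc k) * P) \<longlonglongrightarrow> D * (sqrt 2 ^ DIM('a) * 0) * P"
      using \<delta>(1) by (intro tendsto_intros LIMSEQ_Suc LIMSEQ_power_zero) auto
    then have "\<forall>\<^sub>F k in sequentially. D * (sqrt 2 ^ DIM('a) * exp (- \<delta>\<^sup>2 / 8) ^ Suc k) * P < x / 2"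
      using x by (intro order_tendstoD(2)[where y="D * (sqrt 2 ^ DIM('a) * 0) * P"]) auto
    then show "\<forall>\<^sub>F k in sequentially. dist (\<integral>y. gauss_kernel (e k) y * h y \<partial>lborel) (P * l) < x"
    proof eventually_elim
      case (elim k)
      moreover have "P * \<eta> = x / 2" using P by (simp add: \<eta>_def)
      ultimately show ?case using key[OF \<delta> \<eta>, of k] by (simp add: dist_real_def)
    qed
  qed
qed

text \<open>Monotone convergence in the regularisation parameter yields both the square
  integrability of the transform and its norm; the limit is identified on the space side as the
  autocorrelation at 0.\<close>

lemma plancherel:
  fixes f :: "'a::euclidean_space \<Rightarrow> real"
  assumes f: "integrable lborel f" "square_integrable f"
  shows "square_integrable (fourier_integral f)"
    and "(\<integral>\<xi>. (norm (fourier_integral f \<xi>))\<^sup>2 \<partial>lborel) = (2 * pi) ^ DIM('a) * (\<integral>x. (f x)\<^sup>2 \<partial>lborel)"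
proof -
  have fm [measurable]: "f \<in> borel_measurable borel"
    using f by (auto dest: borel_measurable_integrable)
  note [measurable] = fourier_integral_measurable[OF fm]
  let ?F = "fourier_integral f"
  let ?u = "\<lambda>k \<xi>. exp (- (1 / real (Suc k)) * (norm \<xi>)\<^sup>2) * (norm (?F \<xi>))\<^sup>2"
  have int: "integrable lborel (?u k)" for k
    by (rule plancherel_regularized(1)[OF f(1)]) simp
  have mono: "AE \<xi> in lborel. mono (\<lambda>k. ?u k \<xi>)"
  proof (rule AE_I2, rule monoI)
    fix \<xi> :: 'a and k m :: nat assume "k \<le> m"
    then have "1 / real (Suc m) \<le> 1 / real (Suc k)" by (simp add: frac_le)
    then have "1 / real (Suc m) * (norm \<xi>)\<^sup>2 \<le> 1 / real (Suc k) * (norm \<xi>)\<^sup>2"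
      by (rule mult_right_mono) simp
    then show "?u k \<xi> \<le> ?u m \<xi>" by (intro mult_right_mono) auto
  qed
  have lim: "AE \<xi> in lborel. (\<lambda>k. ?u k \<xi>) \<longlonglongrightarrow> (norm (?F \<xi>))\<^sup>2"
  proof (rule AE_I2)
    fix \<xi> :: 'a
    have "(\<lambda>k. 1 / real (Suc k)) \<longlonglongrightarrow> 0" by (rule LIMSEQ_Suc[OF lim_1_over_n])
    then have "(\<lambda>k. ?u k \<xi>) \<longlonglongrightarrow> exp (- 0 * (norm \<xi>)\<^sup>2) * (norm (?F \<xi>))\<^sup>2"
      by (intro tendsto_intros)
    then show "(\<lambda>k. ?u k \<xi>) \<longlonglongrightarrow> (norm (?F \<xi>))\<^sup>2" by simp
  qed
  have "(\<lambda>k. \<integral>y. gauss_kernel (1 / real (Suc k)) y * (\<integral>x. f x * f (x - y) \<partial>lborel) \<partial>lborel)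
      \<longlonglongrightarrow> (2 * pi) ^ DIM('a) * (\<integral>x. (f x)\<^sup>2 \<partial>lborel)"
    using gauss_kernel_approximate_identity[of "\<lambda>y. \<integral>x. f x * f (x - y) \<partial>lborel", OF _ autocorrelation(2)[OF f(2)]]
      autocorrelation(1)[OF f(2)] by (simp add: power2_eq_square)
  moreover have "(\<integral>\<xi>. ?u k \<xi> \<partial>lborel)
      = (\<integral>y. gauss_kernel (1 / real (Suc k)) y * (\<integral>x. f x * f (x - y) \<partial>lborel) \<partial>lborel)" for k
    by (rule plancherel_regularized(2)[OF f(1)]) simp
  ultimately have ilim: "(\<lambda>k. \<integral>\<xi>. ?u k \<xi> \<partial>lborel) \<longlonglongrightarrow> (2 * pi) ^ DIM('a) * (\<integral>x. (f x)\<^sup>2 \<partial>lborel)"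
    by simp
  have m: "(\<lambda>\<xi>. (norm (?F \<xi>))\<^sup>2) \<in> borel_measurable lborel" by measurable
  have pos: "AE \<xi> in lborel. 0 \<le> ?u k \<xi>" for k by simp
  show "(\<integral>\<xi>. (norm (?F \<xi>))\<^sup>2 \<partial>lborel) = (2 * pi) ^ DIM('a) * (\<integral>x. (f x)\<^sup>2 \<partial>lborel)"
    by (rule integral_monotone_convergence_nonneg(2)[OF int mono pos lim ilim m])
  show "square_integrable ?F"
    unfolding square_integrable_def
    using integral_monotone_convergence_nonneg(1)[OF int mono pos lim ilim m] by simp
qed

section \<open>Weak Fourier pairs\<close>

lemma square_integrable_mult_cnj:
  assumes "square_integrable g" "square_integrable k"
  shows "integrable lborel (\<lambda>\<xi>. g \<xi> * cnj (k \<xi>))"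
proof (rule Bochner_Integration.integrable_bound)
  have m [measurable]: "g \<in> borel_measurable borel" "k \<in> borel_measurable borel"
    using assms by (auto simp: square_integrable_def)
  show "integrable lborel (\<lambda>\<xi>. norm (g \<xi>) * norm (k \<xi>))"
    using assms by (intro square_integrable_mult) (auto simp: square_integrable_def)
  show "(\<lambda>\<xi>. g \<xi> * cnj (k \<xi>)) \<in> borel_measurable lborel" by measurable
qed (simp add: norm_mult)

text \<open>A weak form of ``\<open>g\<close> is the Fourier transform of \<open>f\<close>'', which is manifestly linear.\<close>

definition fourier_pair :: "('a::euclidean_space \<Rightarrow> real) \<Rightarrow> ('a \<Rightarrow> complex) \<Rightarrow> bool" where
  "fourier_pair f g \<longleftrightarrow> square_integrable f \<and> square_integrable g \<and>
    (\<forall>\<phi>. integrable lborel \<phi> \<longrightarrow> square_integrable \<phi> \<longrightarrow>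
      Re (\<integral>\<xi>. g \<xi> * cnj (fourier_integral \<phi> \<xi>) \<partial>lborel) = (2 * pi) ^ DIM('a) * (\<integral>x. f x * \<phi> x \<partial>lborel))"

lemma fourier_integral_add:
  assumes "integrable lborel f" "integrable lborel g"
  shows "fourier_integral (\<lambda>x. f x + g x) \<xi> = fourier_integral f \<xi> + fourier_integral g \<xi>"
  unfolding fourier_integral_def using fourier_integrand_integrable[OF assms(1)] fourier_integrand_integrable[OF assms(2)]
  by (simp add: distrib_right)

text \<open>Polarisation: Plancherel is applied to the sum of \<open>f\<close> and
  \<open>\<phi>\<close>. This yields the real part of the pairing, which is all that
  \<open>fourier_pair\<close> demands.\<close>

lemma fourier_pair_fourier_integral:
  assumes f: "integrable lborel f" "square_integrable f"
  shows "fourier_pair f (fourier_integral f)"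
  unfolding fourier_pair_def
proof (intro conjI allI impI plancherel f)
  fix \<phi> :: "'a \<Rightarrow> real" assume \<phi>: "integrable lborel \<phi>" "square_integrable \<phi>"
  let ?F = "fourier_integral f" and ?G = "fourier_integral \<phi>" and ?c = "(2 * pi) ^ DIM('a)"
  have F: "square_integrable ?F" and G: "square_integrable ?G"
    using plancherel f \<phi> by auto
  have iF: "integrable lborel (\<lambda>\<xi>. (norm (?F \<xi>))\<^sup>2)" and iG: "integrable lborel (\<lambda>\<xi>. (norm (?G \<xi>))\<^sup>2)"
    using F G by (auto simp: square_integrable_def)
  have i: "integrable lborel (\<lambda>\<xi>. ?F \<xi> * cnj (?G \<xi>))" by (rule square_integrable_mult_cnj[OF F G])
  have sum: "integrable lborel (\<lambda>x. f x + \<phi> x)" "square_integrable (\<lambda>x. f x + \<phi> x)"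
    using f \<phi> by (auto intro: square_integrable_add)
  have eq: "(norm (fourier_integral (\<lambda>x. f x + \<phi> x) \<xi>))\<^sup>2
      = (norm (?F \<xi>))\<^sup>2 + (norm (?G \<xi>))\<^sup>2 + 2 * Re (?F \<xi> * cnj (?G \<xi>))" for \<xi>
    unfolding fourier_integral_add[OF f(1) \<phi>(1)] cmod_power2 by (simp add: power2_eq_square algebra_simps)
  have "(\<integral>\<xi>. (norm (fourier_integral (\<lambda>x. f x + \<phi> x) \<xi>))\<^sup>2 \<partial>lborel)
      = (\<integral>\<xi>. (norm (?F \<xi>))\<^sup>2 \<partial>lborel) + (\<integral>\<xi>. (norm (?G \<xi>))\<^sup>2 \<partial>lborel) + 2 * Re (\<integral>\<xi>. ?F \<xi> * cnj (?G \<xi>) \<partial>lborel)"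
    unfolding eq using iF iG i by (simp add: integrable_Re del: times_complex.sel complex_cnj)
  moreover have "(\<integral>x. (f x + \<phi> x)\<^sup>2 \<partial>lborel) = (\<integral>x. (f x)\<^sup>2 \<partial>lborel) + (\<integral>x. (\<phi> x)\<^sup>2 \<partial>lborel) + 2 * (\<integral>x. f x * \<phi> x \<partial>lborel)"
    using f \<phi> square_integrable_mult[OF f(2) \<phi>(2)]
    by (simp add: power2_sum mult.assoc square_integrable_def)
  ultimately show "Re (\<integral>\<xi>. ?F \<xi> * cnj (?G \<xi>) \<partial>lborel) = ?c * (\<integral>x. f x * \<phi> x \<partial>lborel)"
    unfolding plancherel(2)[OF sum] plancherel(2)[OF f] plancherel(2)[OF \<phi>] by (simp add: algebra_simps)
qed

lemma integrable_cutoff: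
  fixes f :: "'a::euclidean_space \<Rightarrow> real"
  assumes f: "square_integrable f"
  shows "integrable lborel (\<lambda>x. indicator (cball 0 r) x * f x)"
    and "square_integrable (\<lambda>x. indicator (cball 0 r) x * f x)"
proof -
  have [measurable]: "f \<in> borel_measurable borel" "cball (0::'a) r \<in> sets borel"
    using f by (simp_all add: square_integrable_def)
  have "square_integrable (indicator (cball 0 r) :: 'a \<Rightarrow> real)"
    by (intro square_integrable_indicator) (use emeasure_lborel_cball_finite[of "0::'a" r] in auto)
  from square_integrable_mult[OF this f] show "integrable lborel (\<lambda>x. indicator (cball 0 r) x * f x)" .
  show "square_integrable (\<lambda>x. indicator (cball 0 r) x * f x)"
    unfolding square_integrable_def
  proof
    show "integrable lborel (\<lambda>x. (norm (indicator (cball 0 r) x * f x))\<^sup>2)"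
    proof (rule Bochner_Integration.integrable_bound)
      show "integrable lborel (\<lambda>x. (norm (f x))\<^sup>2)" using f by (simp add: square_integrable_def)
    qed (auto simp: indicator_def)
  qed measurable
qed

text \<open>The truncations to balls are integrable, so the pairing holds for them. As R grows, the
  frequency side converges by Cauchy-Schwarz and the L2 limit in \<open>has_fourier\<close>, the
  space side by dominated convergence.\<close>

lemma has_fourier_imp_fourier_pair:
  assumes hf: "has_fourier f g"
  shows "fourier_pair f g"
  unfolding fourier_pair_def
proof (intro conjI allI impI)
  show f: "square_integrable f" and g: "square_integrable g"
    using hf by (auto simp: has_fourier_def)
  fix \<phi> :: "'a \<Rightarrow> real" assume \<phi>: "integrable lborel \<phi>" "square_integrable \<phi>"
  have [measurable]: "f \<in> borel_measurable borel" "g \<in> borel_measurable borel" "\<phi> \<in> borel_measurable borel"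
      "\<And>r. cball (0::'a) r \<in> sets borel"
    using f g \<phi> by (auto simp: square_integrable_def)
  let ?c = "(2 * pi) ^ DIM('a)"
  let ?G = "fourier_integral \<phi>"
  have G: "square_integrable ?G" by (rule plancherel(1)[OF \<phi>])
  define fR where "fR R x = indicator (cball 0 (real R)) x * f x" for R :: nat and x :: 'a
  have fR: "integrable lborel (fR R)" "square_integrable (fR R)" for R
    unfolding fR_def using integrable_cutoff[OF f] by auto
  let ?F = "\<lambda>R. fourier_integral (fR R)"
  have F: "square_integrable (?F R)" for R by (rule plancherel(1)[OF fR])
  have [measurable]: "?F R \<in> borel_measurable borel" "?G \<in> borel_measurable borel" for R
    using F G by (auto simp: square_integrable_def)
  \<comment> \<open>Cauchy-Schwarz is at hand for the real space \<open>L2\<close>, hence the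
    passage to moduli of complex functions.\<close>
  define d where "d R \<xi> = norm (?F R \<xi> - g \<xi>)" for R \<xi>
  have d: "square_integrable (d R)" for R
    unfolding square_integrable_def
  proof
    show "integrable lborel (\<lambda>\<xi>. (norm (d R \<xi>))\<^sup>2)"
    proof (rule Bochner_Integration.integrable_bound)
      show "integrable lborel (\<lambda>\<xi>. 2 * (norm (?F R \<xi>))\<^sup>2 + 2 * (norm (g \<xi>))\<^sup>2)"
        using F[of R] g by (simp add: square_integrable_def)
      have "(norm (a - b))\<^sup>2 \<le> 2 * (norm a)\<^sup>2 + 2 * (norm b)\<^sup>2" for a b :: complex
      proof -
        have "(norm (a - b))\<^sup>2 \<le> (norm a + norm b)\<^sup>2" by (intro power_mono norm_triangle_ineq4) simp
        also have "\<dots> \<le> 2 * (norm a)\<^sup>2 + 2 * (norm b)\<^sup>2"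
          using sum_squares_bound[of "norm a" "norm b"] by (simp add: power2_sum)
        finally show ?thesis .
      qed
      then show "AE \<xi> in lborel. norm ((norm (d R \<xi>))\<^sup>2) \<le> norm (2 * (norm (?F R \<xi>))\<^sup>2 + 2 * (norm (g \<xi>))\<^sup>2)"
        by (simp add: d_def)
    qed (unfold d_def, measurable)
  qed (unfold d_def, measurable)
  have "(\<lambda>R. \<integral>\<^sup>+\<xi>. ennreal ((d R \<xi>)\<^sup>2) \<partial>lborel) \<longlonglongrightarrow> 0"
    using hf unfolding has_fourier_def d_def fR_def[abs_def] by blast
  moreover have "(\<integral>\<^sup>+\<xi>. ennreal ((d R \<xi>)\<^sup>2) \<partial>lborel) = ennreal (\<integral>\<xi>. (d R \<xi>)\<^sup>2 \<partial>lborel)" for R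
    using d[of R] by (intro nn_integral_eq_integral) (auto simp: square_integrable_def)
  ultimately have "(\<lambda>R. \<integral>\<xi>. (d R \<xi>)\<^sup>2 \<partial>lborel) \<longlonglongrightarrow> 0"
    using ennreal_tendsto_0_iff[of "\<lambda>R. \<integral>\<xi>. (d R \<xi>)\<^sup>2 \<partial>lborel"] by simp
  then have nd: "(\<lambda>R. sqrt (\<integral>\<xi>. (d R \<xi>)\<^sup>2 \<partial>lborel)) \<longlonglongrightarrow> sqrt 0"
    by (rule tendsto_real_sqrt)
  let ?I = "\<lambda>h. \<integral>\<xi>. h \<xi> * cnj (?G \<xi>) \<partial>lborel"
  have nG: "square_integrable (\<lambda>\<xi>. norm (?G \<xi>))"
    using G by (simp add: square_integrable_def)
  have bound: "norm (?I (?F R) - ?I g) \<le> sqrt (\<integral>\<xi>. (d R \<xi>)\<^sup>2 \<partial>lborel) * norm (L2_of (\<lambda>\<xi>. norm (?G \<xi>)))" for R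
  proof -
    have "?I (?F R) - ?I g = (\<integral>\<xi>. (?F R \<xi> - g \<xi>) * cnj (?G \<xi>) \<partial>lborel)"
      using square_integrable_mult_cnj[OF F G] square_integrable_mult_cnj[OF g G]
      by (simp add: left_diff_distrib)
    also have "norm \<dots> \<le> (\<integral>\<xi>. norm ((?F R \<xi> - g \<xi>) * cnj (?G \<xi>)) \<partial>lborel)"
      by (rule integral_norm_bound)
    also have "\<dots> = (\<integral>\<xi>. d R \<xi> * norm (?G \<xi>) \<partial>lborel)"
      by (simp add: norm_mult d_def)
    also have "\<dots> = inner (L2_of (d R)) (L2_of (\<lambda>\<xi>. norm (?G \<xi>)))"
      using inner_L2_of[OF d nG] by simp
    also have "\<dots> \<le> norm (L2_of (d R)) * norm (L2_of (\<lambda>\<xi>. norm (?G \<xi>)))"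
      by (rule norm_cauchy_schwarz)
    finally show ?thesis using norm_L2_of[OF d] by simp
  qed
  have "(\<lambda>R. ?I (?F R)) \<longlonglongrightarrow> ?I g"
  proof (rule LIM_zero_cancel, rule Lim_null_comparison)
    show "\<forall>\<^sub>F R in sequentially. norm (?I (?F R) - ?I g) \<le> sqrt (\<integral>\<xi>. (d R \<xi>)\<^sup>2 \<partial>lborel) * norm (L2_of (\<lambda>\<xi>. norm (?G \<xi>)))"
      using bound by simp
    show "(\<lambda>R. sqrt (\<integral>\<xi>. (d R \<xi>)\<^sup>2 \<partial>lborel) * norm (L2_of (\<lambda>\<xi>. norm (?G \<xi>)))) \<longlonglongrightarrow> 0"
      using tendsto_mult[OF nd tendsto_const] by simp
  qed
  then have "(\<lambda>R. Re (?I (?F R))) \<longlonglongrightarrow> Re (?I g)" by (rule tendsto_Re)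
  moreover have "Re (?I (?F R)) = ?c * (\<integral>x. fR R x * \<phi> x \<partial>lborel)" for R
    using fourier_pair_fourier_integral[OF fR, of R] \<phi> unfolding fourier_pair_def by blast
  moreover have "(\<lambda>R. ?c * (\<integral>x. fR R x * \<phi> x \<partial>lborel)) \<longlonglongrightarrow> ?c * (\<integral>x. f x * \<phi> x \<partial>lborel)"
  proof (intro tendsto_intros integral_dominated_convergence)
    show "integrable lborel (\<lambda>x. norm (f x * \<phi> x))"
      using square_integrable_mult[OF f \<phi>(2)] by simp
    show "AE x in lborel. (\<lambda>R. fR R x * \<phi> x) \<longlonglongrightarrow> f x * \<phi> x"
    proof (rule AE_I2, rule tendsto_eventually)
      fix x :: 'a
      show "\<forall>\<^sub>F R in sequentially. fR R x * \<phi> x = f x * \<phi> x"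
        using eventually_ge_at_top[of "nat \<lceil>norm x\<rceil>"]
        by eventually_elim (auto simp: fR_def indicator_def nat_le_iff ceiling_le_iff)
    qed
    show "AE x in lborel. norm (fR R x * \<phi> x) \<le> norm (f x * \<phi> x)" for R
      by (auto simp: fR_def indicator_def abs_mult)
  qed (unfold fR_def, measurable)
  ultimately have "(\<lambda>R. Re (?I (?F R))) \<longlonglongrightarrow> ?c * (\<integral>x. f x * \<phi> x \<partial>lborel)"
    and "(\<lambda>R. Re (?I (?F R))) \<longlonglongrightarrow> Re (?I g)" by (simp_all only:)
  then show "Re (?I g) = ?c * (\<integral>x. f x * \<phi> x \<partial>lborel)"
    using LIMSEQ_unique by blast
qed

section \<open>The free wave equation in dimension at most three\<close>

text \<open>Needed to subtract a multiple of a bump from a source; positivity is then applied to the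
  difference.\<close>

lemma fourier_pair_diff_scaled:
  fixes f f' :: "'a::euclidean_space \<Rightarrow> real"
  assumes "fourier_pair f g" "fourier_pair f' g'"
  shows "fourier_pair (\<lambda>x. f x - c * f' x) (\<lambda>\<xi>. g \<xi> - of_real c * g' \<xi>)"
  unfolding fourier_pair_def
proof (intro conjI allI impI)
  have f: "square_integrable f" "square_integrable f'" and g: "square_integrable g" "square_integrable g'"
    using assms by (auto simp: fourier_pair_def)
  show "square_integrable (\<lambda>x. f x - c * f' x)"
    by (intro square_integrable_diff square_integrable_scale f)
  have m [measurable]: "g \<in> borel_measurable borel" "g' \<in> borel_measurable borel"
    using g by (auto simp: square_integrable_def)
  show "square_integrable (\<lambda>\<xi>. g \<xi> - of_real c * g' \<xi>)"
    unfolding square_integrable_def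
  proof
    show "integrable lborel (\<lambda>\<xi>. (norm (g \<xi> - of_real c * g' \<xi>))\<^sup>2)"
    proof (rule Bochner_Integration.integrable_bound)
      show "integrable lborel (\<lambda>\<xi>. 2 * (norm (g \<xi>))\<^sup>2 + 2 * (c\<^sup>2 * (norm (g' \<xi>))\<^sup>2))"
        using g by (simp add: square_integrable_def)
      have "(norm (a - of_real c * b))\<^sup>2 \<le> 2 * (norm a)\<^sup>2 + 2 * (c\<^sup>2 * (norm b)\<^sup>2)" for a b :: complex
      proof -
        have "(norm (a - of_real c * b))\<^sup>2 \<le> (norm a + norm (of_real c * b))\<^sup>2"
          by (intro power_mono norm_triangle_ineq4) simp
        also have "\<dots> \<le> 2 * (norm a)\<^sup>2 + 2 * (norm (of_real c * b))\<^sup>2"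
          using sum_squares_bound[of "norm a" "norm (of_real c * b)"] by (simp add: power2_sum)
        also have "(norm (of_real c * b))\<^sup>2 = c\<^sup>2 * (norm b)\<^sup>2"
          by (simp add: norm_mult power_mult_distrib)
        finally show ?thesis .
      qed
      then show "AE \<xi> in lborel. norm ((norm (g \<xi> - of_real c * g' \<xi>))\<^sup>2)
          \<le> norm (2 * (norm (g \<xi>))\<^sup>2 + 2 * (c\<^sup>2 * (norm (g' \<xi>))\<^sup>2))"
        by simp
    qed measurable
  qed measurable
  fix \<phi> :: "'a \<Rightarrow> real" assume \<phi>: "integrable lborel \<phi>" "square_integrable \<phi>"
  let ?G = "fourier_integral \<phi>"
  have G: "square_integrable ?G" by (rule plancherel(1)[OF \<phi>])
  have 1: "Re (\<integral>\<xi>. g \<xi> * cnj (?G \<xi>) \<partial>lborel) = (2 * pi) ^ DIM('a) * (\<integral>x. f x * \<phi> x \<partial>lborel)"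
    and 2: "Re (\<integral>\<xi>. g' \<xi> * cnj (?G \<xi>) \<partial>lborel) = (2 * pi) ^ DIM('a) * (\<integral>x. f' x * \<phi> x \<partial>lborel)"
    using assms \<phi> by (auto simp: fourier_pair_def)
  have "(\<integral>\<xi>. (g \<xi> - of_real c * g' \<xi>) * cnj (?G \<xi>) \<partial>lborel)
      = (\<integral>\<xi>. g \<xi> * cnj (?G \<xi>) - of_real c * (g' \<xi> * cnj (?G \<xi>)) \<partial>lborel)"
    by (simp add: algebra_simps)
  also have "\<dots> = (\<integral>\<xi>. g \<xi> * cnj (?G \<xi>) \<partial>lborel) - of_real c * (\<integral>\<xi>. g' \<xi> * cnj (?G \<xi>) \<partial>lborel)"
    using square_integrable_mult_cnj[OF g(1) G] square_integrable_mult_cnj[OF g(2) G] by simp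
  finally have "Re (\<integral>\<xi>. (g \<xi> - of_real c * g' \<xi>) * cnj (?G \<xi>) \<partial>lborel)
      = Re (\<integral>\<xi>. g \<xi> * cnj (?G \<xi>) \<partial>lborel) - c * Re (\<integral>\<xi>. g' \<xi> * cnj (?G \<xi>) \<partial>lborel)"
    by simp
  also have "\<dots> = (2 * pi) ^ DIM('a) * ((\<integral>x. f x * \<phi> x \<partial>lborel) - c * (\<integral>x. f' x * \<phi> x \<partial>lborel))"
    unfolding 1 2 by (simp only: right_diff_distrib mult.left_commute[of c])
  also have "(\<integral>x. f x * \<phi> x \<partial>lborel) - c * (\<integral>x. f' x * \<phi> x \<partial>lborel) = (\<integral>x. (f x - c * f' x) * \<phi> x \<partial>lborel)"
    using square_integrable_mult[OF f(1) \<phi>(2)] square_integrable_mult[OF f(2) \<phi>(2)]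
    by (simp add: left_diff_distrib mult.assoc)
  finally show "Re (\<integral>\<xi>. (g \<xi> - of_real c * g' \<xi>) * cnj (?G \<xi>) \<partial>lborel)
      = (2 * pi) ^ DIM('a) * (\<integral>x. (f x - c * f' x) * \<phi> x \<partial>lborel)" .
qed

lemma fourier_integral_translate:
  fixes \<phi> :: "'a::euclidean_space \<Rightarrow> real"
  assumes \<phi>: "\<phi> \<in> borel_measurable borel"
  shows "fourier_integral (\<lambda>x. \<phi> (x + y)) \<xi> = cis (y \<bullet> \<xi>) * fourier_integral \<phi> \<xi>"
proof -
  have [measurable]: "\<phi> \<in> borel_measurable borel" by fact
  have m: "(\<lambda>x. complex_of_real (\<phi> x) * cis (- (x \<bullet> \<xi>))) \<in> borel_measurable borel" by measurable
  have "fourier_integral (\<lambda>x. \<phi> (x + y)) \<xi> = (\<integral>x. cis (y \<bullet> \<xi>) * (of_real (\<phi> (x - (- y))) * cis (- ((x - (- y)) \<bullet> \<xi>))) \<partial>lborel)"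
    unfolding fourier_integral_def
    by (intro Bochner_Integration.integral_cong refl) (simp add: cis_mult inner_add_left mult_ac flip: cis_divide)
  also have "\<dots> = cis (y \<bullet> \<xi>) * (\<integral>x. of_real (\<phi> (x - (- y))) * cis (- ((x - (- y)) \<bullet> \<xi>)) \<partial>lborel)"
    by simp
  also have "(\<integral>x. of_real (\<phi> (x - (- y))) * cis (- ((x - (- y)) \<bullet> \<xi>)) \<partial>lborel) = fourier_integral \<phi> \<xi>"
    unfolding fourier_integral_def by (rule lborel_translate(2)[OF m])
  finally show ?thesis .
qed

text \<open>A character on the frequency side shifts the test function. A symbol that is an average
  of characters therefore acts by averaging shifts.\<close>

lemma fourier_pair_translate:
  fixes f \<phi> :: "'a::euclidean_space \<Rightarrow> real"
  assumes fg: "fourier_pair f g" and \<phi>: "integrable lborel \<phi>" "square_integrable \<phi>"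
  shows "Re (\<integral>\<xi>. cis (- (y \<bullet> \<xi>)) * (g \<xi> * cnj (fourier_integral \<phi> \<xi>)) \<partial>lborel)
    = (2 * pi) ^ DIM('a) * (\<integral>x. f x * \<phi> (x + y) \<partial>lborel)"
proof -
  have m: "\<phi> \<in> borel_measurable borel" using \<phi> by (simp add: square_integrable_def)
  have "integrable lborel (\<lambda>x. \<phi> (x + y))" "square_integrable (\<lambda>x. \<phi> (x + y))"
    using \<phi> lborel_translate(1)[OF m, of "- y"] square_integrable_translate[OF \<phi>(2), of "- y"] by auto
  then have "Re (\<integral>\<xi>. g \<xi> * cnj (fourier_integral (\<lambda>x. \<phi> (x + y)) \<xi>) \<partial>lborel)
    = (2 * pi) ^ DIM('a) * (\<integral>x. f x * \<phi> (x + y) \<partial>lborel)"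
    using fg unfolding fourier_pair_def by blast
  moreover have "g \<xi> * cnj (fourier_integral (\<lambda>x. \<phi> (x + y)) \<xi>)
      = cis (- (y \<bullet> \<xi>)) * (g \<xi> * cnj (fourier_integral \<phi> \<xi>))" for \<xi>
    by (simp add: fourier_integral_translate[OF m] cis_cnj mult_ac)
  ultimately show ?thesis by simp
qed

section \<open>The Fourier transform of a ball in three dimensions\<close>

lemma lborel_distr_orthogonal:
  fixes f :: "real^3 \<Rightarrow> real^3"
  assumes f: "orthogonal_transformation f"
  shows "distr lborel borel f = lborel"
proof (rule sym, rule lborel_eqI)
  fix l u :: "real^3" assume le: "\<And>b. b \<in> Basis \<Longrightarrow> l \<bullet> b \<le> u \<bullet> b"
  have lin: "linear f" using f by (rule orthogonal_transformation_linear)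
  have fm: "f \<in> borel_measurable borel"
    by (intro borel_measurable_continuous_onI linear_continuous_on) (use lin in \<open>simp add: linear_conv_bounded_linear\<close>)
  have eq: "f -` box l u = inv f ` box l u"
    using orthogonal_transformation_bij[OF f] by (simp add: bij_vimage_eq_inv_image)
  have inv: "orthogonal_transformation (inv f)" by (rule orthogonal_transformation_inv[OF f])
  have lm: "f -` box l u \<in> lmeasurable" and me: "measure lebesgue (f -` box l u) = measure lebesgue (box l u)"
    unfolding eq by (rule measurable_orthogonal_image[OF inv] measure_orthogonal_image[OF inv], simp)+
  have b: "f -` box l u \<in> sets borel" using measurable_sets_borel[OF fm, of "box l u"] by simp
  have "emeasure (distr lborel borel f) (box l u) = emeasure lborel (f -` box l u)"
    using fm by (simp add: emeasure_distr)
  also have "\<dots> = emeasure lebesgue (f -` box l u)" using b by simp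
  also have "\<dots> = ennreal (measure lebesgue (box l u))"
    unfolding me[symmetric] using lm by (intro emeasure_eq_measure2) 
  also have "\<dots> = ennreal (\<Prod>b\<in>Basis. (u - l) \<bullet> b)"
    using le by (simp add: measure_lborel_box_eq inner_diff_left)
  finally show "emeasure (distr lborel borel f) (box l u) = (\<Prod>b\<in>Basis. (u - l) \<bullet> b)" .
qed simp

lemma borel_measurable_vector3:
  "(\<lambda>(x, y, z). vector [x, y, z] :: real^3) \<in> borel_measurable borel"
proof (rule borel_measurable_continuous_onI)
  let ?T = "\<lambda>(x, y, z). vector [x, y, z] :: real^3"
  have "continuous_on UNIV (\<lambda>w. \<chi> i. ?T w $ i)"
  proof (rule continuous_on_vec_lambda)
    fix i :: 3
    have "i = 1 \<or> i = 2 \<or> i = 3" by (rule exhaust_3)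
    then show "continuous_on UNIV (\<lambda>w. ?T w $ i)"
      by (elim disjE) (simp_all add: case_prod_unfold continuous_on_fst continuous_on_snd continuous_on_id)
  qed
  then show "continuous_on UNIV ?T" by simp
qed

lemma borel_measurable_sin [measurable]: "(sin :: real \<Rightarrow> real) \<in> borel_measurable borel"
  by (intro borel_measurable_continuous_onI continuous_intros)

lemma borel_measurable_cos [measurable]: "(cos :: real \<Rightarrow> real) \<in> borel_measurable borel"
  by (intro borel_measurable_continuous_onI continuous_intros)

lemma cball_borel [measurable]: "cball (x::'a::metric_space) r \<in> sets borel"
  by simp

lemma emeasure_lborel_Times:
  fixes A :: "'a::euclidean_space set" and B :: "'b::euclidean_space set"
  assumes "A \<in> sets borel" "B \<in> sets borel"
  shows "emeasure lborel (A \<times> B) = emeasure lborel A * emeasure lborel B"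
  unfolding lborel_prod[symmetric] using assms by (intro lborel.emeasure_pair_measure_Times) auto

text \<open>For cutting a ball of R^3 into discs by Fubini's theorem on R x R^2.\<close>

lemma lborel_distr_vector3:
  "distr lborel borel (\<lambda>(x, y, z). vector [x, y, z] :: real^3) = lborel"
proof (rule sym, rule lborel_eqI)
  let ?T = "\<lambda>(x, y, z). vector [x, y, z] :: real^3"
  note T = borel_measurable_vector3
  fix l u :: "real^3" assume le: "\<And>b. b \<in> Basis \<Longrightarrow> l \<bullet> b \<le> u \<bullet> b"
  have prod3: "prod f (UNIV :: 3 set) = f 1 * (f 2 * f 3)" for f :: "3 \<Rightarrow> real"
    unfolding UNIV_3 by simp
  have le': "l $ i \<le> u $ i" for i
    using le[of "axis i 1"] by (simp add: inner_axis axis_in_Basis_iff)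
  have "(\<Prod>b\<in>Basis. (u - l) \<bullet> b) = measure lborel (cbox l u)"
    using le by (simp add: inner_diff_left)
  also have "\<dots> = (\<Prod>i\<in>UNIV. u $ i - l $ i)"
    using le' by (subst content_cbox_cart) (auto simp: box_ne_empty interval_eq_empty_cart not_less)
  also have "\<dots> = (u $ 1 - l $ 1) * ((u $ 2 - l $ 2) * (u $ 3 - l $ 3))"
    by (rule prod3)
  finally have P: "(\<Prod>b\<in>Basis. (u - l) \<bullet> b) = (u $ 1 - l $ 1) * ((u $ 2 - l $ 2) * (u $ 3 - l $ 3))" .
  have eq: "?T -` box l u = {l $ 1<..<u $ 1} \<times> {l $ 2<..<u $ 2} \<times> {l $ 3<..<u $ 3}"
    by (auto simp: mem_box_cart forall_3)
  have "emeasure (distr lborel borel ?T) (box l u) = emeasure lborel (?T -` box l u)"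
    using T by (subst emeasure_distr) auto
  also have "\<dots> = ennreal (u $ 1 - l $ 1) * (ennreal (u $ 2 - l $ 2) * ennreal (u $ 3 - l $ 3))"
    unfolding eq using le' by (simp add: emeasure_lborel_Times open_Times borel_open)
  also have "\<dots> = ennreal (\<Prod>b\<in>Basis. (u - l) \<bullet> b)"
    unfolding P using le' by (simp add: ennreal_mult)
  finally show "emeasure (distr lborel borel ?T) (box l u) = (\<Prod>b\<in>Basis. (u - l) \<bullet> b)" .
qed simp

text \<open>\<open>wave_symbol R \<bar>\<xi>\<bar>\<close> is the symbol of the fundamental solution of the free wave equation,
  and \<open>ball_symbol R \<bar>\<xi>\<bar>\<close> is the Fourier transform of the ball of radius \<open>R\<close> in \<open>\<real>\<^sup>3\<close>.\<close>

definition wave_symbol :: "real \<Rightarrow> real \<Rightarrow> real" where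
  "wave_symbol R r = (if r = 0 then R else sin (R * r) / r)"

definition ball_symbol :: "real \<Rightarrow> real \<Rightarrow> real" where
  "ball_symbol R r =
    (if r = 0 then 4 / 3 * pi * R ^ 3 else 4 * pi * (sin (R * r) - R * r * cos (R * r)) / r ^ 3)"

lemma abs_wave_symbol_le: "R \<ge> 0 \<Longrightarrow> \<bar>wave_symbol R r\<bar> \<le> R"
  using abs_sin_x_le_abs_x[of "R * r"] by (auto simp: wave_symbol_def abs_mult divide_le_eq)

text \<open>Differentiating a ball in its radius gives the surface measure of the sphere, with
  transform 4 pi R sin (R r) / r. This links balls, whose indicators are functions, with the wave
  symbol.\<close>

lemma ball_symbol_deriv:
  "((\<lambda>R. ball_symbol R r) has_real_derivative 4 * pi * R * wave_symbol R r) (at R)"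
proof (cases "r = 0")
  case True
  have "((\<lambda>R. 4 / 3 * pi * R ^ 3) has_real_derivative 4 * pi * R * R) (at R)"
    by (auto intro!: derivative_eq_intros simp: power2_eq_square)
  then show ?thesis using True by (simp add: ball_symbol_def wave_symbol_def)
next
  case False
  have "((\<lambda>R. (4 * pi / r ^ 3) * (sin (R * r) - R * r * cos (R * r))) has_real_derivative
      (4 * pi / r ^ 3) * (cos (R * r) * r - (r * cos (R * r) + R * r * (- sin (R * r) * r)))) (at R)"
    by (rule DERIV_cmult) (auto intro!: derivative_eq_intros)
  moreover have "(4 * pi / r ^ 3) * (cos (R * r) * r - (r * cos (R * r) + R * r * (- sin (R * r) * r)))
      = 4 * pi * R * (sin (R * r) / r)"
    using False by (simp add: field_simps power3_eq_cube)
  ultimately show ?thesis using False by (simp add: ball_symbol_def wave_symbol_def)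
qed

text \<open>The factor pi (R^2 - x^2) is the area of the disc cut from the ball at height x; the
  antiderivative \<open>G\<close> comes from integrating by parts twice.\<close>

lemma ball_slices_integral:
  assumes R: "R \<ge> 0"
  shows "(\<integral>x. indicator {-R..R} x * (pi * (R\<^sup>2 - x\<^sup>2) * cos (x * r)) \<partial>lborel) = ball_symbol R r"
proof -
  \<comment> \<open>With \<open>a * r = 1\<close> as the only relation, the derivative of
    \<open>G\<close> is settled by a polynomial identity.\<close>
  define a where "a = 1 / r"
  define G where "G x = (if r = 0 then pi * (R\<^sup>2 * x - x ^ 3 / 3)
    else pi * ((R\<^sup>2 - x\<^sup>2) * sin (x * r) * a - 2 * x * cos (x * r) * a\<^sup>2 + 2 * sin (x * r) * a ^ 3))" for x
  have G: "(G has_real_derivative pi * (R\<^sup>2 - x\<^sup>2) * cos (x * r)) (at x)" for x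
  proof (cases "r = 0")
    case True
    have "((\<lambda>x. pi * (R\<^sup>2 * x - x ^ 3 / 3)) has_real_derivative pi * (R\<^sup>2 - x\<^sup>2)) (at x)"
      by (auto intro!: derivative_eq_intros)
    then show ?thesis using True by (simp add: G_def[abs_def])
  next
    case False
    then have a: "a * r = 1" by (simp add: a_def)
    have "((\<lambda>x. pi * ((R\<^sup>2 - x\<^sup>2) * sin (x * r) * a - 2 * x * cos (x * r) * a\<^sup>2 + 2 * sin (x * r) * a ^ 3))
        has_real_derivative pi * (- 2 * x * sin (x * r) * a + (R\<^sup>2 - x\<^sup>2) * cos (x * r) * (r * a)
          - 2 * cos (x * r) * a\<^sup>2 + 2 * x * sin (x * r) * r * a\<^sup>2 + 2 * cos (x * r) * r * a ^ 3)) (at x)"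
      by (auto intro!: derivative_eq_intros simp: algebra_simps)
    moreover have "pi * (- 2 * x * sin (x * r) * a + (R\<^sup>2 - x\<^sup>2) * cos (x * r) * (r * a)
          - 2 * cos (x * r) * a\<^sup>2 + 2 * x * sin (x * r) * r * a\<^sup>2 + 2 * cos (x * r) * r * a ^ 3)
        = pi * (R\<^sup>2 - x\<^sup>2) * cos (x * r)"
      using a by algebra
    ultimately show ?thesis using False by (simp add: G_def[abs_def] mult.assoc)
  qed
  have "(\<integral>x. indicator {-R..R} x *\<^sub>R (pi * (R\<^sup>2 - x\<^sup>2) * cos (x * r)) \<partial>lborel) = G R - G (- R)"
    using R G by (intro integral_FTC_Icc)
      (auto simp flip: has_real_derivative_iff_has_vector_derivative
        intro: has_field_derivative_at_within intro!: continuous_intros)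
  also have "G R - G (- R) = ball_symbol R r"
    by (cases "r = 0") (simp_all add: G_def a_def ball_symbol_def field_simps power2_eq_square power3_eq_cube)
  finally show ?thesis by simp
qed

text \<open>The imaginary part vanishes because it is odd under reflection. For the real part a
  rotation moves the frequency to the first axis, so that the integrand is constant on the
  disc-shaped slices.\<close>

lemma ball_fourier:
  fixes \<zeta> :: "real^3"
  assumes R: "R \<ge> 0"
  shows "(\<integral>y. of_real (indicator (cball 0 R) y) * cis (- (y \<bullet> \<zeta>)) \<partial>lborel) = of_real (ball_symbol R (norm \<zeta>))"
proof -
  let ?B = "cball (0::real^3) R"
  have iB: "integrable lborel (indicator ?B :: _ \<Rightarrow> real)"
    using emeasure_lborel_cball_finite[of "0::real^3" R] by (simp add: integrable_indicator_iff)
  have ic: "integrable lborel (\<lambda>y. complex_of_real (indicator ?B y) * cis (- (y \<bullet> \<zeta>)))"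
    by (rule fourier_integrand_integrable[OF iB])
  have "Im (\<integral>y. of_real (indicator ?B y) * cis (- (y \<bullet> \<zeta>)) \<partial>lborel) = 0"
  proof -
    let ?s = "\<lambda>y. indicator ?B y * sin (y \<bullet> \<zeta>)"
    have "(\<integral>y. ?s (0 - y) \<partial>lborel) = (\<integral>y. ?s y \<partial>lborel)"
      by (rule lborel_reflect(2)) measurable
    moreover have "?s (0 - y) = - ?s y" for y by (auto simp: indicator_def)
    then have "(\<integral>y. ?s (0 - y) \<partial>lborel) = - (\<integral>y. ?s y \<partial>lborel)"
      by (simp only: Bochner_Integration.integral_minus)
    ultimately have "(\<integral>y. ?s y \<partial>lborel) = 0" by linarith
    then show ?thesis unfolding integral_Im[OF ic, symmetric] by simp
  qed
  moreover have "Re (\<integral>y. of_real (indicator ?B y) * cis (- (y \<bullet> \<zeta>)) \<partial>lborel) = ball_symbol R (norm \<zeta>)"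
  proof -
    define r where "r = norm \<zeta>"
    have n: "norm (axis 1 r :: real^3) = norm \<zeta>"
      unfolding norm_eq_sqrt_inner[of "axis 1 r"] inner_axis_axis by (simp add: r_def)
    obtain f :: "real^3 \<Rightarrow> real^3" where f: "orthogonal_transformation f" "f (axis 1 r) = \<zeta>"
      by (rule orthogonal_transformation_exists[OF n])
    have lin: "linear f" using f(1) by (rule orthogonal_transformation_linear)
    have fm [measurable]: "f \<in> borel_measurable borel"
      by (intro borel_measurable_continuous_onI linear_continuous_on) (use lin in \<open>simp add: linear_conv_bounded_linear\<close>)
    let ?T = "\<lambda>(x, y, z). vector [x, y, z] :: real^3"
    note T = borel_measurable_vector3
    have Tl: "?T \<in> lborel \<rightarrow>\<^sub>M borel" "f \<in> lborel \<rightarrow>\<^sub>M borel" using T fm by auto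
    have "Re (\<integral>y. of_real (indicator ?B y) * cis (- (y \<bullet> \<zeta>)) \<partial>lborel) = (\<integral>y. indicator ?B y * cos (y \<bullet> \<zeta>) \<partial>lborel)"
      unfolding integral_Re[OF ic, symmetric] by simp
    also have "\<dots> = (\<integral>y. indicator ?B y * cos (y \<bullet> \<zeta>) \<partial>(distr lborel borel f))"
      unfolding lborel_distr_orthogonal[OF f(1)] ..
    also have "\<dots> = (\<integral>y. indicator ?B (f y) * cos (f y \<bullet> \<zeta>) \<partial>lborel)"
      by (rule integral_distr[OF Tl(2)]) measurable
    also have "\<dots> = (\<integral>y. indicator ?B y * cos (y \<bullet> axis 1 r) \<partial>lborel)"
    proof -
      have "norm (f y) = norm y" "f y \<bullet> \<zeta> = y \<bullet> axis 1 r" for y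
        using f by (auto simp: orthogonal_transformation_norm orthogonal_transformation_def)
      then show ?thesis by (simp add: indicator_def)
    qed
    also have "\<dots> = (\<integral>y. indicator ?B y * cos (y \<bullet> axis 1 r) \<partial>(distr lborel borel ?T))"
      unfolding lborel_distr_vector3 ..
    also have "\<dots> = (\<integral>w. indicator ?B (?T w) * cos (?T w \<bullet> axis 1 r) \<partial>lborel)"
      by (rule integral_distr[OF Tl(1)]) measurable
    also have "\<dots> = (\<integral>w. (case w of (x, v) \<Rightarrow> indicator (cball 0 R) (x, v) * cos (x * r)) \<partial>(lborel \<Otimes>\<^sub>M (lborel :: (real \<times> real) measure)))"
    proof -
      have "norm (?T w) = norm w" "?T w \<bullet> axis 1 r = fst w * r" for w
        by (auto simp: norm_vec_def L2_set_def sum_3 norm_Pair inner_axis split: prod.split)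
      then show ?thesis by (simp add: indicator_def case_prod_unfold lborel_prod)
    qed
    also have "\<dots> = (\<integral>x. (\<integral>v. indicator (cball 0 R) (x, v) * cos (x * r) \<partial>(lborel :: (real \<times> real) measure)) \<partial>lborel)"
    proof (rule lborel_pair.integral_fst[symmetric])
      have "integrable lborel (\<lambda>w::real \<times> real \<times> real. indicator (cball 0 R) w * cos (fst w * r))"
      proof (rule Bochner_Integration.integrable_bound)
        show "integrable lborel (indicator (cball 0 R) :: real \<times> real \<times> real \<Rightarrow> real)"
          using emeasure_lborel_cball_finite[of "0::real\<times>real\<times>real" R] by (simp add: integrable_indicator_iff)
        have [measurable]: "(\<lambda>w::real \<times> real \<times> real. cos (fst w * r)) \<in> borel_measurable borel"
          by (intro borel_measurable_continuous_onI continuous_intros)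
        show "(\<lambda>w::real \<times> real \<times> real. indicator (cball 0 R) w * cos (fst w * r)) \<in> borel_measurable lborel"
          by measurable
      qed (auto simp: indicator_def)
      then show "integrable (lborel \<Otimes>\<^sub>M lborel) (\<lambda>(x, v::real\<times>real). indicator (cball 0 R) (x, v) * cos (x * r))"
        by (simp add: lborel_prod case_prod_unfold)
    qed
    also have "\<dots> = (\<integral>x. indicator {-R..R} x * (pi * (R\<^sup>2 - x\<^sup>2) * cos (x * r)) \<partial>lborel)"
    proof (intro Bochner_Integration.integral_cong refl)
      fix x :: real
      show "(\<integral>v. indicator (cball 0 R) (x, v) * cos (x * r) \<partial>(lborel :: (real \<times> real) measure))
          = indicator {-R..R} x * (pi * (R\<^sup>2 - x\<^sup>2) * cos (x * r))"
      proof (cases "x \<in> {-R..R}")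
        case True
        then have "\<bar>x\<bar> \<le> R" by auto
        then have x: "x\<^sup>2 \<le> R\<^sup>2" using R by (simp add: abs_le_square_iff[symmetric])
        have "(indicator (cball 0 R) (x, v) :: real) = indicator (cball 0 (sqrt (R\<^sup>2 - x\<^sup>2))) v" for v :: "real \<times> real"
        proof -
          have "sqrt (x\<^sup>2 + (norm v)\<^sup>2) \<le> R \<longleftrightarrow> x\<^sup>2 + (norm v)\<^sup>2 \<le> R\<^sup>2"
            using R by (simp add: real_sqrt_le_iff')
          moreover have "norm v \<le> sqrt (R\<^sup>2 - x\<^sup>2) \<longleftrightarrow> (norm v)\<^sup>2 \<le> R\<^sup>2 - x\<^sup>2"
            using x by (metis norm_ge_zero real_le_rsqrt real_sqrt_le_mono real_sqrt_pow2 diff_ge_0_iff_ge power_mono)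
          ultimately show ?thesis by (auto simp: indicator_def norm_Pair)
        qed
        then have "(\<integral>v. indicator (cball 0 R) (x, v) * cos (x * r) \<partial>(lborel :: (real \<times> real) measure))
            = measure lborel (cball (0::real\<times>real) (sqrt (R\<^sup>2 - x\<^sup>2))) * cos (x * r)"
          by simp
        also have "measure lborel (cball (0::real\<times>real) (sqrt (R\<^sup>2 - x\<^sup>2))) = pi * (R\<^sup>2 - x\<^sup>2)"
          using x by (subst content_cball) (auto simp: eval_unit_ball_vol)
        finally show ?thesis using True by simp
      next
        case False
        then have "(x, v) \<notin> cball 0 R" for v :: "real \<times> real"
          using norm_fst_le[of x v] by (auto simp: abs_le_iff)
        then show ?thesis using False by simp
      qed
    qed
    also have "\<dots> = ball_symbol R r" by (rule ball_slices_integral[OF R])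
    finally show ?thesis by (simp add: r_def)
  qed
  ultimately show ?thesis by (simp add: complex_eq_iff)
qed

section \<open>Descent from three dimensions and Kirchhoff averages\<close>

text \<open>Method of descent, and a place where n <= 3 is essential: \<open>P\<close> is the
  adjoint of an isometric embedding into R^3, so a character of R^n pulled back by \<open>P\<close>
  is a character of R^3 whose frequency has the same length. As \<open>P\<close> does not increase
  norms, the speed of propagation remains at most one.\<close>

lemma isometric_projection:
  assumes "DIM('a::euclidean_space) \<le> 3"
  obtains P :: "real^3 \<Rightarrow> 'a::euclidean_space" where "linear P" "\<And>y. norm (P y) \<le> norm y"
    "\<And>\<xi>. \<exists>\<zeta>. norm \<zeta> = norm \<xi> \<and> (\<forall>y. P y \<bullet> \<xi> = y \<bullet> \<zeta>)"
proof -
  have "dim (UNIV :: 'a set) \<le> dim (UNIV :: (real^3) set)" using assms by simp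
  from isometry_subset_subspace[OF subspace_UNIV subspace_UNIV this]
  obtain L :: "'a \<Rightarrow> real^3" where L: "linear L" "\<And>x. norm (L x) = norm x" by auto
  define P where "P = adjoint L"
  have adj: "P y \<bullet> \<xi> = y \<bullet> L \<xi>" for y \<xi>
    using adjoint_works[OF L(1), of \<xi> y] by (simp add: P_def inner_commute)
  have "norm (P y) \<le> norm y" for y
  proof (cases "P y = 0")
    case False
    have "norm (P y) * norm (P y) = y \<bullet> L (P y)"
      by (simp flip: adj power2_norm_eq_inner power2_eq_square)
    also have "\<dots> \<le> norm y * norm (P y)"
      using norm_cauchy_schwarz[of y "L (P y)"] by (simp add: L)
    finally show ?thesis using False by simp
  qed simp
  moreover have "linear P" unfolding P_def by (rule adjoint_linear[OF L(1)])
  ultimately show ?thesis using that[of P] adj L(2) by blast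
qed

text \<open>The average of a character over a ball of R^3 depends only on the length of its
  frequency, so three-dimensional balls produce radial symbols on R^n as well.\<close>

lemma ball_pairing:
  fixes P :: "real^3 \<Rightarrow> 'a::euclidean_space"
  assumes P: "linear P" "\<And>\<xi>. \<exists>\<zeta>. norm \<zeta> = norm \<xi> \<and> (\<forall>y. P y \<bullet> \<xi> = y \<bullet> \<zeta>)"
    and H: "integrable lborel H"
    and q: "\<And>y. Re (\<integral>\<xi>. cis (- (P y \<bullet> \<xi>)) * H \<xi> \<partial>lborel) = q y"
    and R: "R \<ge> 0"
  shows "integrable lborel (\<lambda>y. indicator (cball 0 R) y * q y)"
    and "integrable lborel (\<lambda>\<xi>. of_real (ball_symbol R (norm \<xi>)) * H \<xi>)"
    and "Re (\<integral>\<xi>. of_real (ball_symbol R (norm \<xi>)) * H \<xi> \<partial>lborel) = (\<integral>y. indicator (cball 0 R) y * q y \<partial>lborel)"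
proof -
  let ?B = "cball (0::real^3) R"
  let ?I = "\<lambda>y. complex_of_real (indicator ?B y)"
  have iB: "integrable lborel ?I"
    using emeasure_lborel_cball_finite[of "0::real^3" R]
    by (intro integrable_of_real) (simp add: integrable_indicator_iff)
  have Pm [measurable]: "P \<in> borel_measurable borel"
    by (intro borel_measurable_continuous_onI linear_continuous_on) (use P(1) in \<open>simp add: linear_conv_bounded_linear\<close>)
  have "integrable (lborel \<Otimes>\<^sub>M lborel) (\<lambda>z. (case z of (y, \<xi>) \<Rightarrow> ?I y * H \<xi>) * cis (- (P (fst z) \<bullet> snd z)))"
    by (intro integrable_mult_cis integrable_pair_mult iB H) measurable
  then have i: "integrable (lborel \<Otimes>\<^sub>M lborel) (\<lambda>(y, \<xi>). ?I y * H \<xi> * cis (- (P y \<bullet> \<xi>)))"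
    by (simp add: case_prod_unfold)
  have b: "(\<integral>y. ?I y * H \<xi> * cis (- (P y \<bullet> \<xi>)) \<partial>lborel) = of_real (ball_symbol R (norm \<xi>)) * H \<xi>" for \<xi>
  proof -
    obtain \<zeta> where \<zeta>: "norm \<zeta> = norm \<xi>" "\<And>y. P y \<bullet> \<xi> = y \<bullet> \<zeta>" using P(2) by blast
    have "(\<integral>y. ?I y * H \<xi> * cis (- (P y \<bullet> \<xi>)) \<partial>lborel) = (\<integral>y. H \<xi> * (?I y * cis (- (y \<bullet> \<zeta>))) \<partial>lborel)"
      by (simp add: \<zeta>(2) mult_ac)
    also have "\<dots> = H \<xi> * (\<integral>y. ?I y * cis (- (y \<bullet> \<zeta>)) \<partial>lborel)" by (rule integral_mult_right_zero)
    finally show ?thesis unfolding ball_fourier[OF R] \<zeta>(1) by (simp only: mult.commute)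
  qed
  have e: "Re (\<integral>\<xi>. ?I y * H \<xi> * cis (- (P y \<bullet> \<xi>)) \<partial>lborel) = indicator ?B y * q y" for y
  proof -
    have "(\<integral>\<xi>. ?I y * H \<xi> * cis (- (P y \<bullet> \<xi>)) \<partial>lborel) = ?I y * (\<integral>\<xi>. cis (- (P y \<bullet> \<xi>)) * H \<xi> \<partial>lborel)"
      unfolding integral_mult_right_zero[symmetric] by (simp add: mult_ac)
    then show ?thesis by (simp add: q)
  qed
  note i1 = lborel_pair.integrable_fst[OF i] and i2 = lborel_pair.integrable_snd[OF i]
  show "integrable lborel (\<lambda>y. indicator ?B y * q y)"
    using integrable_Re[OF i1] unfolding e .
  show "integrable lborel (\<lambda>\<xi>. of_real (ball_symbol R (norm \<xi>)) * H \<xi>)"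
    using i2 unfolding b .
  have "(\<integral>\<xi>. of_real (ball_symbol R (norm \<xi>)) * H \<xi> \<partial>lborel)
      = (\<integral>y. (\<integral>\<xi>. ?I y * H \<xi> * cis (- (P y \<bullet> \<xi>)) \<partial>lborel) \<partial>lborel)"
    unfolding b[symmetric] by (rule lborel_pair.Fubini_integral[OF i])
  then show "Re (\<integral>\<xi>. of_real (ball_symbol R (norm \<xi>)) * H \<xi> \<partial>lborel) = (\<integral>y. indicator ?B y * q y \<partial>lborel)"
    using integral_Re[OF i1] unfolding e by simp
qed

lemma wave_symbol_measurable [measurable]: "wave_symbol R \<in> borel_measurable borel"
  unfolding wave_symbol_def[abs_def] by measurable

lemma integrable_bounded_mult:
  fixes m :: "'a \<Rightarrow> real" and H :: "'a \<Rightarrow> complex"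
  assumes H: "integrable M H" and m: "m \<in> borel_measurable M" "\<And>x. \<bar>m x\<bar> \<le> C"
  shows "integrable M (\<lambda>x. of_real (m x) * H x)"
proof (rule Bochner_Integration.integrable_bound)
  show "integrable M (\<lambda>x. of_real C * H x)" using H by simp
  have "m x \<le> \<bar>C\<bar>" "- m x \<le> \<bar>C\<bar>" for x using m(2)[of x] by auto
  then show "AE x in M. norm (of_real (m x) * H x) \<le> norm (of_real C * H x)"
    by (auto simp: norm_mult abs_le_iff intro!: mult_right_mono)
  show "(\<lambda>x. of_real (m x) * H x) \<in> borel_measurable M"
    using m(1) borel_measurable_integrable[OF H] by measurable
qed

text \<open>Kirchhoff's formula in weak form: up to the factor \<open>s\<close>, the wave operator at time \<open>s\<close> averages
  translates by vectors of length at most \<open>s\<close>.  The average over the sphere of radius \<open>s\<close> is obtained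
  as the limit of averages over thin spherical shells.\<close>

lemma wave_pairing_lower_bound:
  fixes f \<phi> :: "'a::euclidean_space \<Rightarrow> real"
  assumes dim: "DIM('a) \<le> 3" and fg: "fourier_pair f g"
    and \<phi>: "integrable lborel \<phi>" "square_integrable \<phi>"
    and s: "0 \<le> s" "s < r" and M: "\<And>y. norm y \<le> r \<Longrightarrow> M \<le> (\<integral>x. f x * \<phi> (x + y) \<partial>lborel)"
  shows "(2 * pi) ^ DIM('a) * (s * M)
    \<le> Re (\<integral>\<xi>. of_real (wave_symbol s (norm \<xi>)) * (g \<xi> * cnj (fourier_integral \<phi> \<xi>)) \<partial>lborel)"
proof (cases "s = 0")
  case True
  then have "wave_symbol s r = 0" for r by (simp add: wave_symbol_def)
  then show ?thesis using True by simp
next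
  case False
  with s have s0: "s > 0" by simp
  define c where "c = (2 * pi) ^ DIM('a)"
  have c: "c > 0" by (simp add: c_def)
  obtain P :: "real^3 \<Rightarrow> 'a" where P: "linear P" "\<And>y. norm (P y) \<le> norm y"
    "\<And>\<xi>. \<exists>\<zeta>. norm \<zeta> = norm \<xi> \<and> (\<forall>y. P y \<bullet> \<xi> = y \<bullet> \<zeta>)"
    using isometric_projection[OF dim] by blast
  define H where "H \<xi> = g \<xi> * cnj (fourier_integral \<phi> \<xi>)" for \<xi>
  have H: "integrable lborel H"
    unfolding H_def using fg plancherel(1)[OF \<phi>] by (intro square_integrable_mult_cnj) (auto simp: fourier_pair_def)
  define q where "q y = c * (\<integral>x. f x * \<phi> (x + P y) \<partial>lborel)" for y
  have q: "Re (\<integral>\<xi>. cis (- (P y \<bullet> \<xi>)) * H \<xi> \<partial>lborel) = q y" for y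
    unfolding H_def q_def c_def by (rule fourier_pair_translate[OF fg \<phi>])
  have qM: "c * M \<le> q y" if "norm y \<le> r" for y
    unfolding q_def using M[of "P y"] P(2)[of y] that c by simp
  note pairing = ball_pairing[OF P(1,3) H q]
  \<comment> \<open>The shells have thickness at most r - s, so they stay inside the radius r up to
    which the bound by M is available.\<close>
  define h where "h k = (r - s) / real (Suc k)" for k
  have h: "h k > 0" "h k \<le> r - s" for k
    using s by (auto simp: h_def divide_le_eq mult_le_cancel_left1)
  have hlim: "h \<longlonglongrightarrow> 0"
    unfolding h_def[abs_def] by (rule LIMSEQ_Suc[OF lim_const_over_n])
  define D where "D k \<rho> = (ball_symbol (s + h k) \<rho> - ball_symbol s \<rho>) / h k" for k \<rho>
  have ball0: "(\<integral>y. indicator (cball (0::real^3) R) y \<partial>lborel) = ball_symbol R 0" if "R \<ge> 0" for R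
  proof -
    have "complex_of_real (\<integral>y. indicator (cball (0::real^3) R) y \<partial>lborel) = of_real (ball_symbol R 0)"
      using ball_fourier[OF that, of 0] by (simp del: integral_indicator)
    then show ?thesis by (simp only: of_real_eq_iff)
  qed
  \<comment> \<open>The shell between the radii s and s + h k has measure h k * D k 0, so the
    integral of \<open>q\<close> over it is at least c M times that. The sign of M is
    arbitrary.\<close>
  have lower: "c * M * D k 0 \<le> Re (\<integral>\<xi>. of_real (D k (norm \<xi>)) * H \<xi> \<partial>lborel)" for k
  proof -
    let ?A = "cball (0::real^3) (s + h k)" and ?B = "cball (0::real^3) s"
    have R: "s + h k \<ge> 0" "s \<ge> 0" using s h(1)[of k] by auto
    have iI: "integrable lborel (indicator (cball (0::real^3) R) :: _ \<Rightarrow> real)" for R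
      using emeasure_lborel_cball_finite[of "0::real^3" R] by (simp add: integrable_indicator_iff)
    have "(\<integral>y. (indicator ?A y - indicator ?B y) * (c * M) \<partial>lborel)
        \<le> (\<integral>y. indicator ?A y * q y - indicator ?B y * q y \<partial>lborel)"
    proof (rule integral_mono)
      show "integrable lborel (\<lambda>y. (indicator ?A y - indicator ?B y) * (c * M))"
        by (intro integrable_mult_left Bochner_Integration.integrable_diff iI)
      show "integrable lborel (\<lambda>y. indicator ?A y * q y - indicator ?B y * q y)"
        by (intro Bochner_Integration.integrable_diff pairing(1) R)
      fix y
      show "(indicator ?A y - indicator ?B y) * (c * M) \<le> indicator ?A y * q y - indicator ?B y * q y"
        using qM[of y] h[of k] by (auto simp: indicator_def)
    qed
    also have "\<dots> = Re (\<integral>\<xi>. of_real (ball_symbol (s + h k) (norm \<xi>)) * H \<xi> \<partial>lborel)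
        - Re (\<integral>\<xi>. of_real (ball_symbol s (norm \<xi>)) * H \<xi> \<partial>lborel)"
      unfolding pairing(3)[OF R(1)] pairing(3)[OF R(2)]
      by (intro Bochner_Integration.integral_diff pairing(1) R)
    also have "\<dots> = Re (\<integral>\<xi>. of_real (ball_symbol (s + h k) (norm \<xi>)) * H \<xi>
        - of_real (ball_symbol s (norm \<xi>)) * H \<xi> \<partial>lborel)"
      using pairing(2)[OF R(1)] pairing(2)[OF R(2)] by simp
    also have "\<dots> = Re (\<integral>\<xi>. of_real (h k) * (of_real (D k (norm \<xi>)) * H \<xi>) \<partial>lborel)"
      using h(1)[of k] by (simp add: D_def left_diff_distrib)
    also have "\<dots> = h k * Re (\<integral>\<xi>. of_real (D k (norm \<xi>)) * H \<xi> \<partial>lborel)" by simp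
    also have "(\<integral>y. (indicator ?A y - indicator ?B y) * (c * M) \<partial>lborel) = h k * (c * M * D k 0)"
    proof -
      have "(\<integral>y. (indicator ?A y - indicator ?B y) * (c * M) \<partial>lborel)
          = ((\<integral>y. indicator ?A y \<partial>lborel) - (\<integral>y. indicator ?B y \<partial>lborel)) * (c * M)"
        using iI by (simp del: integral_indicator)
      then show ?thesis unfolding ball0[OF R(1)] ball0[OF R(2)] using h(1)[of k] by (simp add: D_def)
    qed
    finally show ?thesis using h(1)[of k] by (simp only: mult_le_cancel_left_pos)
  qed
  have Dlim: "(\<lambda>k. D k \<rho>) \<longlonglongrightarrow> 4 * pi * s * wave_symbol s \<rho>" for \<rho>
  proof -
    have "filterlim h (at 0) sequentially"
      using hlim h(1) by (intro filterlim_atI) (auto intro!: always_eventually simp: less_imp_neq[symmetric])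
    from filterlim_compose[OF DERIV_D[OF ball_symbol_deriv] this] show ?thesis
      unfolding D_def .
  qed
  \<comment> \<open>The mean value theorem bounds the difference quotients uniformly in k and in the
    frequency, which supplies the dominating function.\<close>
  have Dbound: "\<bar>D k \<rho>\<bar> \<le> 4 * pi * r * r" for k \<rho>
  proof -
    obtain z where z: "s < z" "z < s + h k" "ball_symbol (s + h k) \<rho> - ball_symbol s \<rho> = (s + h k - s) * (4 * pi * z * wave_symbol z \<rho>)"
      using MVT2[of s "s + h k" "\<lambda>R. ball_symbol R \<rho>" "\<lambda>R. 4 * pi * R * wave_symbol R \<rho>"] ball_symbol_deriv h(1)[of k]
      by auto
    have zr: "z \<ge> 0" "z \<le> r" using z s h[of k] by auto
    have "D k \<rho> = 4 * pi * z * wave_symbol z \<rho>" using z(3) h(1)[of k] by (simp add: D_def)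
    also have "\<bar>\<dots>\<bar> = 4 * pi * z * \<bar>wave_symbol z \<rho>\<bar>" using zr by (simp add: abs_mult)
    also have "\<dots> \<le> 4 * pi * r * r"
      using abs_wave_symbol_le[OF zr(1), of \<rho>] zr by (intro mult_mono) auto
    finally show ?thesis .
  qed
  have Dm [measurable]: "D k \<in> borel_measurable borel" for k
    unfolding D_def[abs_def] ball_symbol_def[abs_def] by measurable
  have Hm [measurable]: "H \<in> borel_measurable borel" using borel_measurable_integrable[OF H] by simp
  have "(\<lambda>k. \<integral>\<xi>. of_real (D k (norm \<xi>)) * H \<xi> \<partial>lborel)
      \<longlonglongrightarrow> (\<integral>\<xi>. of_real (4 * pi * s * wave_symbol s (norm \<xi>)) * H \<xi> \<partial>lborel)"
  proof (rule integral_dominated_convergence)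
    show "integrable lborel (\<lambda>\<xi>. (4 * pi * r * r) * norm (H \<xi>))" using H by simp
    show "AE \<xi> in lborel. (\<lambda>k. of_real (D k (norm \<xi>)) * H \<xi>) \<longlonglongrightarrow> of_real (4 * pi * s * wave_symbol s (norm \<xi>)) * H \<xi>"
      by (intro AE_I2 tendsto_mult tendsto_of_real Dlim tendsto_const)
    show "AE \<xi> in lborel. norm (of_real (D k (norm \<xi>)) * H \<xi>) \<le> (4 * pi * r * r) * norm (H \<xi>)" for k
    proof (rule AE_I2)
      fix \<xi> :: 'a
      show "norm (of_real (D k (norm \<xi>)) * H \<xi>) \<le> (4 * pi * r * r) * norm (H \<xi>)"
        unfolding norm_mult norm_of_real by (intro mult_right_mono Dbound) simp
    qed
  qed measurable
  then have 1: "(\<lambda>k. Re (\<integral>\<xi>. of_real (D k (norm \<xi>)) * H \<xi> \<partial>lborel))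
      \<longlonglongrightarrow> Re (\<integral>\<xi>. of_real (4 * pi * s * wave_symbol s (norm \<xi>)) * H \<xi> \<partial>lborel)"
    by (rule tendsto_Re)
  \<comment> \<open>At frequency 0 the limit is 4 pi s^2, the area of the sphere. Cancelling 4 pi s
    leaves the factor s of Kirchhoff's formula.\<close>
  have "(\<lambda>k. c * M * D k 0) \<longlonglongrightarrow> c * M * (4 * pi * s * wave_symbol s 0)"
    by (intro tendsto_intros Dlim)
  from LIMSEQ_le[OF this 1] lower
  have "c * M * (4 * pi * s * wave_symbol s 0) \<le> Re (\<integral>\<xi>. of_real (4 * pi * s * wave_symbol s (norm \<xi>)) * H \<xi> \<partial>lborel)"
    by blast
  also have "(\<integral>\<xi>. of_real (4 * pi * s * wave_symbol s (norm \<xi>)) * H \<xi> \<partial>lborel)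
      = of_real (4 * pi * s) * (\<integral>\<xi>. of_real (wave_symbol s (norm \<xi>)) * H \<xi> \<partial>lborel)"
    unfolding integral_mult_right_zero[symmetric] by (simp add: mult.assoc)
  finally have "(4 * pi * s) * (c * (s * M)) \<le> (4 * pi * s) * Re (\<integral>\<xi>. of_real (wave_symbol s (norm \<xi>)) * H \<xi> \<partial>lborel)"
    by (simp add: wave_symbol_def mult_ac)
  then have "c * (s * M) \<le> Re (\<integral>\<xi>. of_real (wave_symbol s (norm \<xi>)) * H \<xi> \<partial>lborel)"
    using s0 by (subst (asm) mult_le_cancel_left_pos) auto
  then show ?thesis unfolding H_def c_def .
qed

section \<open>Positivity of the damped wave operator\<close>

text \<open>The entire functions with \<open>cos_sqrt (y\<^sup>2) = cos y\<close>, \<open>cos_sqrt (- y\<^sup>2) = cosh y\<close> and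
  \<open>y * sin_sqrt (y\<^sup>2) = sin y\<close>, \<open>y * sin_sqrt (- y\<^sup>2) = sinh y\<close>.\<close>

definition cos_sqrt :: "real \<Rightarrow> real" where
  "cos_sqrt x = (\<Sum>n. (- 1) ^ n / fact (2 * n) * x ^ n)"

definition sin_sqrt :: "real \<Rightarrow> real" where
  "sin_sqrt x = (\<Sum>n. (- 1) ^ n / fact (2 * n + 1) * x ^ n)"

lemma cos_sqrt_square_sums: "(\<lambda>n. (- 1) ^ n / fact (2 * n) * (y\<^sup>2) ^ n) sums cos (y::real)"
  using cos_paired[of y] by (simp add: power_mult)

text \<open>Consecutive terms of the series of cosh are grouped in pairs, in which the odd term is
  0; the two alternating signs cancel.\<close>

lemma cos_sqrt_minus_square_sums: "(\<lambda>n. (- 1) ^ n / fact (2 * n) * (- (y\<^sup>2)) ^ n) sums cosh (y::real)"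
proof -
  have "(\<lambda>n. \<Sum>k = n * 2..<n * 2 + 2. if even k then y ^ k /\<^sub>R fact k else 0) sums cosh y"
    by (rule sums_group) (use cosh_converges[of y] in auto)
  moreover have "(\<Sum>k = n * 2..<n * 2 + 2. if even k then y ^ k /\<^sub>R fact k else 0)
      = (- 1) ^ n / fact (2 * n) * (- (y\<^sup>2)) ^ n" for n
  proof -
    have "{n * 2..<n * 2 + 2} = {2 * n, 2 * n + 1}" by auto
    moreover have "(- (y\<^sup>2)) ^ n = (- 1) ^ n * y ^ (2 * n)"
      by (simp add: power_mult flip: power_mult_distrib)
    ultimately show ?thesis by (simp add: divide_inverse flip: power_mult_distrib)
  qed
  ultimately show ?thesis by simp
qed

lemma sin_sqrt_square_sums: "(\<lambda>n. y * ((- 1) ^ n / fact (2 * n + 1) * (y\<^sup>2) ^ n)) sums sin (y::real)"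
  using sin_paired[of y]
  by (simp only: power_add power_one_right power_mult) (simp only: mult.left_commute mult.commute mult.assoc)

lemma sin_sqrt_minus_square_sums: "(\<lambda>n. y * ((- 1) ^ n / fact (2 * n + 1) * (- (y\<^sup>2)) ^ n)) sums sinh (y::real)"
proof -
  have "(\<lambda>n. \<Sum>k = n * 2..<n * 2 + 2. if even k then 0 else y ^ k /\<^sub>R fact k) sums sinh y"
    by (rule sums_group) (use sinh_converges[of y] in auto)
  moreover have "(\<Sum>k = n * 2..<n * 2 + 2. if even k then 0 else y ^ k /\<^sub>R fact k)
      = y * ((- 1) ^ n / fact (2 * n + 1) * (- (y\<^sup>2)) ^ n)" for n
  proof -
    have "{n * 2..<n * 2 + 2} = {2 * n, 2 * n + 1}" by auto
    moreover have "(- (y\<^sup>2)) ^ n = (- 1) ^ n * y ^ (2 * n)"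
      by (simp add: power_mult flip: power_mult_distrib)
    ultimately show ?thesis by (simp add: divide_inverse mult_ac flip: power_mult_distrib)
  qed
  ultimately show ?thesis by simp
qed

lemma summable_cos_sqrt: "summable (\<lambda>n. (- 1) ^ n / fact (2 * n) * (x::real) ^ n)"
proof (cases "x \<ge> 0")
  case True
  then show ?thesis using sums_summable[OF cos_sqrt_square_sums[of "sqrt x"]] by simp
next
  case False
  then show ?thesis using sums_summable[OF cos_sqrt_minus_square_sums[of "sqrt (- x)"]] by simp
qed

lemma summable_sin_sqrt: "summable (\<lambda>n. (- 1) ^ n / fact (2 * n + 1) * (x::real) ^ n)"
\<comment> \<open>The sine series carries a factor y with y^2 = |x|, which can be cancelled only if
  x is not 0.\<close>
proof (cases "x = 0")
  case True
  then show ?thesis by (auto intro: summable_finite[of "{0}"])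
next
  case nz: False
  show ?thesis
  proof (cases "x \<ge> 0")
    case True
    then show ?thesis
      using sums_summable[OF sin_sqrt_square_sums[of "sqrt x"]] nz
      by (subst (asm) summable_cmult_iff) auto
  next
    case False
    then show ?thesis
      using sums_summable[OF sin_sqrt_minus_square_sums[of "sqrt (- x)"]] nz
      by (subst (asm) summable_cmult_iff) auto
  qed
qed

lemma cos_sqrt_square: "cos_sqrt (y\<^sup>2) = cos y"
  unfolding cos_sqrt_def by (rule sums_unique[symmetric, OF cos_sqrt_square_sums])

lemma cos_sqrt_minus_square: "cos_sqrt (- (y\<^sup>2)) = cosh y"
  unfolding cos_sqrt_def by (rule sums_unique[symmetric, OF cos_sqrt_minus_square_sums])

lemma sin_sqrt_square: "y * sin_sqrt (y\<^sup>2) = sin y"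
  unfolding sin_sqrt_def by (subst suminf_mult[symmetric], rule summable_sin_sqrt)
    (rule sums_unique[symmetric, OF sin_sqrt_square_sums])

lemma sin_sqrt_minus_square: "y * sin_sqrt (- (y\<^sup>2)) = sinh y"
  unfolding sin_sqrt_def by (subst suminf_mult[symmetric], rule summable_sin_sqrt)
    (rule sums_unique[symmetric, OF sin_sqrt_minus_square_sums])

lemma cos_sqrt_0 [simp]: "cos_sqrt 0 = 1"
  using cos_sqrt_square[of 0] by simp

lemma sin_sqrt_0 [simp]: "sin_sqrt 0 = 1"
  unfolding sin_sqrt_def by (subst suminf_finite[of "{0}"]) auto

text \<open>In terms of x = y^2 this says that cos y has the derivative - sin y / (2 y). It is the
  reason why the mixed derivative of the oscillator in time and mass is again an oscillator.\<close>

lemma cos_sqrt_deriv: "(cos_sqrt has_real_derivative - sin_sqrt x / 2) (at x)"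
proof -
  have "(cos_sqrt has_real_derivative (\<Sum>n. diffs (\<lambda>n. (- 1) ^ n / fact (2 * n)) n * x ^ n)) (at x)"
    unfolding cos_sqrt_def[abs_def] by (rule termdiffs_strong_converges_everywhere[OF summable_cos_sqrt])
  moreover have "diffs (\<lambda>n. (- 1) ^ n / fact (2 * n)) n = (- 1 / 2) * ((- 1) ^ n / fact (2 * n + 1) :: real)" for n
  proof -
    have "(fact (2 * Suc n) :: real) = (2 * real (Suc n)) * fact (2 * n + 1)"
      by (simp add: algebra_simps)
    then show ?thesis unfolding diffs_def by (simp del: fact_Suc of_nat_Suc)
  qed
  then have "(\<Sum>n. diffs (\<lambda>n. (- 1) ^ n / fact (2 * n)) n * x ^ n) = (- 1 / 2) * sin_sqrt x"
    unfolding sin_sqrt_def using summable_sin_sqrt[of x] by (subst suminf_mult[symmetric]) (simp_all only: mult.assoc)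
  ultimately show ?thesis by simp
qed

lemma sin_sqrt_differentiable: "\<exists>D. (sin_sqrt has_real_derivative D) (at x)"
  unfolding sin_sqrt_def[abs_def] using termdiffs_strong_converges_everywhere[OF summable_sin_sqrt] by blast

lemma continuous_on_sin_sqrt [continuous_intros]: "continuous_on A f \<Longrightarrow> continuous_on A (\<lambda>x. sin_sqrt (f x))"
  by (rule continuous_on_compose2[of UNIV sin_sqrt])
    (use sin_sqrt_differentiable in \<open>auto intro!: continuous_at_imp_continuous_on intro: DERIV_isCont\<close>)

lemma continuous_on_cos_sqrt [continuous_intros]: "continuous_on A f \<Longrightarrow> continuous_on A (\<lambda>x. cos_sqrt (f x))"
  by (rule continuous_on_compose2[of UNIV cos_sqrt])
    (use cos_sqrt_deriv in \<open>auto intro!: continuous_at_imp_continuous_on intro: DERIV_isCont\<close>)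

text \<open>The solution of \<open>w'' + z w = 0\<close> with \<open>w(0) = 0\<close>, \<open>w'(0) = 1\<close>, so that
  \<open>K_hat t \<xi> = exp (- t / 2) * oscillator t (\<bar>\<xi>\<bar>\<^sup>2 - 1 / 4)\<close>.\<close>

definition oscillator :: "real \<Rightarrow> real \<Rightarrow> real" where
  "oscillator t z = t * sin_sqrt (t\<^sup>2 * z)"

lemma oscillator_square: "w \<noteq> 0 \<Longrightarrow> oscillator t (w\<^sup>2) = sin (t * w) / w"
  using sin_sqrt_square[of "t * w"] by (simp add: oscillator_def power_mult_distrib field_simps)

lemma oscillator_minus_square: "w \<noteq> 0 \<Longrightarrow> oscillator t (- (w\<^sup>2)) = sinh (t * w) / w"
  using sin_sqrt_minus_square[of "t * w"] by (simp add: oscillator_def power_mult_distrib field_simps)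

lemma oscillator_0 [simp]: "oscillator t 0 = t"
  by (simp add: oscillator_def)

lemma oscillator_wave_symbol: "oscillator t (r\<^sup>2) = wave_symbol t r"
  by (cases "r = 0") (simp_all add: wave_symbol_def oscillator_square)

text \<open>The three cases of \<open>K_hat\<close> are one entire function of |\<xi>|^2, so
  measurability and the comparison with the free wave need no case distinction.\<close>

lemma K_hat_oscillator: "K_hat t \<xi> = exp (- t / 2) * oscillator t ((norm \<xi>)\<^sup>2 - 1 / 4)"
proof -
  let ?r = "norm \<xi>"
  consider "?r < 1 / 2" | "?r > 1 / 2" | "?r = 1 / 2" by linarith
  then show ?thesis
  proof cases
    case 1
    then have "?r\<^sup>2 < (1 / 2)\<^sup>2" by (intro power_strict_mono) auto
    then have "1 / 4 - ?r\<^sup>2 > 0" by (simp add: power2_eq_square)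
    then have "sqrt (1 / 4 - ?r\<^sup>2) \<noteq> 0" "?r\<^sup>2 - 1 / 4 = - ((sqrt (1 / 4 - ?r\<^sup>2))\<^sup>2)" by auto
    then have "oscillator t (?r\<^sup>2 - 1 / 4) = sinh (t * sqrt (1 / 4 - ?r\<^sup>2)) / sqrt (1 / 4 - ?r\<^sup>2)"
      using oscillator_minus_square by metis
    then show ?thesis using 1 by (simp add: K_hat_def)
  next
    case 2
    then have "(1 / 2)\<^sup>2 < ?r\<^sup>2" by (intro power_strict_mono) auto
    then have "?r\<^sup>2 - 1 / 4 > 0" by (simp add: power2_eq_square)
    then have "sqrt (?r\<^sup>2 - 1 / 4) \<noteq> 0" "?r\<^sup>2 - 1 / 4 = (sqrt (?r\<^sup>2 - 1 / 4))\<^sup>2" by auto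
    then have "oscillator t (?r\<^sup>2 - 1 / 4) = sin (t * sqrt (?r\<^sup>2 - 1 / 4)) / sqrt (?r\<^sup>2 - 1 / 4)"
      using oscillator_square by metis
    then show ?thesis using 2 by (simp add: K_hat_def)
  next
    case 3
    then have "(norm \<xi>)\<^sup>2 - 1 / 4 = 0" by (simp only:) (simp add: power2_eq_square)
    then have e: "oscillator t ((norm \<xi>)\<^sup>2 - 1 / 4) = t" by (simp only: oscillator_0)
    show ?thesis unfolding K_hat_def e unfolding 3 by simp
  qed
qed

lemma sinh_le_mult_cosh: "x \<ge> 0 \<Longrightarrow> sinh x \<le> x * cosh (x::real)"
proof -
  assume x: "x \<ge> 0"
  have "0 * cosh 0 - sinh 0 \<le> x * cosh x - sinh x"
  proof (rule DERIV_nonneg_imp_nondecreasing[OF x])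
    fix y :: real assume "0 \<le> y"
    then show "\<exists>D. ((\<lambda>y. y * cosh y - sinh y) has_real_derivative D) (at y) \<and> 0 \<le> D"
      by (intro exI[of _ "y * sinh y"]) (auto intro!: derivative_eq_intros simp: sinh_real_nonneg_iff)
  qed
  then show ?thesis by simp
qed

text \<open>For z >= 0 this is |sin x| <= |x|; for z < 0 it is sinh x <= x cosh x <= x exp x with x
  = t sqrt (- z), which is at most t b.\<close>

lemma oscillator_bound:
  assumes t: "t \<ge> 0" and b: "b \<ge> 0" and z: "z \<ge> - (b\<^sup>2)"
  shows "\<bar>oscillator t z\<bar> \<le> t * exp (t * b)"
proof (cases "z \<ge> 0")
  case True
  have "\<bar>oscillator t z\<bar> \<le> t * 1"
    using oscillator_wave_symbol[of t "sqrt z"] abs_wave_symbol_le[OF t, of "sqrt z"] True by simp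
  also have "\<dots> \<le> t * exp (t * b)" using t b by (intro mult_left_mono) auto
  finally show ?thesis .
next
  case False
  define w where "w = sqrt (- z)"
  have w: "w > 0" "z = - (w\<^sup>2)" using False by (auto simp: w_def)
  have wb: "w \<le> b" using z b unfolding w_def by (intro real_le_lsqrt) auto
  have "oscillator t z = sinh (t * w) / w" unfolding w(2) using w(1) by (intro oscillator_minus_square) simp
  then have "\<bar>oscillator t z\<bar> = sinh (t * w) / w" using w t by (simp add: sinh_real_nonneg_iff)
  also have "\<dots> \<le> ((t * w) * cosh (t * w)) / w" using w t by (intro divide_right_mono sinh_le_mult_cosh) auto
  also have "\<dots> = t * cosh (t * w)" using w by simp
  also have "\<dots> \<le> t * exp (t * b)"
  proof (intro mult_left_mono t)
    have "exp (- (t * w)) \<le> exp (t * w)" using t w by simp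
    then have "cosh (t * w) \<le> exp (t * w)" by (simp add: cosh_def)
    also have "\<dots> \<le> exp (t * b)" using t wb by (simp add: mult_left_mono)
    finally show "cosh (t * w) \<le> exp (t * b)" .
  qed
  finally show ?thesis .
qed

lemma oscillator_deriv: "((\<lambda>t. oscillator t z) has_real_derivative cos_sqrt (t\<^sup>2 * z)) (at t)"
proof -
  consider "z = 0" | "z > 0" | "z < 0" by linarith
  then show ?thesis
  proof cases
    case 1
    then show ?thesis by simp
  next
    case 2
    define w where "w = sqrt z"
    have w: "w > 0" "z = w\<^sup>2" using 2 by (auto simp: w_def)
    have "((\<lambda>t. sin (t * w) / w) has_real_derivative cos (t * w)) (at t)"
      using w by (auto intro!: derivative_eq_intros)
    then show ?thesis using w cos_sqrt_square[of "t * w"] by (simp add: oscillator_square power_mult_distrib)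
  next
    case 3
    define w where "w = sqrt (- z)"
    have w: "w > 0" "z = - (w\<^sup>2)" using 3 by (auto simp: w_def)
    have "((\<lambda>t. sinh (t * w) / w) has_real_derivative cosh (t * w)) (at t)"
      using w by (auto intro!: derivative_eq_intros)
    then show ?thesis using w cos_sqrt_minus_square[of "t * w"]
      by (simp add: oscillator_minus_square power_mult_distrib)
  qed
qed

section \<open>Volterra equation in time and mass\<close>

text \<open>The time derivative of \<open>oscillator s (z - b)\<close> is
  \<open>cos_sqrt (s\<^sup>2 * (z - b))\<close>, and the derivative of that in b is s / 2 times the
  oscillator. Integrating back over the rectangle produces no further terms because the oscillator
  vanishes at s = 0.\<close>

lemma oscillator_volterra:
  assumes t: "t \<ge> 0" and a: "a \<ge> 0"
  shows "oscillator t (z - a) - oscillator t z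
    = (\<integral>x. indicator ({0..t} \<times> {0..a}) x * (fst x / 2 * oscillator (fst x) (z - snd x)) \<partial>lborel)"
proof -
  have inner: "(\<integral>b. indicator {0..a} b * (s / 2 * oscillator s (z - b)) \<partial>lborel) = cos_sqrt (s\<^sup>2 * (z - a)) - cos_sqrt (s\<^sup>2 * z)" for s
  proof -
    have "((\<lambda>b. cos_sqrt (s\<^sup>2 * (z - b))) has_real_derivative s / 2 * oscillator s (z - b)) (at b)" for b
    proof -
      have "((\<lambda>b. s\<^sup>2 * (z - b)) has_real_derivative - (s\<^sup>2)) (at b)"
        by (auto intro!: derivative_eq_intros)
      from DERIV_chain2[OF cos_sqrt_deriv this] show ?thesis
        by (simp add: oscillator_def power2_eq_square mult_ac)
    qed
    then have "(\<integral>b. indicator {0..a} b *\<^sub>R (s / 2 * oscillator s (z - b)) \<partial>lborel) = cos_sqrt (s\<^sup>2 * (z - a)) - cos_sqrt (s\<^sup>2 * (z - 0))"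
      using a unfolding oscillator_def
      by (intro integral_FTC_Icc)
        (auto simp flip: has_real_derivative_iff_has_vector_derivative
          intro: has_field_derivative_at_within intro!: continuous_intros)
    then show ?thesis by simp
  qed
  have "((\<lambda>t. oscillator t (z - a) - oscillator t z) has_real_derivative cos_sqrt (s\<^sup>2 * (z - a)) - cos_sqrt (s\<^sup>2 * z)) (at s)" for s
    by (intro DERIV_diff oscillator_deriv)
  then have "(\<integral>s. indicator {0..t} s *\<^sub>R (cos_sqrt (s\<^sup>2 * (z - a)) - cos_sqrt (s\<^sup>2 * z)) \<partial>lborel)
      = (oscillator t (z - a) - oscillator t z) - (oscillator 0 (z - a) - oscillator 0 z)"
    using t by (intro integral_FTC_Icc)
      (auto simp flip: has_real_derivative_iff_has_vector_derivative
        intro: has_field_derivative_at_within intro!: continuous_intros)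
  then have "oscillator t (z - a) - oscillator t z
      = (\<integral>s. indicator {0..t} s * (\<integral>b. indicator {0..a} b * (s / 2 * oscillator s (z - b)) \<partial>lborel) \<partial>lborel)"
    unfolding inner by (simp add: oscillator_def)
  also have "\<dots> = (\<integral>s. (\<integral>b. indicator ({0..t} \<times> {0..a}) (s, b) * (s / 2 * oscillator s (z - b)) \<partial>lborel) \<partial>lborel)"
    by (simp add: indicator_times mult.assoc flip: integral_mult_right_zero)
  also have "\<dots> = (\<integral>x. (case x of (s, b) \<Rightarrow> indicator ({0..t} \<times> {0..a}) (s, b) * (s / 2 * oscillator s (z - b))) \<partial>(lborel \<Otimes>\<^sub>M lborel))"
  proof (rule lborel_pair.integral_fst)
    have "integrable lborel (\<lambda>x::real\<times>real. indicator ({0..t} \<times> {0..a}) x *\<^sub>R (fst x / 2 * oscillator (fst x) (z - snd x)))"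
      unfolding oscillator_def
      by (intro borel_integrable_compact compact_Times compact_Icc) (auto intro!: continuous_intros)
    then show "integrable (lborel \<Otimes>\<^sub>M lborel) (\<lambda>(s, b). indicator ({0..t} \<times> {0..a}) (s, b) * (s / 2 * oscillator s (z - b)))"
      by (simp add: lborel_prod case_prod_unfold)
  qed
  finally show ?thesis by (simp add: lborel_prod case_prod_unfold)
qed

lemma Re_of_real_mult: "Re (complex_of_real a * w) = a * Re w"
  by simp

lemma sin_sqrt_measurable [measurable]: "sin_sqrt \<in> borel_measurable borel"
  by (intro borel_measurable_continuous_onI continuous_on_sin_sqrt continuous_on_id)

lemma oscillator_bound_quarter:
  assumes "0 \<le> s" "s \<le> t" "b \<le> 1 / 4" "z \<ge> 0"
  shows "\<bar>oscillator s (z - b)\<bar> \<le> t * exp t"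
proof -
  have "\<bar>oscillator s (z - b)\<bar> \<le> s * exp (s * (1 / 2))"
    using assms by (intro oscillator_bound) (auto simp: power2_eq_square)
  also have "\<dots> \<le> t * exp t" using assms by (intro mult_mono) auto
  finally show ?thesis .
qed

text \<open>The factor s / 2 in the scalar identity does not involve the frequency, so Fubini's
  theorem carries the identity over to the pairings.\<close>

lemma oscillator_pairing_volterra:
  fixes H :: "'a::euclidean_space \<Rightarrow> complex"
  defines "J \<equiv> \<lambda>b s. Re (\<integral>\<xi>. of_real (oscillator s ((norm \<xi>)\<^sup>2 - b)) * H \<xi> \<partial>lborel)"
  assumes H: "integrable lborel H" and s: "0 \<le> s" and b: "0 \<le> b" "b \<le> 1 / 4"
  shows "integrable lborel (\<lambda>x. indicator ({0..s} \<times> {0..b}) x * (fst x / 2 * J (snd x) (fst x)))"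
    and "J b s = J 0 s + (\<integral>x. indicator ({0..s} \<times> {0..b}) x * (fst x / 2 * J (snd x) (fst x)) \<partial>lborel)"
proof -
  let ?Q = "{0..s} \<times> {0..b} :: (real \<times> real) set"
  have [measurable]: "(fst :: real \<times> real \<Rightarrow> real) \<in> borel_measurable borel"
      "(snd :: real \<times> real \<Rightarrow> real) \<in> borel_measurable borel"
    by (intro borel_measurable_continuous_onI continuous_intros)+
  have cQ: "compact ?Q" by (intro compact_Times compact_Icc)
  then have [measurable]: "?Q \<in> sets borel" by (intro borel_compact)
  have [measurable]: "H \<in> borel_measurable borel" using borel_measurable_integrable[OF H] by simp
  define k where "k x \<xi> = indicator ?Q x * (fst x / 2 * oscillator (fst x) ((norm \<xi>)\<^sup>2 - snd x))"
    for x :: "real \<times> real" and \<xi> :: 'a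
  have km [measurable]: "(\<lambda>z. k (fst z) (snd z)) \<in> borel_measurable (borel \<Otimes>\<^sub>M borel)"
    unfolding k_def oscillator_def by measurable
  have kb: "\<bar>k x \<xi>\<bar> \<le> s * (s * exp s)" for x \<xi>
  proof (cases "x \<in> ?Q")
    case True
    then have x: "0 \<le> fst x" "fst x \<le> s" "snd x \<le> 1 / 4" using b by auto
    have "\<bar>k x \<xi>\<bar> = fst x / 2 * \<bar>oscillator (fst x) ((norm \<xi>)\<^sup>2 - snd x)\<bar>"
      using True x by (simp add: k_def abs_mult)
    also have "\<dots> \<le> s * (s * exp s)"
      using x by (intro mult_mono oscillator_bound_quarter) auto
    finally show ?thesis .
  next
    case False
    then show ?thesis using s by (simp add: k_def)
  qed
  have iQ: "integrable lborel (\<lambda>x. complex_of_real (indicator ?Q x))"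
    using emeasure_compact_finite[OF cQ] by (intro integrable_of_real) (simp add: integrable_indicator_iff)
  have "integrable (lborel \<Otimes>\<^sub>M lborel) (\<lambda>z. of_real (k (fst z) (snd z)) * (case z of (x, \<xi>) \<Rightarrow> complex_of_real (indicator ?Q x) * H \<xi>))"
    by (intro integrable_bounded_mult[where C="s * (s * exp s)"] integrable_pair_mult iQ H) (use kb in auto)
  moreover have "of_real (k (fst z) (snd z)) * (case z of (x, \<xi>) \<Rightarrow> complex_of_real (indicator ?Q x) * H \<xi>)
      = (case z of (x, \<xi>) \<Rightarrow> of_real (k x \<xi>) * H \<xi>)" for z
    by (auto simp: k_def indicator_def split: prod.split)
  ultimately have i: "integrable (lborel \<Otimes>\<^sub>M lborel) (\<lambda>(x, \<xi>). of_real (k x \<xi>) * H \<xi>)" by simp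
  have e: "Re (\<integral>\<xi>. of_real (k x \<xi>) * H \<xi> \<partial>lborel) = indicator ?Q x * (fst x / 2 * J (snd x) (fst x))" for x
  proof -
    have "(\<integral>\<xi>. of_real (k x \<xi>) * H \<xi> \<partial>lborel)
        = (\<integral>\<xi>. of_real (indicator ?Q x * (fst x / 2)) * (of_real (oscillator (fst x) ((norm \<xi>)\<^sup>2 - snd x)) * H \<xi>) \<partial>lborel)"
      by (simp add: k_def mult.assoc)
    also have "\<dots> = of_real (indicator ?Q x * (fst x / 2)) * (\<integral>\<xi>. of_real (oscillator (fst x) ((norm \<xi>)\<^sup>2 - snd x)) * H \<xi> \<partial>lborel)"
      by (rule integral_mult_right_zero)
    finally show ?thesis by (simp only: Re_of_real_mult J_def mult.assoc)
  qed
  show "integrable lborel (\<lambda>x. indicator ?Q x * (fst x / 2 * J (snd x) (fst x)))"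
    using integrable_Re[OF lborel_pair.integrable_fst[OF i]] unfolding e .
  have io: "integrable lborel (\<lambda>\<xi>. of_real (oscillator s ((norm \<xi>)\<^sup>2 - c)) * H \<xi>)" if "c \<le> 1 / 4" for c
  proof (rule integrable_bounded_mult[OF H])
    show "(\<lambda>\<xi>. oscillator s ((norm \<xi>)\<^sup>2 - c)) \<in> borel_measurable lborel"
      unfolding oscillator_def by measurable
    show "\<bar>oscillator s ((norm \<xi>)\<^sup>2 - c)\<bar> \<le> s * exp s" for \<xi> :: 'a
      using s that by (intro oscillator_bound_quarter) auto
  qed
  have i0: "integrable lborel (\<lambda>\<xi>. of_real (oscillator s ((norm \<xi>)\<^sup>2)) * H \<xi>)" using io[of 0] by simp
  have "(\<integral>x. of_real (k x \<xi>) * H \<xi> \<partial>lborel)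
      = of_real (oscillator s ((norm \<xi>)\<^sup>2 - b)) * H \<xi> - of_real (oscillator s ((norm \<xi>)\<^sup>2)) * H \<xi>" for \<xi>
  proof -
    have "(\<integral>x. of_real (k x \<xi>) * H \<xi> \<partial>lborel) = of_real (\<integral>x. k x \<xi> \<partial>lborel) * H \<xi>"
      by simp
    also have "(\<integral>x. k x \<xi> \<partial>lborel) = oscillator s ((norm \<xi>)\<^sup>2 - b) - oscillator s ((norm \<xi>)\<^sup>2)"
      unfolding k_def using oscillator_volterra[OF s b(1), of "(norm \<xi>)\<^sup>2"] by simp
    finally show ?thesis by (simp add: left_diff_distrib)
  qed
  then have "(\<integral>\<xi>. (\<integral>x. of_real (k x \<xi>) * H \<xi> \<partial>lborel) \<partial>lborel)
      = (\<integral>\<xi>. of_real (oscillator s ((norm \<xi>)\<^sup>2 - b)) * H \<xi> \<partial>lborel) - (\<integral>\<xi>. of_real (oscillator s ((norm \<xi>)\<^sup>2)) * H \<xi> \<partial>lborel)"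
    using io[OF b(2)] i0 by simp
  then have "Re (\<integral>\<xi>. (\<integral>x. of_real (k x \<xi>) * H \<xi> \<partial>lborel) \<partial>lborel) = J b s - J 0 s"
    by (simp add: J_def)
  moreover have "Re (\<integral>\<xi>. (\<integral>x. of_real (k x \<xi>) * H \<xi> \<partial>lborel) \<partial>lborel)
      = (\<integral>x. indicator ?Q x * (fst x / 2 * J (snd x) (fst x)) \<partial>lborel)"
    unfolding lborel_pair.Fubini_integral[OF i] integral_Re[OF lborel_pair.integrable_fst[OF i], symmetric] e ..
  ultimately show "J b s = J 0 s + (\<integral>x. indicator ?Q x * (fst x / 2 * J (snd x) (fst x)) \<partial>lborel)"
    by simp
qed

text \<open>The exponential is the weight in which the Volterra operator becomes a contraction in
  \<open>oscillator_pairing_mono\<close>, where l is the final time.\<close>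

lemma integral_exp_rectangle:
  assumes s: "s \<ge> 0" and b: "b \<ge> 0" and l: "l > 0"
  shows "integrable lborel (\<lambda>x::real\<times>real. indicator ({0..s} \<times> {0..b}) x * exp (l * fst x))"
    and "(\<integral>x. indicator ({0..s} \<times> {0..b}) x * exp (l * fst x) \<partial>lborel) = b * ((exp (l * s) - 1) / l)"
proof -
  have i: "integrable lborel (\<lambda>x::real\<times>real. indicator ({0..s} \<times> {0..b}) x *\<^sub>R exp (l * fst x))"
    by (intro borel_integrable_compact compact_Times compact_Icc) (auto intro!: continuous_intros)
  then show "integrable lborel (\<lambda>x::real\<times>real. indicator ({0..s} \<times> {0..b}) x * exp (l * fst x))" by simp
  have "((\<lambda>y. exp (l * y) / l) has_real_derivative exp (l * y)) (at y)" for y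
    using l by (auto intro!: derivative_eq_intros)
  then have F: "(\<integral>y. indicator {0..s} y *\<^sub>R exp (l * y) \<partial>lborel) = exp (l * s) / l - exp (l * 0) / l"
    using s by (intro integral_FTC_Icc)
      (auto simp flip: has_real_derivative_iff_has_vector_derivative
        intro: has_field_derivative_at_within intro!: continuous_intros)
  have "(\<integral>x. indicator ({0..s} \<times> {0..b}) x * exp (l * fst x) \<partial>lborel)
      = (\<integral>x. (case x of (y, v) \<Rightarrow> indicator ({0..s} \<times> {0..b}) (y, v) * exp (l * y)) \<partial>(lborel \<Otimes>\<^sub>M (lborel :: real measure)))"
    by (simp add: lborel_prod case_prod_unfold)
  also have "\<dots> = (\<integral>y. (\<integral>v. indicator ({0..s} \<times> {0..b}) (y, v) * exp (l * y) \<partial>lborel) \<partial>lborel)"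
    using i by (intro lborel_pair.integral_fst[symmetric]) (simp add: lborel_prod case_prod_unfold)
  also have "\<dots> = (\<integral>y. b * (indicator {0..s} y *\<^sub>R exp (l * y)) \<partial>lborel)"
  proof (intro Bochner_Integration.integral_cong refl)
    fix y
    have "(\<integral>v. indicator ({0..s} \<times> {0..b}) (y, v) * exp (l * y) \<partial>lborel)
        = (\<integral>v. (indicator {0..s} y * exp (l * y)) * indicator {0..b} v \<partial>lborel)"
      by (simp add: indicator_times mult_ac)
    also have "\<dots> = (indicator {0..s} y * exp (l * y)) * b"
      using b by (subst integral_mult_right_zero) simp
    finally show "(\<integral>v. indicator ({0..s} \<times> {0..b}) (y, v) * exp (l * y) \<partial>lborel) = b * (indicator {0..s} y *\<^sub>R exp (l * y))"
      by simp
  qed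
  also have "\<dots> = b * (exp (l * s) / l - exp (l * 0) / l)"
    unfolding F[symmetric] by (rule integral_mult_right_zero)
  finally show "(\<integral>x. indicator ({0..s} \<times> {0..b}) x * exp (l * fst x) \<partial>lborel) = b * ((exp (l * s) - 1) / l)"
    by (simp add: diff_divide_distrib)
qed

text \<open>The pairing with the symbol \<open>oscillator s (\<bar>\<xi>\<bar>\<^sup>2 - b)\<close> satisfies a linear Volterra equation in
  \<open>(s, b)\<close> with nonnegative kernel, so positivity propagates from \<open>b = 0\<close> (the free wave
  equation) to \<open>b = 1 / 4\<close> (the damped one).\<close>

lemma oscillator_pairing_mono:
  fixes H :: "'a::euclidean_space \<Rightarrow> complex"
  defines "J \<equiv> \<lambda>b s. Re (\<integral>\<xi>. of_real (oscillator s ((norm \<xi>)\<^sup>2 - b)) * H \<xi> \<partial>lborel)"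
  assumes H: "integrable lborel H" and J0: "\<And>s. s \<ge> 0 \<Longrightarrow> J 0 s \<ge> 0" and t: "t \<ge> 0"
  shows "J 0 t \<le> J (1 / 4) t"
proof (cases "t = 0")
  case True
  then show ?thesis by (simp add: J_def oscillator_def)
next
  case False
  with t have t: "t > 0" by simp
  have volterra: "integrable lborel (\<lambda>x. indicator ({0..s} \<times> {0..b}) x * (fst x / 2 * J (snd x) (fst x)))"
      "J b s = J 0 s + (\<integral>x. indicator ({0..s} \<times> {0..b}) x * (fst x / 2 * J (snd x) (fst x)) \<partial>lborel)"
    if "0 \<le> s" "0 \<le> b" "b \<le> 1 / 4" for s b
    unfolding J_def by (rule oscillator_pairing_volterra[OF H that])+
  \<comment> \<open>A crude bound to start the iteration: the symbol is at most t exp t in modulus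
    up to time t.\<close>
  define C where "C = t * exp t * (\<integral>\<xi>. norm (H \<xi>) \<partial>lborel)"
  have C: "C \<ge> 0" using t by (simp add: C_def)
  have [measurable]: "H \<in> borel_measurable borel" using borel_measurable_integrable[OF H] by simp
  have JC: "J b s \<ge> - C" if "0 \<le> s" "s \<le> t" "b \<le> 1 / 4" for b s
  proof -
    have "\<bar>J b s\<bar> \<le> norm (\<integral>\<xi>. of_real (oscillator s ((norm \<xi>)\<^sup>2 - b)) * H \<xi> \<partial>lborel)"
      unfolding J_def by (rule abs_Re_le_cmod)
    also have "\<dots> \<le> (\<integral>\<xi>. t * exp t * norm (H \<xi>) \<partial>lborel)"
    proof (rule Bochner_Integration.integral_norm_bound_integral)
      have *: "\<bar>oscillator s ((norm \<xi>)\<^sup>2 - b)\<bar> \<le> t * exp t" for \<xi> :: 'a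
        using that by (intro oscillator_bound_quarter) auto
      show "integrable lborel (\<lambda>\<xi>. of_real (oscillator s ((norm \<xi>)\<^sup>2 - b)) * H \<xi>)"
        by (rule integrable_bounded_mult[OF H _ *]) (unfold oscillator_def, measurable)
      show "norm (of_real (oscillator s ((norm \<xi>)\<^sup>2 - b)) * H \<xi>) \<le> t * exp t * norm (H \<xi>)" for \<xi>
        unfolding norm_mult norm_of_real by (intro mult_right_mono *) simp
    qed (use H in simp)
    also have "\<dots> = C" by (simp add: C_def)
    finally show ?thesis by simp
  qed
  \<comment> \<open>Contraction in a weighted norm: against exp (t s) the kernel bound t / 2
    integrates to b (exp (t s) - 1) / 2, so each use of the Volterra equation halves the possible
    negative part, while \<open>J 0 s\<close> only helps.\<close>
  have iter: "J b s \<ge> - (C * (1 / 2) ^ k * exp (t * s))" if "0 \<le> s" "s \<le> t" "0 \<le> b" "b \<le> 1 / 4" for b s k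
    using that
  proof (induction k arbitrary: b s)
    case 0
    have "C * 1 \<le> C * exp (t * s)" using C t 0 by (intro mult_left_mono) auto
    then show ?case using JC[of s b] 0 by simp
  next
    case (Suc k)
    let ?Q = "{0..s} \<times> {0..b}"
    have "(\<integral>x. - (C * (1 / 2) ^ k * (t / 2)) * (indicator ?Q x * exp (t * fst x)) \<partial>lborel)
        \<le> (\<integral>x. indicator ?Q x * (fst x / 2 * J (snd x) (fst x)) \<partial>lborel)"
    proof (rule integral_mono)
      show "integrable lborel (\<lambda>x. - (C * (1 / 2) ^ k * (t / 2)) * (indicator ?Q x * exp (t * fst x)))"
        using Suc.prems t by (intro integrable_mult_right integral_exp_rectangle) auto
      show "integrable lborel (\<lambda>x. indicator ?Q x * (fst x / 2 * J (snd x) (fst x)))"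
        by (rule volterra(1)) (use Suc.prems in auto)
      fix x :: "real \<times> real"
      show "- (C * (1 / 2) ^ k * (t / 2)) * (indicator ?Q x * exp (t * fst x)) \<le> indicator ?Q x * (fst x / 2 * J (snd x) (fst x))"
      proof (cases "x \<in> ?Q")
        case True
        then have x: "0 \<le> fst x" "fst x \<le> t" "0 \<le> snd x" "snd x \<le> 1 / 4" using Suc.prems by auto
        let ?E = "C * (1 / 2) ^ k * exp (t * fst x)"
        have "fst x / 2 * ?E \<le> t / 2 * ?E" using x C by (intro mult_right_mono) auto
        then have "- (t / 2 * ?E) \<le> fst x / 2 * (- ?E)" by simp
        also have "\<dots> \<le> fst x / 2 * J (snd x) (fst x)"
          using Suc.IH[of "fst x" "snd x"] x by (intro mult_left_mono) auto
        finally show ?thesis using True by (simp add: mult_ac)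
      qed simp
    qed
    moreover have "(\<integral>x. - (C * (1 / 2) ^ k * (t / 2)) * (indicator ?Q x * exp (t * fst x)) \<partial>lborel)
        = - ((C * (1 / 2) ^ k * (t / 2)) * (b * ((exp (t * s) - 1) / t)))"
      unfolding mult_minus_left[symmetric] using integral_exp_rectangle(2)[of s b t] Suc.prems t by (subst integral_mult_right_zero) simp
    moreover have "(C * (1 / 2) ^ k * (t / 2)) * (b * ((exp (t * s) - 1) / t)) \<le> C * (1 / 2) ^ Suc k * exp (t * s)"
    proof -
      have "(C * (1 / 2) ^ k * (t / 2)) * (b * ((exp (t * s) - 1) / t)) = (C * (1 / 2) ^ Suc k) * (b * (exp (t * s) - 1))"
        using t by (simp add: field_simps)
      also have "b * (exp (t * s) - 1) \<le> 1 * exp (t * s)"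
        using Suc.prems t by (intro mult_mono) auto
      finally show ?thesis using C by (simp add: mult_left_mono)
    qed
    moreover have "J 0 s \<ge> 0" using J0 Suc.prems by simp
    ultimately show ?case using volterra(2)[OF Suc.prems(1,3,4)] by linarith
  qed
  have nonneg: "J b s \<ge> 0" if "0 \<le> s" "s \<le> t" "0 \<le> b" "b \<le> 1 / 4" for b s
  proof (rule LIMSEQ_le_const2)
    show "(\<lambda>k. - (C * (1 / 2) ^ k * exp (t * s))) \<longlonglongrightarrow> 0"
      by (rule tendsto_eq_intros LIMSEQ_power_zero refl | simp)+
    show "\<exists>N. \<forall>k\<ge>N. - (C * (1 / 2) ^ k * exp (t * s)) \<le> J b s" using iter that by blast
  qed
  \<comment> \<open>With all \<open>J b s\<close> nonnegative, the Volterra integral is exactly the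
    surplus of the damped pairing over the free one.\<close>
  have "(\<integral>x. indicator ({0..t} \<times> {0..1 / 4}) x * (fst x / 2 * J (snd x) (fst x)) \<partial>lborel) \<ge> 0"
    by (intro Bochner_Integration.integral_nonneg) (auto simp: indicator_def intro!: mult_nonneg_nonneg nonneg)
  then show ?thesis using volterra(2)[of t "1 / 4"] t by simp
qed

lemma K_hat_measurable [measurable]: "K_hat t \<in> borel_measurable borel"
proof -
  have "(\<lambda>\<xi>. K_hat t \<xi>) \<in> borel_measurable borel"
    unfolding K_hat_oscillator oscillator_def by measurable
  then show ?thesis by simp
qed

text \<open>Finite speed of propagation appears in the restriction of M to shifts of length at most
  r: the bound comes from the free wave alone, and the mass term adds a nonnegative amount.\<close>

lemma K_pairing_lower_bound:
  fixes f \<phi> :: "'a::euclidean_space \<Rightarrow> real"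
  assumes dim: "DIM('a) \<le> 3" and fg: "fourier_pair f g" and f: "AE x in lborel. f x \<ge> 0"
    and \<phi>: "integrable lborel \<phi>" "square_integrable \<phi>" "\<And>x. \<phi> x \<ge> 0"
    and t: "0 \<le> t" "t < r" and M: "\<And>y. norm y \<le> r \<Longrightarrow> M \<le> (\<integral>x. f x * \<phi> (x + y) \<partial>lborel)"
  shows "(2 * pi) ^ DIM('a) * (exp (- t / 2) * t * M)
    \<le> Re (\<integral>\<xi>. of_real (K_hat t \<xi>) * (g \<xi> * cnj (fourier_integral \<phi> \<xi>)) \<partial>lborel)"
proof -
  define H where "H \<xi> = g \<xi> * cnj (fourier_integral \<phi> \<xi>)" for \<xi>
  have H: "integrable lborel H"
    unfolding H_def using fg plancherel(1)[OF \<phi>(1,2)]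
    by (intro square_integrable_mult_cnj) (auto simp: fourier_pair_def)
  have pos: "0 \<le> (\<integral>x. f x * \<phi> (x + y) \<partial>lborel)" for y
    using f \<phi>(3) by (intro integral_nonneg_AE) (auto elim!: eventually_mono)
  \<comment> \<open>The comparison in the mass needs positivity of the free wave at all times, not
    only at t; it is the case M = 0, where no restriction on the shifts is required.\<close>
  have W: "0 \<le> Re (\<integral>\<xi>. of_real (oscillator s ((norm \<xi>)\<^sup>2 - 0)) * H \<xi> \<partial>lborel)" if "s \<ge> 0" for s
    using wave_pairing_lower_bound[OF dim fg \<phi>(1,2) that, of "s + 1" 0] pos
    by (simp add: oscillator_wave_symbol H_def)
  have "(2 * pi) ^ DIM('a) * (exp (- t / 2) * t * M) = exp (- t / 2) * ((2 * pi) ^ DIM('a) * (t * M))"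
    by (simp only: mult_ac)
  also have "\<dots> \<le> exp (- t / 2) * Re (\<integral>\<xi>. of_real (wave_symbol t (norm \<xi>)) * H \<xi> \<partial>lborel)"
    unfolding H_def by (intro mult_left_mono wave_pairing_lower_bound[OF dim fg \<phi>(1,2) t M]) auto
  also have "\<dots> \<le> exp (- t / 2) * Re (\<integral>\<xi>. of_real (oscillator t ((norm \<xi>)\<^sup>2 - 1 / 4)) * H \<xi> \<partial>lborel)"
    using oscillator_pairing_mono[OF H W t(1)] by (intro mult_left_mono) (auto simp: oscillator_wave_symbol)
  also have "\<dots> = Re (of_real (exp (- t / 2)) * (\<integral>\<xi>. of_real (oscillator t ((norm \<xi>)\<^sup>2 - 1 / 4)) * H \<xi> \<partial>lborel))"
    by (rule Re_of_real_mult[symmetric])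
  also have "\<dots> = Re (\<integral>\<xi>. of_real (K_hat t \<xi>) * H \<xi> \<partial>lborel)"
    unfolding integral_mult_right_zero[symmetric] K_hat_oscillator by (simp add: mult.assoc)
  finally show ?thesis unfolding H_def .
qed

section \<open>Low and high frequencies of the damped symbol\<close>

text \<open>There are two decay rates, d = 1 / 2 - \<rho> and 1 / 2 + \<rho>, with product
  |\<xi>|^2. The slow one differs from |\<xi>|^2 by d^2, and its amplitude 1 / (2 \<rho>) differs
  from 1 by d / \<rho>; both are small at low frequency. The fast one accounts for the term with exp
  (- t / 2).\<close>

lemma K_hat_heat_low:
  fixes \<xi> :: "'a::euclidean_space"
  assumes t: "t \<ge> 1" and r: "norm \<xi> \<le> 1 / 4"
  shows "\<bar>K_hat t \<xi> - exp (- t * (norm \<xi>)\<^sup>2)\<bar> \<le> 16 / t * exp (- t * (norm \<xi>)\<^sup>2 / 2) + 5 / 4 * exp (- t / 2)"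
proof -
  define r2 where "r2 = (norm \<xi>)\<^sup>2"
  have "r2 \<le> (1 / 4)\<^sup>2" unfolding r2_def using r by (intro power_mono) auto
  then have r2: "0 \<le> r2" "r2 \<le> 1 / 16" by (auto simp: r2_def power2_eq_square)
  define \<rho> where "\<rho> = sqrt (1 / 4 - r2)"
  have \<rho>2: "\<rho>\<^sup>2 = 1 / 4 - r2" using r2 by (simp add: \<rho>_def)
  \<comment> \<open>Since r2 <= 1 / 16, the square of \<rho> is at least 3 / 16, which exceeds (2 /
    5)^2.\<close>
  have \<rho>: "2 / 5 \<le> \<rho>" "\<rho> \<le> 1 / 2"
  proof -
    show "2 / 5 \<le> \<rho>"
      unfolding \<rho>_def by (rule real_le_rsqrt) (use r2 in \<open>simp_all add: power2_eq_square\<close>)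
    show "\<rho> \<le> 1 / 2"
      unfolding \<rho>_def by (rule real_le_lsqrt) (use r2 in \<open>simp_all add: power2_eq_square\<close>)
  qed
  define d where "d = 1 / 2 - \<rho>"
  have d0: "d \<ge> 0" using \<rho> by (simp add: d_def)
  have dr: "d * (1 / 2 + \<rho>) = r2" using \<rho>2 by (simp add: d_def power2_eq_square algebra_simps)
  have dge: "r2 \<le> d" using dr mult_left_mono[of "1 / 2 + \<rho>" 1 d] d0 \<rho> by simp
  have dle: "9 / 10 * d \<le> r2" using dr mult_left_mono[of "9 / 10" "1 / 2 + \<rho>" d] d0 \<rho> by simp
  \<comment> \<open>The two rates have sum 1 and product r2, that is, d (1 - d) = r2.\<close>
  have "d - r2 = d * d" using dr by (simp add: d_def algebra_simps)
  also have "\<dots> \<le> (10 / 9 * r2) * (10 / 9 * r2)" using dle d0 by (intro mult_mono) auto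
  also have "\<dots> = 100 / 81 * (r2 * r2)" by simp
  also have "\<dots> \<le> 2 * (r2 * r2)" by (intro mult_right_mono) auto
  finally have dd: "d - r2 \<le> 2 * r2\<^sup>2" by (simp add: power2_eq_square)
  have K: "K_hat t \<xi> = (exp (- t * d) - exp (- t * (1 / 2 + \<rho>))) / (2 * \<rho>)"
  proof -
    have "K_hat t \<xi> = exp (- t / 2) * (exp (t * \<rho>) - exp (- (t * \<rho>))) / (2 * \<rho>)"
      using r by (simp add: K_hat_def sinh_def \<rho>_def r2_def)
    also have "exp (- t / 2) * (exp (t * \<rho>) - exp (- (t * \<rho>))) = exp (- t * d) - exp (- t * (1 / 2 + \<rho>))"
      by (simp add: right_diff_distrib d_def algebra_simps flip: exp_add)
    finally show ?thesis .
  qed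
  have 1: "\<bar>exp (- t * d) / (2 * \<rho>) - exp (- t * d)\<bar> \<le> 3 * r2 * exp (- t * r2)"
  proof -
    have "d / \<rho> \<le> 3 * r2"
    proof -
      have "d \<le> 3 * r2 * (2 / 5)" using dle d0 r2 by simp
      also have "\<dots> \<le> 3 * r2 * \<rho>" using \<rho> r2 by (intro mult_left_mono) auto
      finally show ?thesis using \<rho> by (simp add: divide_le_eq)
    qed
    moreover have "exp (- t * d) \<le> exp (- t * r2)" using dge t by simp
    moreover have d\<rho>: "d / \<rho> \<ge> 0" using d0 \<rho> by simp
    ultimately have "(d / \<rho>) * exp (- t * d) \<le> 3 * r2 * exp (- t * r2)"
      using r2 by (intro mult_mono) auto
    moreover have "exp (- t * d) / (2 * \<rho>) - exp (- t * d) = (d / \<rho>) * exp (- t * d)"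
      using \<rho> by (simp add: d_def field_simps)
    moreover have "\<bar>(d / \<rho>) * exp (- t * d)\<bar> = (d / \<rho>) * exp (- t * d)"
      by (intro abs_of_nonneg mult_nonneg_nonneg d\<rho>) simp
    ultimately show ?thesis by (simp only:)
  qed
  have 2: "\<bar>exp (- t * d) - exp (- t * r2)\<bar> \<le> 2 * t * r2\<^sup>2 * exp (- t * r2)"
  proof -
    have "exp (- t * d) = exp (- t * r2) * exp (- (t * (d - r2)))"
      by (simp add: algebra_simps flip: exp_add)
    then have "exp (- t * r2) - exp (- t * d) = exp (- t * r2) * (1 - exp (- (t * (d - r2))))"
      by (simp add: right_diff_distrib)
    also have "\<dots> \<le> exp (- t * r2) * (t * (2 * r2\<^sup>2))"
    proof (intro mult_left_mono)
      have "1 - exp (- (t * (d - r2))) \<le> t * (d - r2)"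
        using exp_ge_add_one_self[of "- (t * (d - r2))"] by simp
      also have "\<dots> \<le> t * (2 * r2\<^sup>2)" using dd t by (intro mult_left_mono) auto
      finally show "1 - exp (- (t * (d - r2))) \<le> t * (2 * r2\<^sup>2)" .
    qed simp
    moreover have "exp (- t * d) \<le> exp (- t * r2)" using dge t by simp
    ultimately show ?thesis by (simp add: mult_ac)
  qed
  have 3: "exp (- t * (1 / 2 + \<rho>)) / (2 * \<rho>) \<le> 5 / 4 * exp (- t / 2)"
  proof -
    have "exp (- t * (1 / 2 + \<rho>)) \<le> exp (- t / 2)" using t \<rho> by (simp add: algebra_simps)
    then have "exp (- t * (1 / 2 + \<rho>)) / (2 * \<rho>) \<le> exp (- t / 2) / (4 / 5)"
      using \<rho> by (intro frac_le) auto
    then show ?thesis by simp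
  qed
  \<comment> \<open>Powers of y = t r2 are absorbed by half of exp (- y), and the gain 1 / t
    remains.\<close>
  have 4: "3 * r2 * exp (- t * r2) + 2 * t * r2\<^sup>2 * exp (- t * r2) \<le> 16 / t * exp (- t * r2 / 2)"
  proof -
    define y where "y = t * r2"
    have y: "y \<ge> 0" using t r2 by (simp add: y_def)
    have "3 * y + 2 * y\<^sup>2 \<le> 16 * (1 + y / 2 + (y / 2)\<^sup>2 / 2)" using y by (simp add: power_divide)
    also have "\<dots> \<le> 16 * exp (y / 2)"
      using exp_lower_Taylor_quadratic[of "y / 2"] y by simp
    finally have "(3 * y + 2 * y\<^sup>2) * exp (- y) \<le> 16 * exp (y / 2) * exp (- y)"
      by (intro mult_right_mono) auto
    also have "\<dots> = 16 * exp (- y / 2)" by (simp add: field_simps flip: exp_add)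
    finally have "(3 * y + 2 * y\<^sup>2) * exp (- y) / t \<le> 16 * exp (- y / 2) / t"
      using t by (intro divide_right_mono) auto
    moreover have "(3 * y + 2 * y\<^sup>2) * exp (- y) / t = 3 * r2 * exp (- t * r2) + 2 * t * r2\<^sup>2 * exp (- t * r2)"
      using t by (simp add: y_def field_simps power2_eq_square)
    ultimately show ?thesis by (simp add: y_def)
  qed
  have "K_hat t \<xi> - exp (- t * r2) = (exp (- t * d) / (2 * \<rho>) - exp (- t * d)) + (exp (- t * d) - exp (- t * r2))
      - exp (- t * (1 / 2 + \<rho>)) / (2 * \<rho>)"
    unfolding K by (simp add: diff_divide_distrib)
  moreover have "exp (- t * (1 / 2 + \<rho>)) / (2 * \<rho>) \<ge> 0" using \<rho> by simp
  ultimately have "\<bar>K_hat t \<xi> - exp (- t * r2)\<bar> \<le> 16 / t * exp (- t * r2 / 2) + 5 / 4 * exp (- t / 2)"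
    using 1 2 3 4 by linarith
  then show ?thesis by (simp only: r2_def)
qed

text \<open>Away from frequency 0 every mode decays exponentially in time; for |\<xi>| > 1 the
  division by the frequency supplies the weight that H1 data can pay for.\<close>

lemma K_hat_high:
  fixes \<xi> :: "'a::euclidean_space"
  assumes t: "t \<ge> 1" and r: "norm \<xi> \<ge> 1 / 4"
  shows "\<bar>K_hat t \<xi>\<bar> \<le> 64 * exp (- t / 64) / sqrt (1 + (norm \<xi>)\<^sup>2)"
proof (cases "norm \<xi> \<le> 1")
  case True
  have r2: "(norm \<xi>)\<^sup>2 \<ge> 1 / 16" using power_mono[OF r, of 2] by (simp add: power2_eq_square)
  \<comment> \<open>The value b = 7 / 16 is admissible because 3 / 16 <= (7 / 16)^2; the rate left
    over is 1 / 2 - 7 / 16 = 1 / 16.\<close>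
  have "\<bar>oscillator t ((norm \<xi>)\<^sup>2 - 1 / 4)\<bar> \<le> t * exp (t * (7 / 16))"
    using t r2 by (intro oscillator_bound) (auto simp: power2_eq_square)
  then have "\<bar>K_hat t \<xi>\<bar> \<le> exp (- t / 2) * (t * exp (t * (7 / 16)))"
    unfolding K_hat_oscillator abs_mult by (intro mult_mono) auto
  also have "\<dots> = t * exp (- t / 16)" by (simp add: mult_ac flip: exp_add)
  \<comment> \<open>A rate 3 / 64 is spent on the factor t, which leaves 1 / 64; the constant 22
    exceeds 64 / 3.\<close>
  also have "t \<le> 22 * exp (3 * t / 64)"
    using exp_ge_add_one_self[of "3 * t / 64"] t by linarith
  then have "t * exp (- t / 16) \<le> 22 * exp (3 * t / 64) * exp (- t / 16)" by (intro mult_right_mono) auto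
  also have "\<dots> = 22 * exp (- t / 64)" by (simp flip: exp_add)
  also have "\<dots> \<le> 64 * exp (- t / 64) / sqrt (1 + (norm \<xi>)\<^sup>2)"
  proof -
    have "(norm \<xi>)\<^sup>2 \<le> 1" using True by (simp add: power_le_one)
    then have "sqrt (1 + (norm \<xi>)\<^sup>2) \<le> 2" by (intro real_le_lsqrt) auto
    moreover have "sqrt (1 + (norm \<xi>)\<^sup>2) > 0" by (simp add: add_pos_nonneg)
    ultimately have "22 * exp (- t / 64) * sqrt (1 + (norm \<xi>)\<^sup>2) \<le> 22 * exp (- t / 64) * 2"
      by (intro mult_left_mono) auto
    also have "\<dots> \<le> 64 * exp (- t / 64)" by simp
    finally show ?thesis using \<open>sqrt (1 + (norm \<xi>)\<^sup>2) > 0\<close> by (simp add: le_divide_eq)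
  qed
  finally show ?thesis .
next
  case False
  define b where "b = sqrt ((norm \<xi>)\<^sup>2 - 1 / 4)"
  have r1: "(norm \<xi>)\<^sup>2 > 1" using False by (simp add: one_less_power)
  have b: "b > 0" unfolding b_def using r1 by simp
  have bb: "sqrt (1 + (norm \<xi>)\<^sup>2) \<le> 2 * b"
    unfolding b_def using r1 by (intro real_le_lsqrt) (auto simp: power_mult_distrib)
  have "\<bar>K_hat t \<xi>\<bar> = exp (- t / 2) * \<bar>sin (t * b)\<bar> / b"
    using False b by (simp add: K_hat_def b_def abs_mult)
  also have "\<dots> \<le> exp (- t / 2) * 1 / b"
    using b by (intro divide_right_mono mult_left_mono) auto
  also have "\<dots> \<le> exp (- t / 64) / b" using b t by (intro divide_right_mono) auto
  also have "\<dots> = 2 * exp (- t / 64) / (2 * b)" using b by simp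
  also have "\<dots> \<le> 2 * exp (- t / 64) / sqrt (1 + (norm \<xi>)\<^sup>2)"
    using b bb by (intro divide_left_mono mult_pos_pos) (auto simp: add_pos_nonneg)
  also have "\<dots> \<le> 64 * exp (- t / 64) / sqrt (1 + (norm \<xi>)\<^sup>2)"
    by (intro divide_right_mono) auto
  finally show ?thesis .
qed

text \<open>Beyond |\<xi>| = 1 / 4 the Gaussian itself is an error term: half of its exponent is at
  least t / 32, and exp (- t / 32) is at most 64 / t.\<close>

lemma K_hat_heat:
  fixes \<xi> :: "'a::euclidean_space"
  assumes t: "t \<ge> 1"
  shows "\<bar>K_hat t \<xi> - exp (- t * (norm \<xi>)\<^sup>2)\<bar>
    \<le> 64 / t * exp (- t * (norm \<xi>)\<^sup>2 / 2) + 64 * exp (- t / 64) / sqrt (1 + (norm \<xi>)\<^sup>2)"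
proof (cases "norm \<xi> \<le> 1 / 4")
  case True
  have s: "sqrt (1 + (norm \<xi>)\<^sup>2) > 0" by (simp add: add_pos_nonneg)
  have "(norm \<xi>)\<^sup>2 \<le> 1" using True by (simp add: power_le_one)
  then have "sqrt (1 + (norm \<xi>)\<^sup>2) \<le> 2" by (intro real_le_lsqrt) auto
  then have "exp (- t / 2) * sqrt (1 + (norm \<xi>)\<^sup>2) \<le> exp (- t / 64) * 2"
    using t s by (intro mult_mono) auto
  then have "5 / 4 * (exp (- t / 2) * sqrt (1 + (norm \<xi>)\<^sup>2)) \<le> 64 * exp (- t / 64)"
    using exp_gt_zero[of "- t / 64"] by linarith
  then have "5 / 4 * exp (- t / 2) \<le> 64 * exp (- t / 64) / sqrt (1 + (norm \<xi>)\<^sup>2)"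
    using s by (simp only: le_divide_eq mult.assoc if_True)
  moreover have "16 / t * exp (- t * (norm \<xi>)\<^sup>2 / 2) \<le> 64 / t * exp (- t * (norm \<xi>)\<^sup>2 / 2)"
    using t by (intro mult_right_mono divide_right_mono) auto
  ultimately show ?thesis using K_hat_heat_low[OF t True] by linarith
next
  case False
  then have r2: "(norm \<xi>)\<^sup>2 \<ge> 1 / 16" using power_mono[of "1 / 4" "norm \<xi>" 2] by (simp add: power2_eq_square)
  have "exp (- t * (norm \<xi>)\<^sup>2) = exp (- t * (norm \<xi>)\<^sup>2 / 2) * exp (- t * (norm \<xi>)\<^sup>2 / 2)"
    by (simp flip: exp_add)
  also have "\<dots> \<le> exp (- t * (norm \<xi>)\<^sup>2 / 2) * (64 / t)"
  proof (intro mult_left_mono)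
    have "t / 32 \<le> t * (norm \<xi>)\<^sup>2 / 2" using mult_left_mono[OF r2, of t] t by simp
    then have "exp (- t * (norm \<xi>)\<^sup>2 / 2) \<le> exp (- (t / 32))" by simp
    also have "\<dots> \<le> 64 / t"
    proof -
      have "t \<le> 64 * exp (t / 32)" using exp_ge_add_one_self[of "t / 32"] t by linarith
      then have "t * exp (- (t / 32)) \<le> 64 * exp (t / 32) * exp (- (t / 32))" by (intro mult_right_mono) auto
      also have "\<dots> = 64" by (simp flip: exp_add)
      finally show ?thesis using t by (simp add: le_divide_eq mult.commute)
    qed
    finally show "exp (- t * (norm \<xi>)\<^sup>2 / 2) \<le> 64 / t" .
  qed simp
  finally have "exp (- t * (norm \<xi>)\<^sup>2) \<le> 64 / t * exp (- t * (norm \<xi>)\<^sup>2 / 2)" by (simp add: mult.commute)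
  moreover have "exp (- t * (norm \<xi>)\<^sup>2) \<ge> 0" by simp
  ultimately show ?thesis using K_hat_high[OF t, of \<xi>] False by linarith
qed

section \<open>Comparison with the heat equation\<close>

abbreviation vol :: "'a::euclidean_space set \<Rightarrow> real" where "vol E \<equiv> measure lborel E"

lemma bounded_borel_indicator:
  fixes E :: "'a::euclidean_space set"
  assumes E: "E \<in> sets borel" "E \<subseteq> cball 0 r"
  shows "integrable lborel (indicator E :: 'a \<Rightarrow> real)" "square_integrable (indicator E :: 'a \<Rightarrow> real)"
    and "norm (fourier_integral (indicator E) \<xi>) \<le> vol E"
proof -
  have fin: "emeasure lborel E < \<infinity>"
    using emeasure_mono[OF E(2), of lborel] emeasure_lborel_cball_finite[of "0::'a" r] by (simp add: le_less_trans)
  show i: "integrable lborel (indicator E :: 'a \<Rightarrow> real)" using E fin by (simp add: integrable_indicator_iff)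
  show "square_integrable (indicator E :: 'a \<Rightarrow> real)" by (rule square_integrable_indicator[OF E(1) fin])
  show "norm (fourier_integral (indicator E) \<xi>) \<le> vol E"
    using norm_fourier_integral_le[OF i, of \<xi>] by simp
qed

text \<open>A bound without decay in the frequency, with 4160 = 64 + 64^2. It suffices against
  sources whose transform is integrable.\<close>

lemma K_hat_heat_uniform:
  fixes \<xi> :: "'a::euclidean_space"
  assumes t: "t \<ge> 1"
  shows "\<bar>K_hat t \<xi> - exp (- t * (norm \<xi>)\<^sup>2)\<bar> \<le> 4160 / t"
proof -
  have "64 / t * exp (- t * (norm \<xi>)\<^sup>2 / 2) \<le> 64 / t * 1"
    using t by (intro mult_left_mono) auto
  moreover have "64 * exp (- t / 64) / sqrt (1 + (norm \<xi>)\<^sup>2) \<le> 64 * (64 / t) / 1"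
  proof (intro frac_le mult_left_mono)
    have "t \<le> 64 * exp (t / 64)" using exp_ge_add_one_self[of "t / 64"] by linarith
    then have "t * exp (- (t / 64)) \<le> 64 * exp (t / 64) * exp (- (t / 64))" by (intro mult_right_mono) auto
    also have "\<dots> = 64" by (simp flip: exp_add)
    finally show "exp (- t / 64) \<le> 64 / t" using t by (simp add: le_divide_eq mult.commute)
  qed (use t in auto)
  moreover have "64 / t * 1 + 64 * (64 / t) / 1 = 4160 / t" by simp
  ultimately have "64 / t * exp (- t * (norm \<xi>)\<^sup>2 / 2) + 64 * exp (- t / 64) / sqrt (1 + (norm \<xi>)\<^sup>2) \<le> 4160 / t"
    by linarith
  then show ?thesis using K_hat_heat[OF t, of \<xi>] by linarith
qed

lemma K_hat_bounded:
  fixes \<xi> :: "'a::euclidean_space"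
  assumes t: "t \<ge> 0"
  shows "\<bar>K_hat t \<xi>\<bar> \<le> t * exp t"
proof -
  have "\<bar>K_hat t \<xi>\<bar> \<le> 1 * (t * exp t)"
    unfolding K_hat_oscillator abs_mult using t by (intro mult_mono oscillator_bound_quarter) auto
  then show ?thesis by simp
qed

text \<open>The normalised autocorrelation of a ball: a substitute for the indicator of the ball of twice
  the radius, with integrable Fourier transform.\<close>

definition ball_bump :: "real \<Rightarrow> 'a::euclidean_space \<Rightarrow> real" where
  "ball_bump R x = (\<integral>y. indicator (cball 0 R) y * indicator (cball 0 R) (y - x) \<partial>lborel) / vol (cball (0::'a) R)"

text \<open>The transform is the square of an L2 function divided by the volume. By Plancherel its
  modulus has integral (2 pi)^n for every radius, and this uniformity keeps the error in
  \<open>heat_spreading\<close> of order 1 / t.\<close>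

lemma ball_bump:
  fixes R :: real
  assumes R: "R > 0"
  shows "integrable lborel (ball_bump R :: 'a::euclidean_space \<Rightarrow> real)"
    and "square_integrable (ball_bump R :: 'a \<Rightarrow> real)"
    and "0 \<le> ball_bump R (x::'a)" "ball_bump R x \<le> indicator (cball 0 (2 * R)) x"
    and "(\<integral>x. ball_bump R (x::'a) \<partial>lborel) = vol (cball (0::'a) R)"
    and "fourier_integral (ball_bump R) (\<xi>::'a)
      = (fourier_integral (indicator (cball 0 R)) \<xi>)\<^sup>2 / of_real (vol (cball (0::'a) R))"
proof -
  define V where "V = vol (cball (0::'a) R)"
  define h where "h = (indicator (cball (0::'a) R) :: 'a \<Rightarrow> real)"
  have V: "V > 0" unfolding V_def using R by (subst content_cball) auto
  have hm [measurable]: "h \<in> borel_measurable borel" by (simp add: h_def)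
  have hi: "integrable lborel h" unfolding h_def by (rule bounded_borel_indicator(1)[of _ R]) auto
  have hV: "(\<integral>x. h x \<partial>lborel) = V" by (simp add: h_def V_def)
  have sym: "h (y - x) = h (x - y)" for x y by (simp add: h_def indicator_def norm_minus_commute)
  have bump: "ball_bump R x = (\<integral>y. h y * h (y - x) \<partial>lborel) / V" for x
    by (simp add: ball_bump_def h_def V_def)
  note i = integrable_convolution_integrand[OF hi hi]
  have i2: "integrable lborel (\<lambda>x. \<integral>y. h y * h (y - x) \<partial>lborel)"
    using lborel_pair.integrable_snd[OF i] .
  show int: "integrable lborel (ball_bump R :: 'a \<Rightarrow> real)"
    unfolding bump[abs_def] using i2 by simp
  have iy: "integrable lborel (\<lambda>y. h y * h (y - x))" for x
    by (rule Bochner_Integration.integrable_bound[OF hi]) (auto simp: h_def indicator_def)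
  show nn: "0 \<le> ball_bump R x" for x :: 'a
    unfolding bump using V by (intro divide_nonneg_pos Bochner_Integration.integral_nonneg) (auto simp: h_def)
  show le: "ball_bump R x \<le> indicator (cball 0 (2 * R)) x" for x :: 'a
  proof (cases "norm x \<le> 2 * R")
    case True
    have "(\<integral>y. h y * h (y - x) \<partial>lborel) \<le> (\<integral>y. h y \<partial>lborel)"
      by (rule integral_mono[OF iy hi]) (auto simp: h_def indicator_def)
    then show ?thesis using True V unfolding bump hV by simp
  next
    case False
    have hz: "h y * h (y - x) = 0" for y
    proof (rule ccontr)
      assume "h y * h (y - x) \<noteq> 0"
      then have "norm y \<le> R" "norm (y - x) \<le> R" by (auto simp: h_def indicator_def split: if_splits)
      moreover have "norm x \<le> norm y + norm (y - x)"
        using norm_triangle_ineq4[of y "y - x"] by simp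
      ultimately show False using False by simp
    qed
    have "(\<integral>y. h y * h (y - x) \<partial>lborel) = (\<integral>y. 0 \<partial>(lborel :: 'a measure))"
      by (intro Bochner_Integration.integral_cong refl hz)
    then show ?thesis using False by (simp add: bump)
  qed
  have bm: "(ball_bump R :: 'a \<Rightarrow> real) \<in> borel_measurable borel"
    using borel_measurable_integrable[OF int] by simp
  show "square_integrable (ball_bump R :: 'a \<Rightarrow> real)"
    unfolding square_integrable_def
  proof
    show "ball_bump R \<in> borel_measurable (lborel :: 'a measure)" using bm by simp
    show "integrable lborel (\<lambda>x::'a. (norm (ball_bump R x))\<^sup>2)"
    proof (rule Bochner_Integration.integrable_bound[OF int])
      show "(\<lambda>x::'a. (norm (ball_bump R x))\<^sup>2) \<in> borel_measurable lborel" using bm by measurable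
      have "(ball_bump R x)\<^sup>2 \<le> ball_bump R x" for x :: 'a
      proof -
        have "ball_bump R x \<le> 1" by (rule order_trans[OF le indicator_le_1])
        then show ?thesis using nn[of x] by (simp add: power2_eq_square mult_left_le)
      qed
      then show "AE x in lborel. norm ((norm (ball_bump R (x::'a)))\<^sup>2) \<le> norm (ball_bump R x)"
        using nn by simp
    qed
  qed
  have "(\<integral>x. (\<integral>y. h y * h (y - x) \<partial>lborel) \<partial>lborel) = (\<integral>y. (\<integral>x. h y * h (y - x) \<partial>lborel) \<partial>lborel)"
    by (rule lborel_pair.Fubini_integral[OF i])
  also have "\<dots> = (\<integral>y. h y * V \<partial>lborel)"
    using lborel_reflect(2)[OF hm] hV by simp
  also have "\<dots> = V * V" using hV by simp
  finally show "(\<integral>x. ball_bump R (x::'a) \<partial>lborel) = vol (cball (0::'a) R)"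
    unfolding bump[abs_def] using V by (simp add: V_def)
  let ?F = "fourier_integral h"
  have ic: "integrable (lborel \<Otimes>\<^sub>M lborel) (\<lambda>(y, x). complex_of_real (h y * h (y - x)) * cis (- (x \<bullet> \<xi>)))"
  proof -
    have "integrable (lborel \<Otimes>\<^sub>M lborel) (\<lambda>z. complex_of_real (case z of (y, x) \<Rightarrow> h y * h (y - x)) * cis (- (snd z \<bullet> \<xi>)))"
      by (intro integrable_mult_cis integrable_of_real i) measurable
    then show ?thesis by (simp add: case_prod_unfold)
  qed
  have inner: "(\<integral>x. complex_of_real (h y * h (y - x)) * cis (- (x \<bullet> \<xi>)) \<partial>lborel) = of_real (h y) * cis (- (y \<bullet> \<xi>)) * ?F \<xi>" for y
  proof -
    have "(\<integral>x. complex_of_real (h y * h (y - x)) * cis (- (x \<bullet> \<xi>)) \<partial>lborel)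
        = (\<integral>x. of_real (h y) * (complex_of_real (h (x + (- y))) * cis (- (x \<bullet> \<xi>))) \<partial>lborel)"
      by (simp add: sym mult.assoc)
    also have "\<dots> = of_real (h y) * fourier_integral (\<lambda>x. h (x + (- y))) \<xi>"
      unfolding fourier_integral_def by (rule integral_mult_right_zero)
    also have "fourier_integral (\<lambda>x. h (x + (- y))) \<xi> = cis ((- y) \<bullet> \<xi>) * ?F \<xi>"
      by (rule fourier_integral_translate[OF hm])
    finally show ?thesis by simp
  qed
  have "(\<integral>x. (\<integral>y. complex_of_real (h y * h (y - x)) * cis (- (x \<bullet> \<xi>)) \<partial>lborel) \<partial>lborel)
      = (\<integral>y. of_real (h y) * cis (- (y \<bullet> \<xi>)) * ?F \<xi> \<partial>lborel)"
    unfolding lborel_pair.Fubini_integral[OF ic] inner ..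
  also have "\<dots> = ?F \<xi> * ?F \<xi>"
    by (subst (2) fourier_integral_def) (simp add: mult.commute)
  finally have "(\<integral>x. (\<integral>y. complex_of_real (h y * h (y - x)) * cis (- (x \<bullet> \<xi>)) \<partial>lborel) \<partial>lborel) = (?F \<xi>)\<^sup>2"
    by (simp add: power2_eq_square)
  moreover have "of_real (ball_bump R x) * cis (- (x \<bullet> \<xi>))
      = (\<integral>y. complex_of_real (h y * h (y - x)) * cis (- (x \<bullet> \<xi>)) \<partial>lborel) / of_real V" for x
  proof -
    have "(\<integral>y. complex_of_real (h y * h (y - x)) * cis (- (x \<bullet> \<xi>)) \<partial>lborel)
        = (\<integral>y. complex_of_real (h y * h (y - x)) \<partial>lborel) * cis (- (x \<bullet> \<xi>))"
      by (rule integral_mult_left_zero)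
    then show ?thesis by (simp only: integral_complex_of_real bump) (simp add: field_simps)
  qed
  ultimately show "fourier_integral (ball_bump R) \<xi>
      = (fourier_integral (indicator (cball 0 R)) \<xi>)\<^sup>2 / of_real (vol (cball (0::'a) R))"
    unfolding fourier_integral_def[of "ball_bump R"] h_def[symmetric] V_def[symmetric] by simp
qed

section \<open>Spreading of a source by the heat flow\<close>

text \<open>The radius 3 / 2 sqrt t bounds the distance between a point of the ball of radius sqrt t
  / 2 and one of the ball of radius sqrt t. For \<tau> >= t / 2 the exponent is then at most 9 / 8,
  hence below 2.\<close>

lemma gauss_kernel_lower_bound:
  assumes \<tau>: "0 < \<tau>" "\<tau> \<le> t" "t \<le> 2 * \<tau>" and x: "norm (x::'a::euclidean_space) \<le> 3 / 2 * sqrt t"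
  shows "sqrt (pi / t) ^ DIM('a) * exp (- 2) \<le> gauss_kernel \<tau> x"
  unfolding gauss_kernel_def
proof (intro mult_mono power_mono)
  show "sqrt (pi / t) \<le> sqrt (pi / \<tau>)" using \<tau> by (simp add: frac_le)
  have "(norm x)\<^sup>2 \<le> (3 / 2 * sqrt t)\<^sup>2" using x by (intro power_mono) auto
  also have "\<dots> = 9 / 4 * t" using \<tau> by (simp add: power_mult_distrib power_divide)
  also have "\<dots> \<le> 9 / 2 * \<tau>" using \<tau> by simp
  finally have "(norm x)\<^sup>2 / (4 * \<tau>) \<le> 2" using \<tau> by (simp add: divide_le_eq)
  then show "exp (- 2) \<le> exp (- (norm x)\<^sup>2 / (4 * \<tau>))" by simp
qed (use \<tau> in auto)

lemma Re_lower_of_norm: "norm (z - w) \<le> e \<Longrightarrow> Re w - e \<le> Re z"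
  using abs_Re_le_cmod[of "z - w"] by simp

text \<open>On the parabolic scale the heat flow of a bump of width sqrt t has a lower bound
  independent of t, whereas replacing the damped symbol by the Gaussian costs O(1 / t). Positivity
  reduces a general source to m times the bump.\<close>

lemma heat_spreading:
  assumes dim: "DIM('a::euclidean_space) \<le> 3"
  obtains c T where "c > 0" "T \<ge> 1"
    "\<And>t \<tau> m (f :: 'a \<Rightarrow> real) g E. t \<ge> T \<Longrightarrow> t / 2 \<le> \<tau> \<Longrightarrow> \<tau> \<le> t \<Longrightarrow> fourier_pair f g \<Longrightarrow> m \<ge> 0
      \<Longrightarrow> AE x in lborel. m * indicator (cball 0 (sqrt t / 2)) x \<le> f x
      \<Longrightarrow> E \<in> sets borel \<Longrightarrow> E \<subseteq> cball 0 (sqrt t)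
      \<Longrightarrow> (2 * pi) ^ DIM('a) * (m * c * vol E)
        \<le> Re (\<integral>\<xi>. of_real (K_hat \<tau> \<xi>) * (g \<xi> * cnj (fourier_integral (indicator E) \<xi>)) \<partial>lborel)"
proof -
  let ?n = "DIM('a)"
  define P where "P = (2 * pi) ^ ?n"
  have P: "P > 0" by (simp add: P_def)
  \<comment> \<open>The bump has mass \<open>unit_ball_vol (real ?n) * (sqrt t / 4) ^ ?n\<close>,
    and the kernel is at least (pi / t)^(n / 2) exp (- 2): the powers of t cancel in the
    product.\<close>
  define c1 where "c1 = unit_ball_vol (real ?n) * (sqrt pi / 4) ^ ?n * exp (- 2)"
  have c1: "c1 > 0" by (simp add: c1_def)
  \<comment> \<open>From this time on the error 4160 P / \<tau>, which is at most 8320 P / t, is at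
    most c1 / 2.\<close>
  define T where "T = max 2 (2 * 8320 * P / c1)"
  have T: "T \<ge> 2" by (simp add: T_def)
  show thesis
  proof (rule that[of "c1 / 2 / P" T])
    show "c1 / 2 / P > 0" using c1 P by simp
    show "T \<ge> 1" using T by simp
    fix t \<tau> m :: real and f :: "'a \<Rightarrow> real" and g :: "'a \<Rightarrow> complex" and E :: "'a set"
    assume t: "t \<ge> T" and \<tau>: "t / 2 \<le> \<tau>" "\<tau> \<le> t" and fg: "fourier_pair f g" and m: "m \<ge> 0"
      and f: "AE x in lborel. m * indicator (cball 0 (sqrt t / 2)) x \<le> f x"
      and E: "E \<in> sets borel" "E \<subseteq> cball 0 (sqrt t)"
    have t2: "t \<ge> 2" "\<tau> \<ge> 1" "\<tau> > 0" using t T \<tau> by auto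
    \<comment> \<open>The bump lives in the ball of radius 2 R = sqrt t / 2, where the source is at
      least m.\<close>
    define R where "R = sqrt t / 4"
    have R: "R > 0" using t2 by (simp add: R_def)
    define V where "V = vol (cball (0::'a) R)"
    have V: "V = unit_ball_vol (real ?n) * R ^ ?n" unfolding V_def using R by (subst content_cball) auto
    have V0: "V > 0" using R by (simp add: V)
    note \<phi> = bounded_borel_indicator[OF E]
    let ?G = "fourier_integral (indicator E)"
    let ?g0 = "fourier_integral (ball_bump R :: 'a \<Rightarrow> real)"
    let ?F = "fourier_integral (indicator (cball (0::'a) R))"
    note bump = ball_bump[OF R, where 'a='a]
    have fp0: "fourier_pair (ball_bump R) ?g0" by (rule fourier_pair_fourier_integral[OF bump(1,2)])
    define H where "H g \<xi> = g \<xi> * cnj (?G \<xi>)" for g :: "'a \<Rightarrow> complex" and \<xi>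
    have iH: "integrable lborel (H g)" if "fourier_pair f g" for f g
      unfolding H_def using that plancherel(1)[OF \<phi>(1,2)]
      by (intro square_integrable_mult_cnj) (auto simp: fourier_pair_def)
    let ?J = "\<lambda>g. \<integral>\<xi>. of_real (K_hat \<tau> \<xi>) * H g \<xi> \<partial>lborel"
    have iK: "integrable lborel (\<lambda>\<xi>. of_real (K_hat \<tau> \<xi>) * H g \<xi>)" if "fourier_pair f g" for f g
      by (rule integrable_bounded_mult[OF iH[OF that] _ K_hat_bounded]) (use t2 in auto)
    \<comment> \<open>\<open>f - m * ball_bump R\<close> is nonnegative, hence so is its image under the multiplier.\<close>
    have "0 \<le> Re (?J (\<lambda>\<xi>. g \<xi> - of_real m * ?g0 \<xi>))"
    proof -
      have nn: "AE x in lborel. 0 \<le> f x - m * ball_bump R x"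
        using f
      proof eventually_elim
        case (elim x)
        have "m * ball_bump R x \<le> m * indicator (cball 0 (2 * R)) x"
          using bump(4) m by (intro mult_left_mono) auto
        then show ?case using elim by (simp add: R_def)
      qed
      have "0 \<le> (\<integral>x. (f x - m * ball_bump R x) * indicator E (x + y) \<partial>lborel)" for y
        using nn by (intro integral_nonneg_AE) (auto elim!: eventually_mono)
      from K_pairing_lower_bound[OF dim fourier_pair_diff_scaled[OF fg fp0] nn \<phi>(1,2) _ _ _ this, of \<tau> "\<tau> + 1"]
      show ?thesis using t2 by (simp add: H_def)
    qed
    also have "?J (\<lambda>\<xi>. g \<xi> - of_real m * ?g0 \<xi>) = ?J g - of_real m * ?J ?g0"
    proof -
      have "?J (\<lambda>\<xi>. g \<xi> - of_real m * ?g0 \<xi>)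
          = (\<integral>\<xi>. of_real (K_hat \<tau> \<xi>) * H g \<xi> - of_real m * (of_real (K_hat \<tau> \<xi>) * H ?g0 \<xi>) \<partial>lborel)"
        by (intro Bochner_Integration.integral_cong refl) (simp add: H_def algebra_simps)
      also have "\<dots> = ?J g - of_real m * ?J ?g0"
        using iK[OF fg] iK[OF fp0] by simp
      finally show ?thesis .
    qed
    finally have 1: "m * Re (?J ?g0) \<le> Re (?J g)" by simp
    let ?e = "\<lambda>\<xi>::'a. exp (- \<tau> * (norm \<xi>)\<^sup>2)"
    let ?I = "\<integral>\<xi>. of_real (?e \<xi>) * H ?g0 \<xi> \<partial>lborel"
    have ie: "integrable lborel (\<lambda>\<xi>. of_real (?e \<xi>) * H ?g0 \<xi>)"
      using t2 by (intro integrable_bounded_mult[OF iH[OF fp0], where C=1]) auto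
    have "norm (?J ?g0 - ?I) \<le> (\<integral>\<xi>. 4160 / \<tau> * vol E / V * (norm (?F \<xi>))\<^sup>2 \<partial>lborel)"
    proof -
      have "?J ?g0 - ?I = (\<integral>\<xi>. of_real (K_hat \<tau> \<xi>) * H ?g0 \<xi> - of_real (?e \<xi>) * H ?g0 \<xi> \<partial>lborel)"
        using iK[OF fp0] ie by simp
      also have "norm \<dots> \<le> (\<integral>\<xi>. 4160 / \<tau> * vol E / V * (norm (?F \<xi>))\<^sup>2 \<partial>lborel)"
      proof (rule Bochner_Integration.integral_norm_bound_integral)
        show "integrable lborel (\<lambda>\<xi>. of_real (K_hat \<tau> \<xi>) * H ?g0 \<xi> - of_real (?e \<xi>) * H ?g0 \<xi>)"
          using iK[OF fp0] ie by simp
        have "square_integrable ?F" by (intro plancherel(1) bounded_borel_indicator[of _ R]) auto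
        then show "integrable lborel (\<lambda>\<xi>. 4160 / \<tau> * vol E / V * (norm (?F \<xi>))\<^sup>2)"
          by (simp add: square_integrable_def)
        fix \<xi> :: 'a
        have "norm (of_real (K_hat \<tau> \<xi>) * H ?g0 \<xi> - of_real (?e \<xi>) * H ?g0 \<xi>)
            = \<bar>K_hat \<tau> \<xi> - ?e \<xi>\<bar> * (norm (?g0 \<xi>) * norm (?G \<xi>))"
          by (simp add: H_def norm_mult flip: left_diff_distrib of_real_diff)
        also have "\<dots> \<le> 4160 / \<tau> * (((norm (?F \<xi>))\<^sup>2 / V) * vol E)"
          using V0 t2 bump(6)[of \<xi>] \<phi>(3)[of \<xi>]
          by (intro mult_mono K_hat_heat_uniform) (auto simp: V_def norm_divide norm_power)
        finally show "norm (of_real (K_hat \<tau> \<xi>) * H ?g0 \<xi> - of_real (?e \<xi>) * H ?g0 \<xi>)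
            \<le> 4160 / \<tau> * vol E / V * (norm (?F \<xi>))\<^sup>2" by (simp add: field_simps)
      qed
      finally show ?thesis .
    qed
    also have "\<dots> = 4160 / \<tau> * vol E / V * (\<integral>\<xi>. (norm (?F \<xi>))\<^sup>2 \<partial>lborel)"
      by (rule integral_mult_right_zero)
    also have "(\<integral>\<xi>. (norm (?F \<xi>))\<^sup>2 \<partial>lborel) = P * V"
    proof -
      have "(\<integral>x. (indicator (cball (0::'a) R) x)\<^sup>2 \<partial>lborel) = V"
      proof -
        have "(indicator (cball (0::'a) R) x :: real)\<^sup>2 = indicator (cball 0 R) x" for x
          by (simp add: indicator_def)
        then show ?thesis by (simp add: V_def)
      qed
      then show ?thesis
        unfolding P_def by (subst plancherel(2)) (auto intro: bounded_borel_indicator[of _ R])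
    qed
    also have "4160 / \<tau> * vol E / V * (P * V) = 4160 * P / \<tau> * vol E" using V0 by simp
    also have "\<dots> \<le> c1 / 2 * vol E"
    proof (intro mult_right_mono)
      have "2 * 8320 * P / c1 \<le> t" using t by (simp add: T_def)
      then have "2 * 8320 * P \<le> t * c1" using c1 by (simp add: divide_le_eq)
      also have "\<dots> \<le> 2 * \<tau> * c1" using \<tau> c1 by (intro mult_right_mono) auto
      finally show "4160 * P / \<tau> \<le> c1 / 2" using t2 P by (simp add: divide_le_eq mult.commute)
    qed simp
    finally have 2: "Re ?I - c1 / 2 * vol E \<le> Re (?J ?g0)" by (rule Re_lower_of_norm)
    have "?I = of_real (\<integral>x. ball_bump R x * (\<integral>y. indicator E y * gauss_kernel \<tau> (x - y) \<partial>lborel) \<partial>lborel)"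
      unfolding H_def by (rule gaussian_pairing[OF bump(1) \<phi>(1) t2(3)])
    then have "Re ?I = (\<integral>x. ball_bump R x * (\<integral>y. indicator E y * gauss_kernel \<tau> (x - y) \<partial>lborel) \<partial>lborel)"
      by simp
    also have "\<dots> \<ge> (\<integral>x. ball_bump R (x::'a) * (sqrt (pi / t) ^ ?n * exp (- 2) * vol E) \<partial>lborel)"
    proof -
      have ig: "integrable lborel (\<lambda>y. indicator E y * gauss_kernel \<tau> (x - y))" for x :: 'a
      proof (rule Bochner_Integration.integrable_bound)
        show "integrable lborel (\<lambda>y. indicator E y * sqrt (pi / \<tau>) ^ ?n :: real)" using \<phi>(1) by simp
        show "(\<lambda>y. indicator E y * gauss_kernel \<tau> (x - y)) \<in> borel_measurable lborel"
          using E(1) by measurable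
        show "AE y in lborel. norm (indicator E y * gauss_kernel \<tau> (x - y)) \<le> norm (indicator E y * sqrt (pi / \<tau>) ^ ?n :: real)"
        proof (rule AE_I2)
          fix y :: 'a
          have "\<bar>gauss_kernel \<tau> (x - y)\<bar> \<le> \<bar>sqrt (pi / \<tau>) ^ ?n\<bar>"
            using gauss_kernel_le[OF t2(3), of "x - y"] gauss_kernel_nonneg[OF t2(3), of "x - y"] by linarith
          then show "norm (indicator E y * gauss_kernel \<tau> (x - y)) \<le> norm (indicator E y * sqrt (pi / \<tau>) ^ ?n :: real)"
            by (simp add: abs_mult mult_left_mono)
        qed
      qed
      have bound: "(\<integral>y. indicator E y * gauss_kernel \<tau> (x - y) \<partial>lborel) \<le> sqrt (pi / \<tau>) ^ ?n * vol E" for x :: 'a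
      proof -
        have "(\<integral>y. indicator E y * gauss_kernel \<tau> (x - y) \<partial>lborel) \<le> (\<integral>y. sqrt (pi / \<tau>) ^ ?n * indicator E y \<partial>lborel)"
        proof (rule integral_mono[OF ig])
          fix y :: 'a
          show "indicator E y * gauss_kernel \<tau> (x - y) \<le> sqrt (pi / \<tau>) ^ ?n * indicator E y"
            using gauss_kernel_le[OF t2(3), of "x - y"] by (simp add: indicator_def)
        qed (use \<phi>(1) in simp)
        then show ?thesis by simp
      qed
      show ?thesis
      proof (rule integral_mono)
        show "integrable lborel (\<lambda>x::'a. ball_bump R x * (sqrt (pi / t) ^ ?n * exp (- 2) * vol E))"
          using bump(1) by simp
        show "integrable lborel (\<lambda>x. ball_bump R x * (\<integral>y. indicator E y * gauss_kernel \<tau> (x - y) \<partial>lborel))"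
        proof (rule Bochner_Integration.integrable_bound)
          show "integrable lborel (\<lambda>x::'a. ball_bump R x * (sqrt (pi / \<tau>) ^ ?n * vol E))" using bump(1) by simp
          have [measurable]: "(ball_bump R :: 'a \<Rightarrow> real) \<in> borel_measurable borel"
            using borel_measurable_integrable[OF bump(1)] by simp
          show "(\<lambda>x. ball_bump R x * (\<integral>y. indicator E y * gauss_kernel \<tau> (x - y) \<partial>lborel)) \<in> borel_measurable lborel"
            using E(1) by measurable
          have nn: "0 \<le> (\<integral>y. indicator E y * gauss_kernel \<tau> (x - y) \<partial>lborel)" for x :: 'a
            by (intro Bochner_Integration.integral_nonneg) (simp add: gauss_kernel_nonneg[OF t2(3)])
          show "AE x::'a in lborel. norm (ball_bump R x * (\<integral>y. indicator E y * gauss_kernel \<tau> (x - y) \<partial>lborel))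
              \<le> norm (ball_bump R x * (sqrt (pi / \<tau>) ^ ?n * vol E))"
          proof (rule AE_I2)
            fix x :: 'a
            have "norm (ball_bump R x * (\<integral>y. indicator E y * gauss_kernel \<tau> (x - y) \<partial>lborel))
                = ball_bump R x * (\<integral>y. indicator E y * gauss_kernel \<tau> (x - y) \<partial>lborel)"
              unfolding real_norm_def by (intro abs_of_nonneg mult_nonneg_nonneg bump(3) nn)
            also have "\<dots> \<le> ball_bump R x * (sqrt (pi / \<tau>) ^ ?n * vol E)"
              by (rule mult_left_mono[OF bound bump(3)])
            also have "\<dots> \<le> norm (ball_bump R x * (sqrt (pi / \<tau>) ^ ?n * vol E))"
              unfolding real_norm_def by (rule abs_ge_self)
            finally show "norm (ball_bump R x * (\<integral>y. indicator E y * gauss_kernel \<tau> (x - y) \<partial>lborel))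
                \<le> norm (ball_bump R x * (sqrt (pi / \<tau>) ^ ?n * vol E))" .
          qed
        qed
        fix x :: 'a
        show "ball_bump R x * (sqrt (pi / t) ^ ?n * exp (- 2) * vol E)
            \<le> ball_bump R x * (\<integral>y. indicator E y * gauss_kernel \<tau> (x - y) \<partial>lborel)"
        proof (cases "norm x \<le> 2 * R")
          case False
          then have "ball_bump R x = 0" using bump(3,4)[of x] by simp
          then show ?thesis by simp
        next
          case True
          have "(\<integral>y. sqrt (pi / t) ^ ?n * exp (- 2) * indicator E y \<partial>lborel)
              \<le> (\<integral>y. indicator E y * gauss_kernel \<tau> (x - y) \<partial>lborel)"
          proof (rule integral_mono)
            show "integrable lborel (\<lambda>y. sqrt (pi / t) ^ ?n * exp (- 2) * indicator E y :: real)" using \<phi>(1) by simp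
            fix y :: 'a
            show "sqrt (pi / t) ^ ?n * exp (- 2) * indicator E y \<le> indicator E y * gauss_kernel \<tau> (x - y)"
            proof (cases "y \<in> E")
              case yE: True
              then have "norm y \<le> sqrt t" using E(2) by auto
              then have "norm (x - y) \<le> 3 / 2 * sqrt t"
                using norm_triangle_ineq4[of x y] True by (simp add: R_def)
              then show ?thesis using gauss_kernel_lower_bound[OF t2(3) \<tau>(2)] \<tau>(1) yE by simp
            qed simp
          qed (rule ig)
          then have "sqrt (pi / t) ^ ?n * exp (- 2) * vol E \<le> (\<integral>y. indicator E y * gauss_kernel \<tau> (x - y) \<partial>lborel)"
            by simp
          then show ?thesis using bump(3)[of x] by (rule mult_left_mono)
        qed
      qed
    qed
    moreover have "(\<integral>x. ball_bump R (x::'a) * (sqrt (pi / t) ^ ?n * exp (- 2) * vol E) \<partial>lborel) = c1 * vol E"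
    proof -
      have "(\<integral>x. ball_bump R (x::'a) * (sqrt (pi / t) ^ ?n * exp (- 2) * vol E) \<partial>lborel) = V * (sqrt (pi / t) ^ ?n * exp (- 2) * vol E)"
        using bump(5) by (simp add: V_def)
      also have "\<dots> = unit_ball_vol (real ?n) * (R ^ ?n * sqrt (pi / t) ^ ?n) * exp (- 2) * vol E"
        by (simp only: V mult_ac)
      also have "R ^ ?n * sqrt (pi / t) ^ ?n = (R * sqrt (pi / t)) ^ ?n" by (rule power_mult_distrib[symmetric])
      also have "R * sqrt (pi / t) = sqrt pi / 4"
        using t2 by (simp add: R_def real_sqrt_divide)
      also have "unit_ball_vol (real ?n) * (sqrt pi / 4) ^ ?n * exp (- 2) * vol E = c1 * vol E"
        by (simp only: c1_def)
      finally show ?thesis .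
    qed
    ultimately have "c1 / 2 * vol E \<le> Re (?J ?g0)" using 2 by linarith
    then have "m * (c1 / 2 * vol E) \<le> m * Re (?J ?g0)" using m by (rule mult_left_mono)
    also note 1
    also have "m * (c1 / 2 * vol E) = P * (m * (c1 / 2 / P) * vol E)" using P by simp
    finally show "(2 * pi) ^ ?n * (m * (c1 / 2 / P) * vol E)
        \<le> Re (\<integral>\<xi>. of_real (K_hat \<tau> \<xi>) * (g \<xi> * cnj (?G \<xi>)) \<partial>lborel)"
      unfolding H_def P_def .
  qed
qed

section \<open>Large-time behaviour of the linear part\<close>

text \<open>The first limit serves to identify the Plancherel transform with the Fourier integral;
  the second, at frequency 0, is how the positive mass of the datum enters.\<close>

lemma fourier_integral_L1_limit:
  fixes f :: "'a::euclidean_space \<Rightarrow> real"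
  assumes f: "integrable lborel f"
  shows "(\<lambda>R::nat. fourier_integral (\<lambda>x. indicator (cball 0 (real R)) x * f x) \<xi>) \<longlonglongrightarrow> fourier_integral f \<xi>"
    and "fourier_integral f \<midarrow>0\<rightarrow> of_real (\<integral>x. f x \<partial>lborel)"
proof -
  have [measurable]: "f \<in> borel_measurable borel" using borel_measurable_integrable[OF f] by simp
  have fn: "integrable lborel (\<lambda>x. norm (f x))" using f by simp
  show "(\<lambda>R::nat. fourier_integral (\<lambda>x. indicator (cball 0 (real R)) x * f x) \<xi>) \<longlonglongrightarrow> fourier_integral f \<xi>"
    unfolding fourier_integral_def
  proof (rule integral_dominated_convergence[OF _ _ fn])
    show "AE x in lborel. (\<lambda>R::nat. of_real (indicator (cball 0 (real R)) x * f x) * cis (- (x \<bullet> \<xi>)))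
        \<longlonglongrightarrow> of_real (f x) * cis (- (x \<bullet> \<xi>))"
    proof (rule AE_I2, rule tendsto_eventually)
      fix x :: 'a
      show "\<forall>\<^sub>F R in sequentially. of_real (indicator (cball 0 (real R)) x * f x) * cis (- (x \<bullet> \<xi>))
          = of_real (f x) * cis (- (x \<bullet> \<xi>))"
        using eventually_ge_at_top[of "nat \<lceil>norm x\<rceil>"]
        by eventually_elim (auto simp: indicator_def nat_le_iff ceiling_le_iff)
    qed
    show "AE x in lborel. norm (of_real (indicator (cball 0 (real R)) x * f x) * cis (- (x \<bullet> \<xi>))) \<le> norm (f x)" for R :: nat
      by (auto simp: norm_mult indicator_def)
  qed measurable
  show "fourier_integral f \<midarrow>0\<rightarrow> of_real (\<integral>x. f x \<partial>lborel)"
  proof (rule tendsto_at_iff_sequentially[THEN iffD2], intro allI impI)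
    fix X :: "nat \<Rightarrow> 'a" assume X: "X \<longlonglongrightarrow> 0"
    have "(\<lambda>i. fourier_integral f (X i)) \<longlonglongrightarrow> (\<integral>x. complex_of_real (f x) \<partial>lborel)"
      unfolding fourier_integral_def
    proof (rule integral_dominated_convergence[OF _ _ fn])
      show "AE x in lborel. (\<lambda>i. of_real (f x) * cis (- (x \<bullet> X i))) \<longlonglongrightarrow> complex_of_real (f x)"
      proof (rule AE_I2)
        fix x :: 'a
        have "(\<lambda>i. of_real (f x) * cis (- (x \<bullet> X i))) \<longlonglongrightarrow> complex_of_real (f x) * cis (- (x \<bullet> 0))"
          unfolding cis_conv_exp by (intro tendsto_intros X)
        then show "(\<lambda>i. of_real (f x) * cis (- (x \<bullet> X i))) \<longlonglongrightarrow> complex_of_real (f x)" by simp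
      qed
      show "AE x in lborel. norm (of_real (f x) * cis (- (x \<bullet> X i))) \<le> norm (f x)" for i
        by (auto simp: norm_mult)
    qed measurable
    then show "(fourier_integral f \<circ> X) \<longlonglongrightarrow> of_real (\<integral>x. f x \<partial>lborel)" by (simp add: o_def)
  qed
qed

text \<open>The truncated transforms converge pointwise to the Fourier integral and in L2 to
  \<open>g\<close>; Fatou's lemma makes the squared distance between the two limits vanish.\<close>

lemma has_fourier_integrable_AE:
  fixes f :: "'a::euclidean_space \<Rightarrow> real"
  assumes hf: "has_fourier f g" and f: "integrable lborel f"
  shows "AE \<xi> in lborel. g \<xi> = fourier_integral f \<xi>"
proof -
  have [measurable]: "f \<in> borel_measurable borel" "g \<in> borel_measurable borel"
    using hf by (auto simp: has_fourier_def square_integrable_def)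
  have [measurable]: "fourier_integral f \<in> borel_measurable borel"
    "(\<lambda>\<xi>. fourier_integral (\<lambda>x. indicator (cball 0 (real R)) x * f x) \<xi>) \<in> borel_measurable borel" for R :: nat
    by (rule fourier_integral_measurable, measurable)+
  define d where "d R \<xi> = ennreal ((norm (fourier_integral (\<lambda>x. indicator (cball 0 (real R)) x * f x) \<xi> - g \<xi>))\<^sup>2)" for R :: nat and \<xi>
  have "(\<integral>\<^sup>+\<xi>. ennreal ((norm (fourier_integral f \<xi> - g \<xi>))\<^sup>2) \<partial>lborel) = (\<integral>\<^sup>+\<xi>. liminf (\<lambda>R. d R \<xi>) \<partial>lborel)"
  proof (intro nn_integral_cong)
    fix \<xi> :: 'a
    have "(\<lambda>R. d R \<xi>) \<longlonglongrightarrow> ennreal ((norm (fourier_integral f \<xi> - g \<xi>))\<^sup>2)"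
      unfolding d_def by (intro tendsto_ennrealI tendsto_intros fourier_integral_L1_limit(1)[OF f])
    then show "ennreal ((norm (fourier_integral f \<xi> - g \<xi>))\<^sup>2) = liminf (\<lambda>R. d R \<xi>)"
      by (intro lim_imp_Liminf[symmetric]) auto
  qed
  also have "\<dots> \<le> liminf (\<lambda>R. \<integral>\<^sup>+\<xi>. d R \<xi> \<partial>lborel)"
    by (intro nn_integral_liminf) (unfold d_def, measurable)
  also have "\<dots> = 0"
    using hf unfolding has_fourier_def d_def by (intro lim_imp_Liminf) auto
  finally have "(\<integral>\<^sup>+\<xi>. ennreal ((norm (fourier_integral f \<xi> - g \<xi>))\<^sup>2) \<partial>lborel) = 0" by simp
  then have "AE \<xi> in lborel. ennreal ((norm (fourier_integral f \<xi> - g \<xi>))\<^sup>2) = 0"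
    by (subst (asm) nn_integral_0_iff_AE) auto
  then show ?thesis
    by eventually_elim (simp add: ennreal_eq_0_iff)
qed

text \<open>Domination by a dyadic sum: where |\<xi>| > 2^(k - 1) the weight is at most 16 * 16^-k,
  and for n <= 3 the ball of radius 2^k has volume of order at most 8^k, so the k-th term
  contributes O(2^-k).\<close>

lemma integrable_bessel_weight:
  assumes dim: "DIM('a::euclidean_space) \<le> 3"
  shows "integrable lborel (\<lambda>\<xi>::'a. 1 / (1 + (norm \<xi>)\<^sup>2)\<^sup>2)"
proof -
  let ?n = "DIM('a)"
  define v where "v = unit_ball_vol (real ?n)"
  have v: "v \<ge> 0" by (simp add: v_def)
  define F :: "nat \<Rightarrow> 'a \<Rightarrow> real" where "F k \<xi> = 16 * (1 / 16) ^ k * indicator (cball 0 (2 ^ k)) \<xi>" for k \<xi>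
  have iF: "integrable lborel (F k)" for k
    unfolding F_def[abs_def] by (intro integrable_mult_right bounded_borel_indicator(1)[of _ "2 ^ k"]) auto
  have Fint: "(\<integral>\<xi>. norm (F k \<xi>) \<partial>lborel) \<le> 16 * v * (1 / 2) ^ k" for k
  proof -
    have "norm (F k \<xi>) = F k \<xi>" for \<xi> by (simp add: F_def)
    then have "(\<integral>\<xi>. norm (F k \<xi>) \<partial>lborel) = 16 * (1 / 16) ^ k * vol (cball (0::'a) (2 ^ k))"
      by (simp add: F_def)
    also have "vol (cball (0::'a) (2 ^ k)) = v * (2 ^ k) ^ ?n" unfolding v_def by (subst content_cball) auto
    also have "((2::real) ^ k) ^ ?n \<le> (2 ^ k) ^ (3::nat)" using dim by (intro power_increasing) auto
    also have "((2::real) ^ k) ^ 3 = 8 ^ k" by (simp add: power_mult[symmetric] mult.commute[of k] power_mult)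
    finally have "(\<integral>\<xi>. norm (F k \<xi>) \<partial>lborel) \<le> 16 * (1 / 16) ^ k * (v * 8 ^ k)"
      using v by (simp add: mult_left_mono)
    also have "\<dots> = 16 * v * (1 / 16 * 8) ^ k" by (simp only: power_mult_distrib mult_ac)
    finally show ?thesis by simp
  qed
  have sumF: "summable (\<lambda>k. norm (F k \<xi>))" for \<xi>
  proof (rule summable_comparison_test')
    show "summable (\<lambda>k. 16 * (1 / 16 :: real) ^ k)" by (intro summable_mult summable_geometric) auto
    show "norm (norm (F k \<xi>)) \<le> 16 * (1 / 16) ^ k" if "k \<ge> 0" for k by (simp add: F_def indicator_def)
  qed
  have int: "integrable lborel (\<lambda>\<xi>. \<Sum>k. F k \<xi>)"
  proof (rule integrable_suminf[OF iF])
    show "AE \<xi> in lborel. summable (\<lambda>k. norm (F k \<xi>))" using sumF by simp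
    show "summable (\<lambda>k. \<integral>\<xi>. norm (F k \<xi>) \<partial>lborel)"
    proof (rule summable_comparison_test')
      show "summable (\<lambda>k. 16 * v * (1 / 2) ^ k)" by (intro summable_mult summable_geometric) auto
      show "norm (\<integral>\<xi>. norm (F k \<xi>) \<partial>lborel) \<le> 16 * v * (1 / 2) ^ k" if "k \<ge> 0" for k
        using Fint[of k] by simp
    qed
  qed
  show ?thesis
  proof (rule Bochner_Integration.integrable_bound[OF int])
    show "(\<lambda>\<xi>::'a. 1 / (1 + (norm \<xi>)\<^sup>2)\<^sup>2) \<in> borel_measurable lborel" by measurable
    have "1 / (1 + (norm \<xi>)\<^sup>2)\<^sup>2 \<le> (\<Sum>k. F k \<xi>)" for \<xi> :: 'a
    proof -
      \<comment> \<open>For k > 0 minimality gives |\<xi>| > 2^(k - 1); for k = 0 the weight is at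
        most 1 and the factor 16 is more than enough.\<close>
      define k where "k = (LEAST k::nat. norm \<xi> \<le> 2 ^ k)"
      have ex: "\<exists>k::nat. norm \<xi> \<le> 2 ^ k"
        using real_arch_pow[of 2 "norm \<xi>"] by (auto intro: less_imp_le)
      have k: "norm \<xi> \<le> 2 ^ k" unfolding k_def by (rule LeastI_ex[OF ex])
      have "1 / (1 + (norm \<xi>)\<^sup>2)\<^sup>2 \<le> F k \<xi>"
      proof (cases k)
        case 0
        have "1 \<le> (1 + (norm \<xi>)\<^sup>2)\<^sup>2" by (rule one_le_power) simp
        then have "1 / (1 + (norm \<xi>)\<^sup>2)\<^sup>2 \<le> 1" by (simp add: divide_le_eq)
        then show ?thesis using k 0 by (simp add: F_def)
      next
        case (Suc j)
        then have "j < k" by simp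
        then have "\<not> norm \<xi> \<le> 2 ^ j" unfolding k_def by (rule not_less_Least)
        then have "(2 ^ j)\<^sup>2 \<le> (norm \<xi>)\<^sup>2" by (intro power_mono) auto
        then have "(2 ^ j)\<^sup>2 \<le> 1 + (norm \<xi>)\<^sup>2" by linarith
        then have "((2 ^ j)\<^sup>2)\<^sup>2 \<le> (1 + (norm \<xi>)\<^sup>2)\<^sup>2" by (rule power_mono) simp
        then have "1 / (1 + (norm \<xi>)\<^sup>2)\<^sup>2 \<le> 1 / ((2 ^ j)\<^sup>2)\<^sup>2"
          by (intro divide_left_mono mult_pos_pos) (auto simp: add_pos_nonneg)
        also have "((2 ^ j)\<^sup>2)\<^sup>2 = (16 :: real) ^ j"
          by (simp add: power_mult[symmetric] mult.commute[of j] power_mult)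
        also have "1 / 16 ^ j = F k \<xi>" using k Suc by (simp add: F_def power_divide)
        finally show ?thesis .
      qed
      also have "F k \<xi> \<le> (\<Sum>k. F k \<xi>)"
      proof -
        have "(\<Sum>i\<in>{k}. F i \<xi>) \<le> (\<Sum>k. F k \<xi>)"
          using sumF[of \<xi>] by (intro sum_le_suminf) (auto simp: F_def)
        then show ?thesis by simp
      qed
      finally show ?thesis .
    qed
    then show "AE \<xi>::'a in lborel. norm (1 / (1 + (norm \<xi>)\<^sup>2)\<^sup>2) \<le> norm (\<Sum>k. F k \<xi>)"
      by (intro AE_I2) (auto intro: order_trans[OF _ abs_ge_self])
  qed
qed

text \<open>With w = sqrt (1 + |\<xi>|^2) and a = |g|, the quotient a / w is the product of w a and
  1 / w^2. The square of the first is integrable by H1, that of the second because n <= 3.\<close>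

lemma H1_integrable:
  fixes g :: "'a::euclidean_space \<Rightarrow> complex"
  assumes dim: "DIM('a) \<le> 3" and gm: "g \<in> borel_measurable borel"
    and g: "integrable lborel (\<lambda>\<xi>. (1 + (norm \<xi>)\<^sup>2) * (norm (g \<xi>))\<^sup>2)"
  shows "integrable lborel (\<lambda>\<xi>. norm (g \<xi>) / sqrt (1 + (norm \<xi>)\<^sup>2))"
proof (rule Bochner_Integration.integrable_bound)
  show "integrable lborel (\<lambda>\<xi>. (1 + (norm \<xi>)\<^sup>2) * (norm (g \<xi>))\<^sup>2 + 1 / (1 + (norm \<xi>)\<^sup>2)\<^sup>2)"
    using g integrable_bessel_weight[OF dim] by simp
  show "(\<lambda>\<xi>. norm (g \<xi>) / sqrt (1 + (norm \<xi>)\<^sup>2)) \<in> borel_measurable lborel" using gm by measurable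
  have "a / w \<le> w\<^sup>2 * a\<^sup>2 + 1 / (w\<^sup>2)\<^sup>2" if "a \<ge> 0" "w > 0" for a w :: real
  proof -
    have "2 * ((w * a) * (1 / w\<^sup>2)) \<le> (w * a)\<^sup>2 + (1 / w\<^sup>2)\<^sup>2" using sum_squares_bound[of "w * a" "1 / w\<^sup>2"] by (simp add: mult_ac)
    moreover have "(w * a) * (1 / w\<^sup>2) = a / w" using that by (simp add: power2_eq_square)
    moreover have "a / w \<ge> 0" using that by simp
    ultimately show ?thesis by (simp add: power_mult_distrib power_divide)
  qed
  from this[of "norm (g \<xi>)" "sqrt (1 + (norm \<xi>)\<^sup>2)" for \<xi>]
  show "AE \<xi> in lborel. norm (norm (g \<xi>) / sqrt (1 + (norm \<xi>)\<^sup>2))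
      \<le> norm ((1 + (norm \<xi>)\<^sup>2) * (norm (g \<xi>))\<^sup>2 + 1 / (1 + (norm \<xi>)\<^sup>2)\<^sup>2)"
    by (intro AE_I2) (simp add: add_pos_nonneg)
qed

text \<open>The weighted integrability of the Fourier transform controls the high frequencies; for
  \<open>n \<le> 3\<close> it follows from \<open>f \<in> H\<^sup>1\<close>.\<close>

lemma linear_error:
  fixes f :: "'a::euclidean_space \<Rightarrow> real"
  defines "M \<equiv> \<integral>x. f x \<partial>lborel"
  assumes dim: "DIM('a) \<le> 3" and f: "integrable lborel f"
    and F: "integrable lborel (\<lambda>\<xi>. norm (fourier_integral f \<xi>) / sqrt (1 + (norm \<xi>)\<^sup>2))" and q: "q > 0"
  obtains T where "T \<ge> 1" "\<And>t. t \<ge> T \<Longrightarrow>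
      integrable lborel (\<lambda>\<xi>. norm (of_real (K_hat t \<xi>) * fourier_integral f \<xi> - of_real (M * exp (- t * (norm \<xi>)\<^sup>2))))"
    "\<And>t. t \<ge> T \<Longrightarrow>
      (\<integral>\<xi>. norm (of_real (K_hat t \<xi>) * fourier_integral f \<xi> - of_real (M * exp (- t * (norm \<xi>)\<^sup>2))) \<partial>lborel)
        \<le> q / sqrt t ^ DIM('a)"
proof -
  let ?n = "DIM('a)" and ?F = "fourier_integral f"
  have fm [measurable]: "f \<in> borel_measurable borel" using borel_measurable_integrable[OF f] by simp
  note [measurable] = fourier_integral_measurable[OF fm]
  define A where "A = (\<integral>x. \<bar>f x\<bar> \<partial>lborel)"
  have A: "A \<ge> 0" by (simp add: A_def)
  have FA: "norm (?F \<xi>) \<le> A" for \<xi> unfolding A_def by (rule norm_fourier_integral_le[OF f])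
  have MA: "norm (complex_of_real M) \<le> A"
    unfolding A_def M_def norm_of_real using integral_norm_bound[of lborel f] by simp
  define B where "B = (\<integral>\<xi>. norm (?F \<xi>) / sqrt (1 + (norm \<xi>)\<^sup>2) \<partial>lborel)"
  define a1 where "a1 = sqrt pi ^ ?n"
  define a2 where "a2 = sqrt (2 * pi) ^ ?n"
  have a: "a1 > 0" "a2 > 0" by (auto simp: a1_def a2_def)
  \<comment> \<open>Half of the tolerance q goes to frequencies below \<delta>, where the transform
    is within \<eta> of M; a1 / sqrt t ^ n is the integral of the Gaussian there used as
    weight.\<close>
  define \<eta> where "\<eta> = q / (2 * a1)"
  have \<eta>: "\<eta> > 0" using q a by (simp add: \<eta>_def)
  from LIM_D[OF fourier_integral_L1_limit(2)[OF f] \<eta>] obtain \<delta> where \<delta>: "\<delta> > 0"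
    "\<And>\<xi>. \<xi> \<noteq> 0 \<Longrightarrow> norm \<xi> < \<delta> \<Longrightarrow> norm (?F \<xi> - of_real M) < \<eta>"
    by (auto simp: M_def)
  \<comment> \<open>The remaining errors multiplied by sqrt t ^ n. In the middle term t^2 replaces
    sqrt t ^ n, an upper bound because n <= 4 and t >= 1.\<close>
  define err where "err t = 64 * A * a2 / t + 64 * B * exp (- t / 64) * t\<^sup>2 + 2 * A * a2 * exp (- (\<delta>\<^sup>2 / 2) * t)" for t :: real
  have "\<delta>\<^sup>2 / 2 > 0" using \<delta> by simp
  then have "((\<lambda>t. exp (- (\<delta>\<^sup>2 / 2) * t)) \<longlongrightarrow> 0) at_top" by real_asymp
  moreover have "((\<lambda>t::real. exp (- t / 64) * t\<^sup>2) \<longlongrightarrow> 0) at_top" by real_asymp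
  moreover have "((\<lambda>t::real. 1 / t) \<longlongrightarrow> 0) at_top" by real_asymp
  ultimately have "((\<lambda>t. 64 * A * a2 * (1 / t) + 64 * B * (exp (- t / 64) * t\<^sup>2) + 2 * A * a2 * exp (- (\<delta>\<^sup>2 / 2) * t))
      \<longlongrightarrow> 64 * A * a2 * 0 + 64 * B * 0 + 2 * A * a2 * 0) at_top"
    by (intro tendsto_intros)
  then have "(err \<longlongrightarrow> 0) at_top" unfolding err_def[abs_def] by (simp add: mult.assoc)
  then have "\<forall>\<^sub>F t in at_top. err t < q / 2" using q by (intro order_tendstoD(2)[of _ 0]) auto
  then obtain T0 where T0: "\<And>t. t \<ge> T0 \<Longrightarrow> err t < q / 2" by (auto simp: eventually_at_top_linorder)
  define D where "D t \<xi> = of_real (K_hat t \<xi>) * ?F \<xi> - of_real (M * exp (- t * (norm \<xi>)\<^sup>2))" for t \<xi>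
  \<comment> \<open>The first two terms compare the symbol with the Gaussian; the last two compare
    the transform with its value M at 0, near 0 and away from it.\<close>
  define bnd where "bnd t \<xi> = 64 / t * A * exp (- (t / 2) * (norm \<xi>)\<^sup>2)
      + 64 * exp (- t / 64) * (norm (?F \<xi>) / sqrt (1 + (norm \<xi>)\<^sup>2))
      + (\<eta> * exp (- t * (norm \<xi>)\<^sup>2) + 2 * A * exp (- (\<delta>\<^sup>2 / 2) * t) * exp (- (t / 2) * (norm \<xi>)\<^sup>2))"
    for t :: real and \<xi> :: 'a
  have pt: "norm (D t \<xi>) \<le> bnd t \<xi>" if t: "t \<ge> 1" and \<xi>: "\<xi> \<noteq> 0" for t \<xi>
  proof -
    have "D t \<xi> = of_real (K_hat t \<xi> - exp (- t * (norm \<xi>)\<^sup>2)) * ?F \<xi> + of_real (exp (- t * (norm \<xi>)\<^sup>2)) * (?F \<xi> - of_real M)"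
      by (simp add: D_def algebra_simps)
    then have "norm (D t \<xi>) \<le> \<bar>K_hat t \<xi> - exp (- t * (norm \<xi>)\<^sup>2)\<bar> * norm (?F \<xi>) + exp (- t * (norm \<xi>)\<^sup>2) * norm (?F \<xi> - of_real M)"
      using norm_triangle_ineq by (metis abs_exp_cancel norm_mult norm_of_real)
    moreover have "\<bar>K_hat t \<xi> - exp (- t * (norm \<xi>)\<^sup>2)\<bar> * norm (?F \<xi>)
        \<le> 64 / t * A * exp (- (t / 2) * (norm \<xi>)\<^sup>2) + 64 * exp (- t / 64) * (norm (?F \<xi>) / sqrt (1 + (norm \<xi>)\<^sup>2))"
    proof -
      have "\<bar>K_hat t \<xi> - exp (- t * (norm \<xi>)\<^sup>2)\<bar> * norm (?F \<xi>)
          \<le> (64 / t * exp (- t * (norm \<xi>)\<^sup>2 / 2) + 64 * exp (- t / 64) / sqrt (1 + (norm \<xi>)\<^sup>2)) * norm (?F \<xi>)"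
        by (intro mult_right_mono K_hat_heat[OF t]) simp
      also have "\<dots> = 64 / t * exp (- t * (norm \<xi>)\<^sup>2 / 2) * norm (?F \<xi>) + 64 * exp (- t / 64) * (norm (?F \<xi>) / sqrt (1 + (norm \<xi>)\<^sup>2))"
        by (simp add: distrib_right)
      also have "64 / t * exp (- t * (norm \<xi>)\<^sup>2 / 2) * norm (?F \<xi>) \<le> 64 / t * exp (- t * (norm \<xi>)\<^sup>2 / 2) * A"
        using t by (intro mult_left_mono FA) auto
      finally show ?thesis by (simp add: mult_ac)
    qed
    moreover have "exp (- t * (norm \<xi>)\<^sup>2) * norm (?F \<xi> - of_real M)
        \<le> \<eta> * exp (- t * (norm \<xi>)\<^sup>2) + 2 * A * exp (- (\<delta>\<^sup>2 / 2) * t) * exp (- (t / 2) * (norm \<xi>)\<^sup>2)"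
    proof (cases "norm \<xi> < \<delta>")
      case True
      then have "exp (- t * (norm \<xi>)\<^sup>2) * norm (?F \<xi> - of_real M) \<le> exp (- t * (norm \<xi>)\<^sup>2) * \<eta>"
        using \<delta>(2)[OF \<xi>] by (intro mult_left_mono) auto
      also have "\<dots> = \<eta> * exp (- t * (norm \<xi>)\<^sup>2)" by (rule mult.commute)
      finally have "exp (- t * (norm \<xi>)\<^sup>2) * norm (?F \<xi> - of_real M) \<le> \<eta> * exp (- t * (norm \<xi>)\<^sup>2)" .
      moreover have "0 \<le> 2 * A * exp (- (\<delta>\<^sup>2 / 2) * t) * exp (- (t / 2) * (norm \<xi>)\<^sup>2)" using A by simp
      ultimately show ?thesis by linarith
    next
      case False
      then have "\<delta>\<^sup>2 \<le> (norm \<xi>)\<^sup>2" using \<delta>(1) by (intro power_mono) auto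
      then have "t * \<delta>\<^sup>2 \<le> t * (norm \<xi>)\<^sup>2" using t by (intro mult_left_mono) auto
      then have "exp (- t * (norm \<xi>)\<^sup>2) \<le> exp (- (\<delta>\<^sup>2 / 2) * t + - (t / 2) * (norm \<xi>)\<^sup>2)" by (simp add: algebra_simps)
      then have "exp (- t * (norm \<xi>)\<^sup>2) \<le> exp (- (\<delta>\<^sup>2 / 2) * t) * exp (- (t / 2) * (norm \<xi>)\<^sup>2)" by (simp only: exp_add)
      moreover have "norm (?F \<xi> - of_real M) \<le> 2 * A"
        using norm_triangle_ineq4[of "?F \<xi>" "of_real M"] FA[of \<xi>] MA by simp
      ultimately have "exp (- t * (norm \<xi>)\<^sup>2) * norm (?F \<xi> - of_real M)
          \<le> (exp (- (\<delta>\<^sup>2 / 2) * t) * exp (- (t / 2) * (norm \<xi>)\<^sup>2)) * (2 * A)"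
        by (intro mult_mono) auto
      also have "\<dots> = 2 * A * exp (- (\<delta>\<^sup>2 / 2) * t) * exp (- (t / 2) * (norm \<xi>)\<^sup>2)"
        by (simp only: mult_ac)
      finally have "exp (- t * (norm \<xi>)\<^sup>2) * norm (?F \<xi> - of_real M)
          \<le> 2 * A * exp (- (\<delta>\<^sup>2 / 2) * t) * exp (- (t / 2) * (norm \<xi>)\<^sup>2)" .
      moreover have "0 \<le> \<eta> * exp (- t * (norm \<xi>)\<^sup>2)" using \<eta> by simp
      ultimately show ?thesis by linarith
    qed
    ultimately show ?thesis unfolding bnd_def by linarith
  qed
  \<comment> \<open>The limit at 0 is a punctured one and does not cover \<xi> = 0, which is a null
    set.\<close>
  have AEn0: "AE \<xi>::'a in lborel. \<xi> \<noteq> 0" by (rule AE_lborel_singleton)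
  have ibnd: "integrable lborel (bnd t)" if t: "t \<ge> 1" for t
    unfolding bnd_def[abs_def] using t
    by (intro Bochner_Integration.integrable_add integrable_mult_right gaussian_integral(1) F) auto
  have iD: "integrable lborel (\<lambda>\<xi>. norm (D t \<xi>))" if t: "t \<ge> 1" for t
  proof (rule Bochner_Integration.integrable_bound[OF ibnd[OF t]])
    show "(\<lambda>\<xi>. norm (D t \<xi>)) \<in> borel_measurable lborel" unfolding D_def by measurable
    show "AE \<xi> in lborel. norm (norm (D t \<xi>)) \<le> norm (bnd t \<xi>)"
      using AEn0 by eventually_elim (use pt[OF t] in \<open>auto intro: order_trans[OF _ abs_ge_self]\<close>)
  qed
  have bound: "(\<integral>\<xi>. norm (D t \<xi>) \<partial>lborel) \<le> q / sqrt t ^ ?n" if t: "t \<ge> max 1 T0" for t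
  proof -
    have t1: "t \<ge> 1" "t > 0" using t by auto
    have g1: "sqrt (pi / t) ^ ?n = a1 / sqrt t ^ ?n" by (simp add: a1_def real_sqrt_divide power_divide)
    have g2: "sqrt (pi / (t / 2)) ^ ?n = a2 / sqrt t ^ ?n"
      unfolding a2_def by (simp add: real_sqrt_divide power_divide real_sqrt_mult mult.commute)
    have s: "sqrt t ^ ?n > 0" using t1 by simp
    have "(\<integral>\<xi>. norm (D t \<xi>) \<partial>lborel) \<le> (\<integral>\<xi>. bnd t \<xi> \<partial>lborel)"
    proof (rule integral_mono_AE[OF iD[OF t1(1)] ibnd[OF t1(1)]])
      show "AE \<xi> in lborel. norm (D t \<xi>) \<le> bnd t \<xi>"
        using AEn0 by eventually_elim (rule pt[OF t1(1)])
    qed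
    also have "\<dots> = 64 / t * A * (a2 / sqrt t ^ ?n) + 64 * exp (- t / 64) * B
        + (\<eta> * (a1 / sqrt t ^ ?n) + 2 * A * exp (- (\<delta>\<^sup>2 / 2) * t) * (a2 / sqrt t ^ ?n))"
    proof -
      have G1: "integrable lborel (\<lambda>\<xi>::'a. exp (- t * (norm \<xi>)\<^sup>2))" "(\<integral>\<xi>. exp (- t * (norm (\<xi>::'a))\<^sup>2) \<partial>lborel) = a1 / sqrt t ^ ?n"
        using gaussian_integral[OF t1(2), where 'a='a] unfolding g1 by auto
      have "t / 2 > 0" using t1 by simp
      then have G2: "integrable lborel (\<lambda>\<xi>::'a. exp (- (t / 2) * (norm \<xi>)\<^sup>2))" "(\<integral>\<xi>. exp (- (t / 2) * (norm (\<xi>::'a))\<^sup>2) \<partial>lborel) = a2 / sqrt t ^ ?n"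
        using gaussian_integral[of "t / 2", where 'a='a] unfolding g2 by auto
      have add4: "(\<integral>\<xi>. f1 \<xi> + f2 \<xi> + (f3 \<xi> + f4 \<xi>) \<partial>lborel) = (\<integral>\<xi>. f1 \<xi> \<partial>lborel) + (\<integral>\<xi>. f2 \<xi> \<partial>lborel) + ((\<integral>\<xi>. f3 \<xi> \<partial>lborel) + (\<integral>\<xi>. f4 \<xi> \<partial>lborel))"
        if "integrable lborel f1" "integrable lborel f2" "integrable lborel f3" "integrable lborel f4"
        for f1 f2 f3 f4 :: "'a \<Rightarrow> real"
        using that by simp
      show ?thesis
        unfolding bnd_def
        by (subst add4) (use G1 G2 F in \<open>simp_all only: integrable_mult_right integral_mult_right_zero B_def\<close>)
    qed
    also have "\<dots> \<le> (err t + \<eta> * a1) / sqrt t ^ ?n"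
    proof -
      have "sqrt t ^ ?n \<le> t\<^sup>2"
      proof -
        have "sqrt t ^ ?n \<le> sqrt t ^ 4" using dim t1 by (intro power_increasing) auto
        also have "\<dots> = (sqrt t ^ 2) ^ 2" by (simp flip: power_mult)
        also have "\<dots> = t\<^sup>2" using t1 by simp
        finally show ?thesis .
      qed
      moreover have "B \<ge> 0" unfolding B_def by (intro Bochner_Integration.integral_nonneg) auto
      ultimately have "64 * exp (- t / 64) * B * sqrt t ^ ?n \<le> 64 * exp (- t / 64) * B * t\<^sup>2"
        by (intro mult_left_mono) auto
      then have "64 * exp (- t / 64) * B \<le> 64 * B * exp (- t / 64) * t\<^sup>2 / sqrt t ^ ?n"
        using s by (simp add: le_divide_eq mult_ac)
      moreover have "(err t + \<eta> * a1) / sqrt t ^ ?n = 64 / t * A * (a2 / sqrt t ^ ?n)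
          + 64 * B * exp (- t / 64) * t\<^sup>2 / sqrt t ^ ?n
          + (\<eta> * (a1 / sqrt t ^ ?n) + 2 * A * exp (- (\<delta>\<^sup>2 / 2) * t) * (a2 / sqrt t ^ ?n))"
        by (simp add: err_def add_divide_distrib mult_ac)
      ultimately show ?thesis by linarith
    qed
    also have "\<dots> \<le> q / sqrt t ^ ?n"
    proof (rule divide_right_mono)
      have "\<eta> * a1 = q / 2" using a by (simp add: \<eta>_def)
      then show "err t + \<eta> * a1 \<le> q" using T0[of t] t by simp
    qed (use s in simp)
    finally show ?thesis .
  qed
  show thesis
    by (rule that[of "max 1 T0"]) (use iD bound in \<open>auto simp: D_def\<close>)
qed

text \<open>The main term is M times the heat kernel, of order t^(-n/2) on the ball of radius sqrt
  t. The error from \<open>linear_error\<close>, with half of the main constant as tolerance, is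
  tested against a transform of modulus at most vol E.\<close>

lemma linear_lower_bound:
  fixes f :: "'a::euclidean_space \<Rightarrow> real"
  assumes dim: "DIM('a) \<le> 3" and f: "integrable lborel f" "in_H1 f" and M: "(\<integral>x. f x \<partial>lborel) > 0"
  obtains c T where "c > 0" "T \<ge> 1"
    "\<And>t g E. t \<ge> T \<Longrightarrow> has_fourier f g \<Longrightarrow> E \<in> sets borel \<Longrightarrow> E \<subseteq> cball 0 (sqrt t)
      \<Longrightarrow> (2 * pi) ^ DIM('a) * (c / sqrt t ^ DIM('a) * vol E)
        \<le> Re (\<integral>\<xi>. of_real (K_hat t \<xi>) * (g \<xi> * cnj (fourier_integral (indicator E) \<xi>)) \<partial>lborel)"
proof -
  let ?n = "DIM('a)" and ?F = "fourier_integral f" and ?M = "\<integral>x. f x \<partial>lborel"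
  have fm [measurable]: "f \<in> borel_measurable borel" using borel_measurable_integrable[OF f(1)] by simp
  note [measurable] = fourier_integral_measurable[OF fm]
  obtain g0 where g0: "has_fourier f g0" "integrable lborel (\<lambda>\<xi>. (1 + (norm \<xi>)\<^sup>2) * (norm (g0 \<xi>))\<^sup>2)"
    using f(2) by (auto simp: in_H1_def)
  have [measurable]: "g0 \<in> borel_measurable borel" using g0(1) by (simp add: has_fourier_def square_integrable_def)
  have "integrable lborel (\<lambda>\<xi>. norm (g0 \<xi>) / sqrt (1 + (norm \<xi>)\<^sup>2))"
    by (rule H1_integrable[OF dim _ g0(2)]) measurable
  \<comment> \<open>\<open>in_H1\<close> speaks of some Plancherel transform; for an integrable
    function it agrees almost everywhere with the Fourier integral.\<close>
  then have F: "integrable lborel (\<lambda>\<xi>. norm (?F \<xi>) / sqrt (1 + (norm \<xi>)\<^sup>2))"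
    by (rule integrable_cong_AE_imp)
      (use has_fourier_integrable_AE[OF g0(1) f(1)] in \<open>auto elim!: eventually_mono\<close>)
  define P where "P = (2 * pi) ^ ?n"
  have P: "P > 0" by (simp add: P_def)
  define c where "c = ?M * sqrt pi ^ ?n * exp (- 2)"
  have c: "c > 0" using M by (simp add: c_def)
  obtain T where T: "T \<ge> 1" and iD: "\<And>t. t \<ge> T \<Longrightarrow>
      integrable lborel (\<lambda>\<xi>. norm (of_real (K_hat t \<xi>) * ?F \<xi> - of_real (?M * exp (- t * (norm \<xi>)\<^sup>2))))"
    and D: "\<And>t. t \<ge> T \<Longrightarrow>
      (\<integral>\<xi>. norm (of_real (K_hat t \<xi>) * ?F \<xi> - of_real (?M * exp (- t * (norm \<xi>)\<^sup>2))) \<partial>lborel) \<le> (c / 2) / sqrt t ^ ?n"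
    by (rule linear_error[OF dim f(1) F half_gt_zero[OF c]]) (rule that, assumption+)
  show thesis
  proof (rule that[of "c / 2 / P" T])
    show "c / 2 / P > 0" using c P by simp
    show "T \<ge> 1" by (rule T)
    fix t :: real and g :: "'a \<Rightarrow> complex" and E :: "'a set"
    assume t: "t \<ge> T" and hf: "has_fourier f g" and E: "E \<in> sets borel" "E \<subseteq> cball 0 (sqrt t)"
    have t1: "t \<ge> 1" "t > 0" using t T by auto
    note \<phi> = bounded_borel_indicator[OF E]
    let ?G = "fourier_integral (indicator E)"
    note [measurable] = E(1)
    have [measurable]: "?G \<in> borel_measurable borel" by (intro fourier_integral_measurable) measurable
    have [measurable]: "g \<in> borel_measurable borel" using hf by (simp add: has_fourier_def square_integrable_def)
    let ?e = "\<lambda>\<xi>::'a. exp (- t * (norm \<xi>)\<^sup>2)"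
    let ?J = "\<integral>\<xi>. of_real (K_hat t \<xi>) * (g \<xi> * cnj (?G \<xi>)) \<partial>lborel"
    let ?I = "\<integral>\<xi>. of_real (?M * ?e \<xi>) * cnj (?G \<xi>) \<partial>lborel"
    have "AE \<xi> in lborel. g \<xi> = ?F \<xi>" by (rule has_fourier_integrable_AE[OF hf f(1)])
    then have J: "?J = (\<integral>\<xi>. of_real (K_hat t \<xi>) * (?F \<xi> * cnj (?G \<xi>)) \<partial>lborel)"
      by (intro integral_cong_AE) (auto elim!: eventually_mono)
    have iG: "integrable lborel (\<lambda>\<xi>. of_real (m \<xi>) * (g \<xi> * cnj (?G \<xi>)))"
      if "m \<in> borel_measurable borel" "\<And>\<xi>. \<bar>m \<xi>\<bar> \<le> C" for m :: "'a \<Rightarrow> real" and C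
      using that hf plancherel(1)[OF \<phi>(1,2)]
      by (intro integrable_bounded_mult square_integrable_mult_cnj) (auto simp: has_fourier_def)
    have iK: "integrable lborel (\<lambda>\<xi>. of_real (K_hat t \<xi>) * (?F \<xi> * cnj (?G \<xi>)))"
    proof (rule integrable_cong_AE_imp)
      show "integrable lborel (\<lambda>\<xi>. of_real (K_hat t \<xi>) * (g \<xi> * cnj (?G \<xi>)))"
        using t1 by (intro iG[OF K_hat_measurable K_hat_bounded]) simp
      show "AE \<xi> in lborel. of_real (K_hat t \<xi>) * (g \<xi> * cnj (?G \<xi>)) = of_real (K_hat t \<xi>) * (?F \<xi> * cnj (?G \<xi>))"
        using \<open>AE \<xi> in lborel. g \<xi> = ?F \<xi>\<close> by eventually_elim simp
    qed measurable
    have ie: "integrable lborel (\<lambda>\<xi>. of_real (?M * ?e \<xi>) * cnj (?G \<xi>))"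
    proof (rule Bochner_Integration.integrable_bound)
      show "integrable lborel (\<lambda>\<xi>. ?M * vol E * ?e \<xi>)"
        by (intro integrable_mult_right gaussian_integral(1) t1)
      show "AE \<xi> in lborel. norm (of_real (?M * ?e \<xi>) * cnj (?G \<xi>)) \<le> norm (?M * vol E * ?e \<xi>)"
      proof (rule AE_I2)
        fix \<xi> :: 'a
        have "(?M * ?e \<xi>) * norm (?G \<xi>) \<le> (?M * ?e \<xi>) * vol E"
          using M by (intro mult_left_mono \<phi>(3)) auto
        then show "norm (of_real (?M * ?e \<xi>) * cnj (?G \<xi>)) \<le> norm (?M * vol E * ?e \<xi>)"
          using M by (simp add: norm_mult abs_mult mult_ac)
      qed
    qed measurable
    have "norm (?J - ?I) \<le> (c / 2) / sqrt t ^ ?n * vol E"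
    proof -
      let ?D = "\<lambda>\<xi>. of_real (K_hat t \<xi>) * ?F \<xi> - of_real (?M * ?e \<xi>)"
      have "?J - ?I = (\<integral>\<xi>. of_real (K_hat t \<xi>) * (?F \<xi> * cnj (?G \<xi>)) - of_real (?M * ?e \<xi>) * cnj (?G \<xi>) \<partial>lborel)"
        unfolding J by (rule Bochner_Integration.integral_diff[OF iK ie, symmetric])
      also have "norm \<dots> \<le> (\<integral>\<xi>. vol E * norm (?D \<xi>) \<partial>lborel)"
      proof (rule Bochner_Integration.integral_norm_bound_integral)
        show "integrable lborel (\<lambda>\<xi>. of_real (K_hat t \<xi>) * (?F \<xi> * cnj (?G \<xi>)) - of_real (?M * ?e \<xi>) * cnj (?G \<xi>))"
          by (rule Bochner_Integration.integrable_diff[OF iK ie])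
        show "integrable lborel (\<lambda>\<xi>. vol E * norm (?D \<xi>))"
          by (rule integrable_mult_right[OF iD[OF t]])
        fix \<xi> :: 'a
        have "of_real (K_hat t \<xi>) * (?F \<xi> * cnj (?G \<xi>)) - of_real (?M * ?e \<xi>) * cnj (?G \<xi>) = ?D \<xi> * cnj (?G \<xi>)"
          by (simp add: algebra_simps)
        then have "norm (of_real (K_hat t \<xi>) * (?F \<xi> * cnj (?G \<xi>)) - of_real (?M * ?e \<xi>) * cnj (?G \<xi>)) = norm (?D \<xi>) * norm (?G \<xi>)"
          by (simp only: norm_mult complex_mod_cnj)
        also have "\<dots> \<le> norm (?D \<xi>) * vol E" by (intro mult_left_mono \<phi>(3)) simp
        finally show "norm (of_real (K_hat t \<xi>) * (?F \<xi> * cnj (?G \<xi>)) - of_real (?M * ?e \<xi>) * cnj (?G \<xi>)) \<le> vol E * norm (?D \<xi>)"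
          by (simp only: mult.commute)
      qed
      also have "\<dots> = vol E * (\<integral>\<xi>. norm (?D \<xi>) \<partial>lborel)" by (rule integral_mult_right_zero)
      also have "\<dots> \<le> vol E * ((c / 2) / sqrt t ^ ?n)" by (intro mult_left_mono D t) simp
      finally show ?thesis by (simp only: mult.commute)
    qed
    then have 1: "Re ?I - (c / 2) / sqrt t ^ ?n * vol E \<le> Re ?J" by (rule Re_lower_of_norm)
    have 2: "c / sqrt t ^ ?n * vol E \<le> Re ?I"
    proof -
      have ig: "integrable lborel (\<lambda>\<xi>::'a. complex_of_real (?e \<xi>))"
        by (intro integrable_of_real gaussian_integral(1) t1)
      have "(\<integral>\<xi>. of_real (?e \<xi>) * ?G \<xi> \<partial>lborel) = (\<integral>x. of_real (indicator E x) * (\<integral>\<xi>. of_real (?e \<xi>) * cis (- (x \<bullet> \<xi>)) \<partial>lborel) \<partial>lborel)"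
        by (rule fourier_multiplication[OF \<phi>(1) ig])
      also have "\<dots> = (\<integral>x. complex_of_real (indicator E x * gauss_kernel t x) \<partial>lborel)"
      proof (intro Bochner_Integration.integral_cong refl)
        fix x :: 'a
        have "(\<integral>\<xi>. of_real (?e \<xi>) * cis (- (x \<bullet> \<xi>)) \<partial>lborel) = of_real (gauss_kernel t x)"
          using gaussian_fourier(2)[OF t1(2), of "- x"] by (simp add: gauss_kernel_def)
        then show "of_real (indicator E x) * (\<integral>\<xi>. of_real (?e \<xi>) * cis (- (x \<bullet> \<xi>)) \<partial>lborel) = complex_of_real (indicator E x * gauss_kernel t x)"
          by (simp only: of_real_mult)
      qed
      also have "\<dots> = of_real (\<integral>x. indicator E x * gauss_kernel t x \<partial>lborel)" by (rule integral_complex_of_real)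
      finally have eG: "cnj (\<integral>\<xi>. of_real (?e \<xi>) * ?G \<xi> \<partial>lborel) = of_real (\<integral>x. indicator E x * gauss_kernel t x \<partial>lborel)"
        by simp
      have "?I = of_real ?M * cnj (\<integral>\<xi>. of_real (?e \<xi>) * ?G \<xi> \<partial>lborel)"
        unfolding Bochner_Integration.integral_cnj[symmetric] integral_mult_right_zero[symmetric]
        by (intro Bochner_Integration.integral_cong refl) simp
      then have "Re ?I = ?M * (\<integral>x. indicator E x * gauss_kernel t x \<partial>lborel)"
        unfolding eG by simp
      moreover have "(\<integral>x. sqrt (pi / t) ^ ?n * exp (- 2) * indicator E x \<partial>lborel) \<le> (\<integral>x. indicator E x * gauss_kernel t x \<partial>lborel)"
      proof (rule integral_mono)
        show "integrable lborel (\<lambda>x. sqrt (pi / t) ^ ?n * exp (- 2) * indicator E x :: real)" using \<phi>(1) by simp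
        show "integrable lborel (\<lambda>x. indicator E x * gauss_kernel t x)"
          by (rule Bochner_Integration.integrable_bound[OF gauss_kernel_integral(1)[OF t1(2)]])
            (use E(1) in \<open>auto simp: indicator_def\<close>)
        fix x :: 'a
        show "sqrt (pi / t) ^ ?n * exp (- 2) * indicator E x \<le> indicator E x * gauss_kernel t x"
        proof (cases "x \<in> E")
          case True
          then have "norm x \<le> sqrt t" using E(2) by auto
          also have "\<dots> \<le> 3 / 2 * sqrt t" using t1 by simp
          finally show ?thesis using gauss_kernel_lower_bound[of t t x] True t1 by simp
        qed simp
      qed
      then have "?M * (sqrt (pi / t) ^ ?n * exp (- 2) * vol E) \<le> ?M * (\<integral>x. indicator E x * gauss_kernel t x \<partial>lborel)"
        using M by (intro mult_left_mono) auto
      moreover have "sqrt (pi / t) ^ ?n = sqrt pi ^ ?n / sqrt t ^ ?n" by (simp add: real_sqrt_divide power_divide)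
      then have "?M * (sqrt (pi / t) ^ ?n * exp (- 2) * vol E) = c / sqrt t ^ ?n * vol E"
        by (simp add: c_def)
      ultimately show ?thesis by linarith
    qed
    define X where "X = c / sqrt t ^ ?n * vol E"
    have X: "P * (c / 2 / P / sqrt t ^ ?n * vol E) = X / 2" "(c / 2) / sqrt t ^ ?n * vol E = X / 2"
      using P by (simp_all add: X_def)
    show "(2 * pi) ^ ?n * (c / 2 / P / sqrt t ^ ?n * vol E) \<le> Re ?J"
      using 1 2 unfolding P_def[symmetric] X X_def[symmetric] by linarith
  qed
qed

section \<open>Lower bounds for mild solutions and blow-up\<close>

text \<open>From here on multipliers are seen only through pairings with indicators of bounded Borel
  sets.\<close>

lemma multiplier_pairing:
  assumes m: "has_multiplier m f w" and E: "E \<in> sets borel" "E \<subseteq> cball (0::'a::euclidean_space) r"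
  obtains g where "has_fourier f g"
    "(2 * pi) ^ DIM('a) * inner w (L2_of (indicator E))
      = Re (\<integral>\<xi>. of_real (m \<xi>) * (g \<xi> * cnj (fourier_integral (indicator E) \<xi>)) \<partial>lborel)"
proof -
  note \<phi> = bounded_borel_indicator[OF E]
  obtain g where g: "has_fourier f g" "has_fourier (L2_fun w) (\<lambda>\<xi>. of_real (m \<xi>) * g \<xi>)"
    using m by (auto simp: has_multiplier_def)
  have "inner w (L2_of (indicator E)) = inner (L2_of (L2_fun w)) (L2_of (indicator E))" by simp
  also have "\<dots> = (\<integral>x. L2_fun w x * indicator E x \<partial>lborel)"
    by (intro inner_L2_of \<phi>) simp
  finally have "(2 * pi) ^ DIM('a) * inner w (L2_of (indicator E))
      = Re (\<integral>\<xi>. (of_real (m \<xi>) * g \<xi>) * cnj (fourier_integral (indicator E) \<xi>) \<partial>lborel)"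
    using has_fourier_imp_fourier_pair[OF g(2)] \<phi> unfolding fourier_pair_def by simp
  then show thesis using that g(1) by (simp add: mult.assoc)
qed

text \<open>Disposes of the part of the linear solution that carries the initial position, without
  any information on the symbol \<open>dt_K_hat\<close>.\<close>

lemma multiplier_0_pairing:
  assumes "has_multiplier m (\<lambda>x. 0) w" and E: "E \<in> sets borel" "E \<subseteq> cball (0::'a::euclidean_space) r"
  shows "inner w (L2_of (indicator E)) = 0"
proof -
  obtain g where g: "has_fourier (\<lambda>x::'a. 0) g" "(2 * pi) ^ DIM('a) * inner w (L2_of (indicator E))
      = Re (\<integral>\<xi>. of_real (m \<xi>) * (g \<xi> * cnj (fourier_integral (indicator E) \<xi>)) \<partial>lborel)"
    using multiplier_pairing[OF assms] by blast
  have "AE \<xi> in lborel. g \<xi> = fourier_integral (\<lambda>x. 0) \<xi>"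
    by (rule has_fourier_integrable_AE[OF g(1)]) simp
  then have "AE \<xi> in lborel. of_real (m \<xi>) * (g \<xi> * cnj (fourier_integral (indicator E) \<xi>)) = 0"
    by eventually_elim (simp add: fourier_integral_def)
  then have "(\<integral>\<xi>. of_real (m \<xi>) * (g \<xi> * cnj (fourier_integral (indicator E) \<xi>)) \<partial>lborel) = 0"
    by (rule integral_eq_zero_AE)
  then show ?thesis using g(2) by simp
qed

definition bounded_below_on :: "real \<Rightarrow> real \<Rightarrow> 'a::euclidean_space L2 \<Rightarrow> bool" where
  "bounded_below_on r m w \<longleftrightarrow> (AE x in lborel. x \<in> cball 0 r \<longrightarrow> m \<le> L2_fun w x)"

text \<open>The test set is the part of the ball where the bound fails: there m - w is positive and
  yet has integral at most 0.\<close>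

lemma bounded_below_onI:
  fixes w :: "'a::euclidean_space L2"
  assumes le: "\<And>E. E \<in> sets borel \<Longrightarrow> E \<subseteq> cball 0 r \<Longrightarrow> m * vol E \<le> inner w (L2_of (indicator E))"
  shows "bounded_below_on r m w"
proof -
  have [measurable]: "L2_fun w \<in> borel_measurable borel"
    using square_integrable_measurable[OF square_integrable_L2_fun[of w]] by simp
  define E where "E = {x \<in> space borel. x \<in> cball 0 r \<and> L2_fun w x < m}"
  have E: "E \<in> sets borel" "E \<subseteq> cball 0 r" unfolding E_def by (measurable, auto)
  note \<phi> = bounded_borel_indicator[OF E]
  have iw: "integrable lborel (\<lambda>x. L2_fun w x * indicator E x)"
    by (intro square_integrable_mult \<phi>) simp
  have "inner w (L2_of (indicator E)) = inner (L2_of (L2_fun w)) (L2_of (indicator E))" by simp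
  also have "\<dots> = (\<integral>x. L2_fun w x * indicator E x \<partial>lborel)" by (intro inner_L2_of \<phi>) simp
  finally have "m * vol E \<le> (\<integral>x. L2_fun w x * indicator E x \<partial>lborel)" using le[OF E] by simp
  moreover have "(\<integral>x. m * indicator E x - L2_fun w x * indicator E x \<partial>lborel)
      = m * vol E - (\<integral>x. L2_fun w x * indicator E x \<partial>lborel)"
    using \<phi>(1) iw by simp
  moreover have id: "integrable lborel (\<lambda>x. m * indicator E x - L2_fun w x * indicator E x)"
    using \<phi>(1) iw by simp
  moreover have nn: "AE x in lborel. 0 \<le> m * indicator E x - L2_fun w x * indicator E x"
    by (auto simp: E_def indicator_def)
  ultimately have "(\<integral>x. m * indicator E x - L2_fun w x * indicator E x \<partial>lborel) = 0"
    using integral_nonneg_AE[OF nn] by linarith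
  then have "AE x in lborel. m * indicator E x - L2_fun w x * indicator E x = 0"
    using integral_nonneg_eq_0_iff_AE[OF id nn] by simp
  then show ?thesis
    unfolding bounded_below_on_def by eventually_elim (auto simp: E_def indicator_def split: if_splits)
qed

lemma bounded_below_on_mono:
  "bounded_below_on r m w \<Longrightarrow> r' \<le> r \<Longrightarrow> m' \<le> m \<Longrightarrow> bounded_below_on r' m' w"
  unfolding bounded_below_on_def by (auto elim!: eventually_mono)

text \<open>The Bochner integral commutes with the inner product, and by positivity the times
  outside the window from a to b can be discarded.\<close>

lemma duhamel_pairing_lower_bound:
  fixes F :: "real \<Rightarrow> 'a::euclidean_space \<Rightarrow> real"
  assumes dim: "DIM('a) \<le> 3" and D: "duhamel_part F t D" and F: "\<And>s x. F s x \<ge> 0"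
    and E: "E \<in> sets borel" "E \<subseteq> cball 0 r" and ab: "0 \<le> a" "a \<le> b" "b \<le> t"
    and l: "\<And>s g. a \<le> s \<Longrightarrow> s \<le> b \<Longrightarrow> fourier_pair (F s) g \<Longrightarrow> (2 * pi) ^ DIM('a) * l
      \<le> Re (\<integral>\<xi>. of_real (K_hat (t - s) \<xi>) * (g \<xi> * cnj (fourier_integral (indicator E) \<xi>)) \<partial>lborel)"
  shows "(b - a) * l \<le> inner D (L2_of (indicator E))"
proof -
  note \<phi> = bounded_borel_indicator[OF E]
  let ?P = "(2 * pi) ^ DIM('a)" and ?e = "L2_of (indicator E) :: 'a L2"
  have P: "?P > 0" by simp
  obtain G where G: "AE s in lborel. s \<in> {0..t} \<longrightarrow> has_multiplier (K_hat (t - s)) (F s) (G s)"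
    "set_integrable lborel {0..t} G" "D = (LINT s:{0..t}|lborel. G s)"
    using D by (auto simp: duhamel_part_def)
  have "has_bochner_integral lborel (\<lambda>s. indicator {0..t} s *\<^sub>R G s) D"
    using G(2,3) unfolding set_integrable_def set_lebesgue_integral_def
    by (simp add: has_bochner_integral_integrable)
  then have hb: "has_bochner_integral lborel (\<lambda>s. inner (indicator {0..t} s *\<^sub>R G s) ?e) (inner D ?e)"
    by (rule has_bochner_integral_inner_left)
  have low: "AE s in lborel. indicator {a..b} s * l \<le> inner (indicator {0..t} s *\<^sub>R G s) ?e"
    using G(1)
  proof eventually_elim
    case (elim s)
    show ?case
    proof (cases "s \<in> {0..t}")
      case False
      then show ?thesis using ab by (auto simp: indicator_def)
    next
      case True
      then have s: "0 \<le> s" "s \<le> t" by auto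
      obtain g where g: "has_fourier (F s) g" "?P * inner (G s) ?e
          = Re (\<integral>\<xi>. of_real (K_hat (t - s) \<xi>) * (g \<xi> * cnj (fourier_integral (indicator E) \<xi>)) \<partial>lborel)"
        using multiplier_pairing[OF _ E] elim True by blast
      have fp: "fourier_pair (F s) g" by (rule has_fourier_imp_fourier_pair[OF g(1)])
      have "0 \<le> inner (G s) ?e"
      proof -
        have "0 \<le> (\<integral>x. F s x * indicator E (x + y) \<partial>lborel)" for y
          using F by (intro Bochner_Integration.integral_nonneg) auto
        from K_pairing_lower_bound[OF dim fp _ \<phi>(1,2) _ _ _ this, of "t - s" "t - s + 1"]
        have "?P * 0 \<le> ?P * inner (G s) ?e" using s F g(2) by simp
        then show ?thesis using P by (simp only: mult_le_cancel_left_pos)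
      qed
      moreover have "l \<le> inner (G s) ?e" if "s \<in> {a..b}"
      proof -
        have "?P * l \<le> ?P * inner (G s) ?e" unfolding g(2) using that by (intro l[OF _ _ fp]) auto
        then show ?thesis using P by (simp only: mult_le_cancel_left_pos)
      qed
      ultimately show ?thesis using True by (auto simp: indicator_def)
    qed
  qed
  have hi: "integrable lborel (\<lambda>s. inner (indicator {0..t} s *\<^sub>R G s) ?e)"
    "(\<integral>s. inner (indicator {0..t} s *\<^sub>R G s) ?e \<partial>lborel) = inner D ?e"
    using hb unfolding has_bochner_integral_iff by blast+
  have ii: "integrable lborel (\<lambda>s. indicator {a..b} s * l)"
    using ab by (intro integrable_mult_left) (simp add: integrable_indicator_iff emeasure_lborel_Icc_eq)
  have "(b - a) * l = (\<integral>s. indicator {a..b} s * l \<partial>lborel)" using ab by simp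
  also have "\<dots> \<le> inner D ?e" unfolding hi(2)[symmetric] by (rule integral_mono_AE[OF ii hi(1) low])
  finally show ?thesis .
qed

section \<open>Lower bounds from one application of Duhamel's formula\<close>

text \<open>The common form of both equations for vanishing initial positions. The nonlinearity is
  treated as a given force, so the coupling of the components is postponed.\<close>

definition forced_wave :: "('a::euclidean_space \<Rightarrow> real) \<Rightarrow> (real \<Rightarrow> 'a \<Rightarrow> real) \<Rightarrow> (real \<Rightarrow> 'a L2) \<Rightarrow> bool" where
  "forced_wave w1 F w \<longleftrightarrow>
    (\<forall>t\<ge>0. \<exists>wl D. linear_part (\<lambda>x. 0) w1 t wl \<and> duhamel_part F t D \<and> w t = wl + D)"

text \<open>Three independent sources of positivity: the linear part; forcing between t / 4 and t /
  2, which the heat flow has spread over the ball by time t; and forcing during the last \<tau>,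
  which finite speed keeps local.\<close>

lemma forced_wave_bounds:
  fixes w1 :: "'a::euclidean_space \<Rightarrow> real"
  assumes dim: "DIM('a) \<le> 3" and w1: "integrable lborel w1" "in_H1 w1" "(\<integral>x. w1 x \<partial>lborel) > 0"
    and w: "forced_wave w1 F w" and F: "\<And>s x. F s x \<ge> 0"
  obtains c T where "c > 0" "T \<ge> 1"
    "\<And>t. t \<ge> T \<Longrightarrow> bounded_below_on (sqrt t) (c / sqrt t ^ DIM('a)) (w t)"
    "\<And>t m. t \<ge> T \<Longrightarrow> m \<ge> 0 \<Longrightarrow>
      (\<And>s. t / 4 \<le> s \<Longrightarrow> s \<le> t / 2 \<Longrightarrow> AE x in lborel. x \<in> cball 0 (sqrt s) \<longrightarrow> m \<le> F s x) \<Longrightarrow>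
      bounded_below_on (sqrt t) (c * t * m) (w t)"
    "\<And>t m r \<tau>. t \<ge> T \<Longrightarrow> m \<ge> 0 \<Longrightarrow> 0 < \<tau> \<Longrightarrow> \<tau> \<le> 1 \<Longrightarrow> r \<le> sqrt t \<Longrightarrow>
      (\<And>s. t - \<tau> \<le> s \<Longrightarrow> s \<le> t \<Longrightarrow> AE x in lborel. x \<in> cball 0 r \<longrightarrow> m \<le> F s x) \<Longrightarrow>
      bounded_below_on (r - 2 * \<tau>) (\<tau>\<^sup>2 / 8 * m) (w t)"
proof -
  let ?P = "(2 * pi) ^ DIM('a)"
  have P: "?P > 0" by simp
  obtain c0 T0 where c0: "c0 > 0" "T0 \<ge> 1" and heat:
    "\<And>t \<tau> m (f :: 'a \<Rightarrow> real) g E. t \<ge> T0 \<Longrightarrow> t / 2 \<le> \<tau> \<Longrightarrow> \<tau> \<le> t \<Longrightarrow> fourier_pair f g \<Longrightarrow> m \<ge> 0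
      \<Longrightarrow> AE x in lborel. m * indicator (cball 0 (sqrt t / 2)) x \<le> f x
      \<Longrightarrow> E \<in> sets borel \<Longrightarrow> E \<subseteq> cball 0 (sqrt t)
      \<Longrightarrow> ?P * (m * c0 * vol E)
        \<le> Re (\<integral>\<xi>. of_real (K_hat \<tau> \<xi>) * (g \<xi> * cnj (fourier_integral (indicator E) \<xi>)) \<partial>lborel)"
    by (rule heat_spreading[OF dim]) (rule that, assumption+)
  obtain c1 T1 where c1: "c1 > 0" "T1 \<ge> 1" and lin:
    "\<And>t g E. t \<ge> T1 \<Longrightarrow> has_fourier w1 g \<Longrightarrow> E \<in> sets borel \<Longrightarrow> E \<subseteq> cball 0 (sqrt t)
      \<Longrightarrow> ?P * (c1 / sqrt t ^ DIM('a) * vol E)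
        \<le> Re (\<integral>\<xi>. of_real (K_hat t \<xi>) * (g \<xi> * cnj (fourier_integral (indicator E) \<xi>)) \<partial>lborel)"
    by (rule linear_lower_bound[OF dim w1]) (rule that, assumption+)
  define T where "T = max T0 T1"
  define c where "c = min c1 (c0 / 4)"
  have T: "T \<ge> T0" "T \<ge> T1" "T \<ge> 1" using c0 c1 by (auto simp: T_def)
  have c: "c > 0" "c \<le> c1" "c \<le> c0 / 4" using c0 c1 by (auto simp: c_def)
  have pairing: "c1 / sqrt t ^ DIM('a) * vol E + (b - a) * l \<le> inner (w t) (L2_of (indicator E))"
    if t: "t \<ge> T" and E: "E \<in> sets borel" "E \<subseteq> cball 0 (sqrt t)" and ab: "0 \<le> a" "a \<le> b" "b \<le> t"
      and l: "\<And>s g. a \<le> s \<Longrightarrow> s \<le> b \<Longrightarrow> fourier_pair (F s) g \<Longrightarrow> ?P * l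
        \<le> Re (\<integral>\<xi>. of_real (K_hat (t - s) \<xi>) * (g \<xi> * cnj (fourier_integral (indicator E) \<xi>)) \<partial>lborel)"
    for t a b l and E :: "'a set"
  proof -
    have "t \<ge> 0" using t T by simp
    then obtain wl D where wl: "linear_part (\<lambda>x. 0) w1 t wl" and D: "duhamel_part F t D" and wt: "w t = wl + D"
      using w by (auto simp: forced_wave_def)
    obtain wa wb where wab: "has_multiplier (\<lambda>\<xi>. K_hat t \<xi> + dt_K_hat t \<xi>) (\<lambda>x. 0) wa"
      "has_multiplier (K_hat t) w1 wb" "wl = wa + wb"
      using wl by (auto simp: linear_part_def)
    obtain g where g: "has_fourier w1 g" "?P * inner wb (L2_of (indicator E))
        = Re (\<integral>\<xi>. of_real (K_hat t \<xi>) * (g \<xi> * cnj (fourier_integral (indicator E) \<xi>)) \<partial>lborel)"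
      using multiplier_pairing[OF wab(2) E] by blast
    have "?P * (c1 / sqrt t ^ DIM('a) * vol E) \<le> ?P * inner wb (L2_of (indicator E))"
      unfolding g(2) using t T by (intro lin[OF _ g(1) E]) simp
    then have "c1 / sqrt t ^ DIM('a) * vol E \<le> inner wb (L2_of (indicator E))"
      using P by (simp only: mult_le_cancel_left_pos)
    moreover have "inner wa (L2_of (indicator E)) = 0" by (rule multiplier_0_pairing[OF wab(1) E])
    moreover have "(b - a) * l \<le> inner D (L2_of (indicator E))"
      by (rule duhamel_pairing_lower_bound[OF dim D F E ab l])
    ultimately show ?thesis by (simp add: wt wab(3) inner_add_left)
  qed
  have lin0: "c1 / sqrt t ^ DIM('a) * vol E \<ge> 0" if "t \<ge> T" for t and E :: "'a set"
    using c1 that T by simp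
  show thesis
  proof (rule that[OF c(1) T(3)])
    fix t assume t: "t \<ge> T"
    show "bounded_below_on (sqrt t) (c / sqrt t ^ DIM('a)) (w t)"
    proof (rule bounded_below_onI)
      fix E :: "'a set" assume E: "E \<in> sets borel" "E \<subseteq> cball 0 (sqrt t)"
      note \<phi> = bounded_borel_indicator[OF E]
      have l: "?P * 0 \<le> Re (\<integral>\<xi>. of_real (K_hat (t - s) \<xi>) * (g \<xi> * cnj (fourier_integral (indicator E) \<xi>)) \<partial>lborel)"
        if "s \<le> 0" "fourier_pair (F s) g" for s g
      proof -
        have "0 \<le> (\<integral>x. F s x * indicator E (x + y) \<partial>lborel)" for y
          using F by (intro Bochner_Integration.integral_nonneg) auto
        from K_pairing_lower_bound[OF dim that(2) _ \<phi>(1,2) _ _ _ this, of "t - s" "t - s + 1"]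
        show ?thesis using F that t T by simp
      qed
      \<comment> \<open>A window of length 0: from Duhamel's term only its nonnegativity is
        used.\<close>
      have "c1 / sqrt t ^ DIM('a) * vol E + (0 - 0) * 0 \<le> inner (w t) (L2_of (indicator E))"
        by (rule pairing[OF t E]) (rule l | use t T in simp)+
      then have "c1 / sqrt t ^ DIM('a) * vol E \<le> inner (w t) (L2_of (indicator E))" by simp
      moreover have "c / sqrt t ^ DIM('a) * vol E \<le> c1 / sqrt t ^ DIM('a) * vol E"
        using c t T by (intro mult_right_mono divide_right_mono) auto
      ultimately show "c / sqrt t ^ DIM('a) * vol E \<le> inner (w t) (L2_of (indicator E))" by linarith
    qed
  next
    fix t m assume t: "t \<ge> T" and m: "m \<ge> 0"
      and Fm: "\<And>s. t / 4 \<le> s \<Longrightarrow> s \<le> t / 2 \<Longrightarrow> AE x in lborel. x \<in> cball 0 (sqrt s) \<longrightarrow> m \<le> F s x"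
    have t0: "t > 0" using t T by simp
    show "bounded_below_on (sqrt t) (c * t * m) (w t)"
    proof (rule bounded_below_onI)
      fix E :: "'a set" assume E: "E \<in> sets borel" "E \<subseteq> cball 0 (sqrt t)"
      \<comment> \<open>For these s the elapsed time t - s lies between t / 2 and t, and sqrt s >=
        sqrt t / 2, as \<open>heat\<close> requires. The window has length t / 4, whence c0 / 4 in
        the definition of \<open>c\<close>.\<close>
      have l: "?P * (m * c0 * vol E) \<le> Re (\<integral>\<xi>. of_real (K_hat (t - s) \<xi>) * (g \<xi> * cnj (fourier_integral (indicator E) \<xi>)) \<partial>lborel)"
        if s: "t / 4 \<le> s" "s \<le> t / 2" and fp: "fourier_pair (F s) g" for s g
      proof (rule heat[OF _ _ _ fp m _ E])
        have "sqrt (t / 4) \<le> sqrt s" using s by simp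
        then have st: "sqrt t / 2 \<le> sqrt s" by (simp add: real_sqrt_divide)
        show "AE x in lborel. m * indicator (cball 0 (sqrt t / 2)) x \<le> F s x"
          using Fm[OF s] by eventually_elim (use st F in \<open>auto simp: indicator_def\<close>)
      qed (use s t T t0 in auto)
      have "c1 / sqrt t ^ DIM('a) * vol E + (t / 2 - t / 4) * (m * c0 * vol E) \<le> inner (w t) (L2_of (indicator E))"
        by (rule pairing[OF t E]) (rule l | use t0 in simp)+
      have "c * (t * m * vol E) \<le> c0 / 4 * (t * m * vol E)"
        using c m t0 by (intro mult_right_mono) auto
      show "c * t * m * vol E \<le> inner (w t) (L2_of (indicator E))"
      proof -
        have "(t / 2 - t / 4) * (m * c0 * vol E) = c0 / 4 * (t * m * vol E)" by (simp add: field_simps)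
        moreover have "c * t * m * vol E = c * (t * m * vol E)" by simp
        ultimately show ?thesis
          using lin0[OF t, of E] \<open>c * (t * m * vol E) \<le> c0 / 4 * (t * m * vol E)\<close>
            \<open>c1 / sqrt t ^ DIM('a) * vol E + (t / 2 - t / 4) * (m * c0 * vol E) \<le> inner (w t) (L2_of (indicator E))\<close>
          by linarith
      qed
    qed
  next
    fix t m r \<tau> assume t: "t \<ge> T" and m: "m \<ge> 0" and \<tau>: "0 < \<tau>" "\<tau> \<le> 1" and r: "r \<le> sqrt t"
      and Fm: "\<And>s. t - \<tau> \<le> s \<Longrightarrow> s \<le> t \<Longrightarrow> AE x in lborel. x \<in> cball 0 r \<longrightarrow> m \<le> F s x"
    have t1: "t \<ge> 1" using t T by simp
    show "bounded_below_on (r - 2 * \<tau>) (\<tau>\<^sup>2 / 8 * m) (w t)"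
    proof (rule bounded_below_onI)
      fix E :: "'a set" assume E: "E \<in> sets borel" "E \<subseteq> cball 0 (r - 2 * \<tau>)"
      have Et: "E \<subseteq> cball 0 (sqrt t)" using E(2) r \<tau> by auto
      note \<phi> = bounded_borel_indicator[OF E]
      \<comment> \<open>Stopping at t - \<tau> / 2 keeps the elapsed time at least \<tau> / 2, so
        exp (- (t - s) / 2) * (t - s) is at least \<tau> / 4. The window of length \<tau> / 2 then
        yields \<tau>^2 / 8.\<close>
      have l: "?P * (\<tau> / 4 * (m * vol E)) \<le> Re (\<integral>\<xi>. of_real (K_hat (t - s) \<xi>) * (g \<xi> * cnj (fourier_integral (indicator E) \<xi>)) \<partial>lborel)"
        if s: "t - \<tau> \<le> s" "s \<le> t - \<tau> / 2" and fp: "fourier_pair (F s) g" for s g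
      proof -
        have st: "s \<le> t" using s \<tau> by simp
        \<comment> \<open>The elapsed time is at most \<tau>; shifts up to 2 \<tau> provide the
          strict inequality that \<open>K_pairing_lower_bound\<close> asks for. Hence the loss 2
          \<tau> in the radius.\<close>
        have M: "m * vol E \<le> (\<integral>x. F s x * indicator E (x + y) \<partial>lborel)" if y: "norm y \<le> 2 * \<tau>" for y
        proof -
          have sq: "square_integrable (F s)" using fp by (simp add: fourier_pair_def)
          have sqE: "square_integrable (\<lambda>x. indicator E (x + y) :: real)"
            using square_integrable_translate[OF \<phi>(2), of "- y"] by simp
          have Em: "(indicator E :: 'a \<Rightarrow> real) \<in> borel_measurable borel" using E(1) by simp
          have "m * vol E = (\<integral>x. m * indicator E (x - (- y)) \<partial>lborel)"
            using lborel_translate(2)[OF Em, of "- y"] by simp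
          also have "\<dots> \<le> (\<integral>x. F s x * indicator E (x + y) \<partial>lborel)"
          proof (rule integral_mono_AE)
            show "integrable lborel (\<lambda>x. m * indicator E (x - (- y)) :: real)"
              using lborel_translate(1)[OF Em, of "- y"] \<phi>(1) by simp
            show "integrable lborel (\<lambda>x. F s x * indicator E (x + y))"
              by (rule square_integrable_mult[OF sq sqE])
            show "AE x in lborel. m * indicator E (x - (- y)) \<le> F s x * indicator E (x + y)"
              using Fm[OF s(1) st]
            proof eventually_elim
              case (elim x)
              show ?case
              proof (cases "x + y \<in> E")
                case True
                then have "norm (x + y) \<le> r - 2 * \<tau>" using E(2) by auto
                then have "norm x \<le> r" using norm_triangle_ineq4[of "x + y" y] y by simp
                then show ?thesis using elim True by simp
              qed simp
            qed
          qed
          finally show ?thesis .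
        qed
        have "\<tau> / 4 \<le> exp (- (t - s) / 2) * (t - s)"
        proof -
          have "1 / 2 * (\<tau> / 2) \<le> exp (- (t - s) / 2) * (t - s)"
          proof (intro mult_mono)
            have "t - s \<le> 1" using s \<tau> by linarith
            then have "1 / 2 \<le> 1 + - (t - s) / 2" by (simp add: field_simps)
            also have "\<dots> \<le> exp (- (t - s) / 2)" by (rule exp_ge_add_one_self)
            finally show "1 / 2 \<le> exp (- (t - s) / 2)" .
          qed (use s \<tau> in auto)
          then show ?thesis by simp
        qed
        then have "\<tau> / 4 * (m * vol E) \<le> (exp (- (t - s) / 2) * (t - s)) * (m * vol E)"
          using m by (intro mult_right_mono) auto
        then have "?P * (\<tau> / 4 * (m * vol E)) \<le> ?P * (exp (- (t - s) / 2) * (t - s) * (m * vol E))"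
          using P by (intro mult_left_mono) auto
        also have "\<dots> \<le> Re (\<integral>\<xi>. of_real (K_hat (t - s) \<xi>) * (g \<xi> * cnj (fourier_integral (indicator E) \<xi>)) \<partial>lborel)"
          using s \<tau> F by (intro K_pairing_lower_bound[OF dim fp _ \<phi>(1,2) _ _ _ M]) auto
        finally show ?thesis .
      qed
      have "c1 / sqrt t ^ DIM('a) * vol E + ((t - \<tau> / 2) - (t - \<tau>)) * (\<tau> / 4 * (m * vol E)) \<le> inner (w t) (L2_of (indicator E))"
        by (rule pairing[OF t E(1) Et]) (rule l | use t1 \<tau> in simp)+
      moreover have "((t - \<tau> / 2) - (t - \<tau>)) * (\<tau> / 4 * (m * vol E)) = \<tau>\<^sup>2 / 8 * m * vol E"
        by (simp add: field_simps power2_eq_square)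
      ultimately show "\<tau>\<^sup>2 / 8 * m * vol E \<le> inner (w t) (L2_of (indicator E))"
        using lin0[OF t, of E] by linarith
    qed
  qed
qed

section \<open>Iteration of the decay exponents\<close>

text \<open>A limit (A, B) of the decreasing iteration would satisfy (1 - \<alpha>) A <= p B - 1 and
  (1 - \<beta>) B <= q A - 1. With \<Delta> = p q - (1 - \<alpha>) (1 - \<beta>), elimination gives
  \<Delta> A >= 1 + p - \<beta> and \<Delta> B >= 1 + q - \<alpha>, which contradicts A, B <=
  N.\<close>

lemma exponent_iteration:
  fixes Inv :: "real \<Rightarrow> real \<Rightarrow> bool" and \<alpha> \<beta> p q N :: real
  assumes \<alpha>: "0 \<le> \<alpha>" "\<alpha> < 1" and \<beta>: "0 \<le> \<beta>" "\<beta> < 1" and p: "p > 0" "p + \<alpha> > 1" and q: "q > 0" "q + \<beta> > 1"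
    and N: "N < (1 + max (q - \<alpha>) (p - \<beta>)) / (p * q - (1 - \<alpha>) * (1 - \<beta>))"
    and init: "Inv N N"
    and step: "\<And>a b. Inv a b \<Longrightarrow> Inv (min a (\<alpha> * a + p * b - 1)) (min b (q * a + \<beta> * b - 1))"
  shows "\<exists>a b. a < 0 \<and> b < 0 \<and> Inv a b"
proof (rule ccontr)
  assume neg: "\<not> ?thesis"
  define z where "z = rec_nat (N, N) (\<lambda>_ (a, b). (min a (\<alpha> * a + p * b - 1), min b (q * a + \<beta> * b - 1)))"
  define a where "a k = fst (z k)" for k
  define b where "b k = snd (z k)" for k
  have a0: "a 0 = N" and b0: "b 0 = N" by (simp_all add: a_def b_def z_def)
  have aS: "a (Suc k) = min (a k) (\<alpha> * a k + p * b k - 1)" and bS: "b (Suc k) = min (b k) (q * a k + \<beta> * b k - 1)" for k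
    by (simp_all add: a_def b_def z_def case_prod_unfold)
  have Inv: "Inv (a k) (b k)" for k
    by (induction k) (use init step in \<open>auto simp: a0 b0 aS bS\<close>)
  have da: "decseq a" and db: "decseq b" by (auto simp: decseq_Suc_iff aS bS)
  have aN: "a k \<le> N" and bN: "b k \<le> N" for k
    using decseqD[OF da, of 0 k] decseqD[OF db, of 0 k] by (auto simp: a0 b0)
  have ale: "a (Suc k) \<le> \<alpha> * a k + p * b k - 1" and ble: "b (Suc k) \<le> q * a k + \<beta> * b k - 1" for k
    by (simp_all add: aS bS)
  \<comment> \<open>Both sequences decrease, so if each became negative at some index, they would be
    negative together at the larger one.\<close>
  have "(\<forall>k. a k \<ge> 0) \<or> (\<forall>k. b k \<ge> 0)"
  proof (rule ccontr)
    assume "\<not> ?thesis"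
    then obtain i j where ij: "a i < 0" "b j < 0" by (auto simp: not_le)
    then have "a (max i j) < 0" "b (max i j) < 0"
      using decseqD[OF da, of i "max i j"] decseqD[OF db, of j "max i j"] by auto
    then show False using neg Inv by blast
  qed
  \<comment> \<open>If one sequence stays nonnegative, its update forces a lower bound on the other,
    which enters with a positive coefficient.\<close>
  then have "\<exists>L. \<forall>k. L \<le> a k \<and> L \<le> b k"
  proof
    assume *: "\<forall>k. a k \<ge> 0"
    have "(1 - \<alpha> * N) / p \<le> b k" for k
    proof -
      have "\<alpha> * a k \<le> \<alpha> * N" using \<alpha> aN by (intro mult_left_mono) auto
      then have "1 - \<alpha> * N \<le> p * b k" using ale[of k] *[rule_format, of "Suc k"] by linarith
      then show ?thesis using p by (simp add: divide_le_eq mult.commute)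
    qed
    then show ?thesis using * by (intro exI[of _ "min 0 ((1 - \<alpha> * N) / p)"]) (auto simp: min_le_iff_disj)
  next
    assume *: "\<forall>k. b k \<ge> 0"
    have "(1 - \<beta> * N) / q \<le> a k" for k
    proof -
      have "\<beta> * b k \<le> \<beta> * N" using \<beta> bN by (intro mult_left_mono) auto
      then have "1 - \<beta> * N \<le> q * a k" using ble[of k] *[rule_format, of "Suc k"] by linarith
      then show ?thesis using q by (simp add: divide_le_eq mult.commute)
    qed
    then show ?thesis using * by (intro exI[of _ "min 0 ((1 - \<beta> * N) / q)"]) (auto simp: min_le_iff_disj)
  qed
  then obtain L where L: "\<And>k. L \<le> a k" "\<And>k. L \<le> b k" by blast
  have "\<forall>k. L \<le> a k" "\<forall>k. L \<le> b k" using L by auto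
  then obtain A B where A: "a \<longlonglongrightarrow> A" and B: "b \<longlonglongrightarrow> B"
    using decseq_convergent[OF da] decseq_convergent[OF db] by meson
  have AN: "A \<le> N" by (rule LIMSEQ_le_const2[OF A]) (use aN in blast)
  have BN: "B \<le> N" by (rule LIMSEQ_le_const2[OF B]) (use bN in blast)
  have "(\<lambda>k. \<alpha> * a k + p * b k - 1) \<longlonglongrightarrow> \<alpha> * A + p * B - 1" by (intro tendsto_intros A B)
  from LIMSEQ_le[OF LIMSEQ_Suc[OF A] this] have eqA: "A \<le> \<alpha> * A + p * B - 1" using ale by blast
  have "(\<lambda>k. q * a k + \<beta> * b k - 1) \<longlonglongrightarrow> q * A + \<beta> * B - 1" by (intro tendsto_intros A B)
  from LIMSEQ_le[OF LIMSEQ_Suc[OF B] this] have eqB: "B \<le> q * A + \<beta> * B - 1" using ble by blast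
  define \<Delta> where "\<Delta> = p * q - (1 - \<alpha>) * (1 - \<beta>)"
  have "(1 - \<alpha>) * (1 - \<beta>) < p * q" using \<alpha> \<beta> p q by (intro mult_strict_mono) auto
  then have \<Delta>: "\<Delta> > 0" by (simp add: \<Delta>_def)
  have 1: "p * ((1 - \<beta>) * B) \<le> p * (q * A - 1)" using eqB p by (intro mult_left_mono) (auto simp: algebra_simps)
  have 2: "(1 - \<beta>) * ((1 - \<alpha>) * A) \<le> (1 - \<beta>) * (p * B - 1)" using eqA \<beta> by (intro mult_left_mono) (auto simp: algebra_simps)
  have 3: "q * ((1 - \<alpha>) * A) \<le> q * (p * B - 1)" using eqA q by (intro mult_left_mono) (auto simp: algebra_simps)
  have 4: "(1 - \<alpha>) * ((1 - \<beta>) * B) \<le> (1 - \<alpha>) * (q * A - 1)" using eqB \<alpha> by (intro mult_left_mono) (auto simp: algebra_simps)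
  have "1 + (p - \<beta>) \<le> \<Delta> * A" using 1 2 by (simp add: \<Delta>_def algebra_simps)
  also have "\<dots> \<le> \<Delta> * N" using AN \<Delta> by simp
  finally have 5: "1 + (p - \<beta>) \<le> \<Delta> * N" .
  have "1 + (q - \<alpha>) \<le> \<Delta> * B" using 3 4 by (simp add: \<Delta>_def algebra_simps)
  also have "\<dots> \<le> \<Delta> * N" using BN \<Delta> by simp
  finally have "1 + max (q - \<alpha>) (p - \<beta>) \<le> \<Delta> * N" using 5 by simp
  then show False using N \<Delta> by (simp add: \<Delta>_def[symmetric] less_divide_eq mult.commute)
qed

section \<open>Blow-up from a large constant\<close>

text \<open>Halving the time step costs a factor 4 in \<tau>^2, but the power \<sigma> > 1 outweighs
  this once M is large: the lower bound grows geometrically while the total time stays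
  finite.\<close>

lemma blow_up:
  fixes u v :: "real \<Rightarrow> 'a::euclidean_space L2"
  assumes \<sigma>: "\<sigma> > 1" and T: "T \<ge> 9"
    and M: "M \<ge> 1" "M powr (\<sigma> - 1) \<ge> 32 * 4 powr (1 / (\<sigma> - 1))"
    and init: "\<And>t. t \<ge> T \<Longrightarrow> bounded_below_on 3 M (u t) \<and> bounded_below_on 3 M (v t)"
    and step: "\<And>t m r \<tau>. t \<ge> T \<Longrightarrow> m \<ge> 1 \<Longrightarrow> 0 < \<tau> \<Longrightarrow> \<tau> \<le> 1 \<Longrightarrow> r \<le> sqrt t \<Longrightarrow>
      (\<And>s. t - \<tau> \<le> s \<Longrightarrow> s \<le> t \<Longrightarrow> bounded_below_on r m (u s) \<and> bounded_below_on r m (v s)) \<Longrightarrow>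
      bounded_below_on (r - 2 * \<tau>) (\<tau>\<^sup>2 / 8 * m powr \<sigma>) (u t) \<and>
      bounded_below_on (r - 2 * \<tau>) (\<tau>\<^sup>2 / 8 * m powr \<sigma>) (v t)"
  shows False
proof -
  \<comment> \<open>A^(\<sigma> - 1) = 4 compensates the factor 4^-k of \<tau>^2. The hypothesis on
    M reads M^(\<sigma> - 1) >= 32 A, where 32 = 4 * 8 comes from \<tau>^2 / 8 with \<tau> = 2^-k /
    2.\<close>
  define A where "A = 4 powr (1 / (\<sigma> - 1))"
  have A: "A > 1" unfolding A_def using \<sigma> by simp
  have A4: "A powr (\<sigma> - 1) = 4" unfolding A_def using \<sigma> by (simp add: powr_powr)
  define m where "m k = M * A ^ k" for k
  have m1: "m k \<ge> 1" for k
  proof -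
    have "1 * 1 \<le> M * A ^ k" using M(1) A by (intro mult_mono) (auto intro: one_le_power)
    then show ?thesis by (simp add: m_def)
  qed
  have mS: "m (Suc k) \<le> ((1 / 2) ^ k / 2)\<^sup>2 / 8 * m k powr \<sigma>" for k
  proof -
    have mk: "m k > 0" using m1[of k] by simp
    have "m k powr \<sigma> = m k powr 1 * m k powr (\<sigma> - 1)"
      unfolding powr_add[symmetric] by simp
    also have "\<dots> = m k * (M powr (\<sigma> - 1) * (A ^ k) powr (\<sigma> - 1))"
      using mk M A by (simp add: m_def powr_mult)
    also have "(A ^ k) powr (\<sigma> - 1) = (A powr (\<sigma> - 1)) ^ k"
      using A by (simp add: powr_powr mult.commute flip: powr_realpow)
    finally have mp: "m k powr \<sigma> = m k * (M powr (\<sigma> - 1) * 4 ^ k)" by (simp add: A4)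
    have h: "((1 / 2) ^ k / 2)\<^sup>2 / 8 * (4::real) ^ k = 1 / 32"
    proof -
      have "((1 / 2 :: real) ^ k)\<^sup>2 = (1 / 4) ^ k"
        by (simp add: power_mult[symmetric] mult.commute[of k] power_mult power_divide)
      then show ?thesis by (simp add: power_divide)
    qed
    have "((1 / 2) ^ k / 2)\<^sup>2 / 8 * m k powr \<sigma> = m k * M powr (\<sigma> - 1) * (((1 / 2) ^ k / 2)\<^sup>2 / 8 * 4 ^ k)"
      unfolding mp by (simp only: mult_ac)
    then have "((1 / 2) ^ k / 2)\<^sup>2 / 8 * m k powr \<sigma> = m k * M powr (\<sigma> - 1) * (1 / 32)"
      unfolding h .
    moreover have "m k * (32 * A) * (1 / 32) \<le> m k * M powr (\<sigma> - 1) * (1 / 32)"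
      using M(2) mk by (intro mult_right_mono mult_left_mono) (auto simp: A_def)
    moreover have "m (Suc k) = m k * (32 * A) * (1 / 32)" by (simp add: m_def)
    ultimately show ?thesis by linarith
  qed
  \<comment> \<open>The radii fall from 3 to 1 and the starting times rise from T to T + 2. A step
    \<tau> = 2^-k / 2 costs the radius 2 \<tau> = 2^-k, exactly the difference of consecutive radii,
    and at time T + 2 the bounds hold for every k.\<close>
  have claim: "bounded_below_on (1 + 2 * (1 / 2) ^ k) (m k) (u t) \<and> bounded_below_on (1 + 2 * (1 / 2) ^ k) (m k) (v t)"
    if "t \<ge> T + 2 - 2 * (1 / 2) ^ k" for k t
    using that
  proof (induction k arbitrary: t)
    case 0
    then show ?case using init[of t] by (simp add: m_def)
  next
    case (Suc k)
    define \<tau> :: real where "\<tau> = (1 / 2) ^ k / 2"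
    have p: "(1 / 2 :: real) ^ k \<le> 1" by (simp add: power_le_one)
    have \<tau>: "0 < \<tau>" "\<tau> \<le> 1" using p by (auto simp: \<tau>_def)
    have p0: "(1 / 2 :: real) ^ k > 0" by simp
    have "T + 2 - (1 / 2) ^ k \<le> t" using Suc.prems by simp
    then have t: "t \<ge> T" "t - \<tau> \<ge> T + 2 - 2 * (1 / 2) ^ k" unfolding \<tau>_def using p p0 by linarith+
    \<comment> \<open>This is what T >= 9 is for: \<open>step\<close> works with radii up to sqrt t,
      and the largest radius here is 3.\<close>
    have "3 = sqrt 9" by simp
    also have "\<dots> \<le> sqrt t" using t T by (intro real_sqrt_le_mono) simp
    finally have r: "1 + 2 * (1 / 2) ^ k \<le> sqrt t" using p by linarith
    have "bounded_below_on (1 + 2 * (1 / 2) ^ k - 2 * \<tau>) (\<tau>\<^sup>2 / 8 * m k powr \<sigma>) (u t) \<and>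
        bounded_below_on (1 + 2 * (1 / 2) ^ k - 2 * \<tau>) (\<tau>\<^sup>2 / 8 * m k powr \<sigma>) (v t)"
    proof (rule step[OF t(1) m1 \<tau> r])
      fix s assume "t - \<tau> \<le> s"
      then show "bounded_below_on (1 + 2 * (1 / 2) ^ k) (m k) (u s) \<and> bounded_below_on (1 + 2 * (1 / 2) ^ k) (m k) (v s)"
        using t(2) by (intro Suc.IH) simp
    qed
    moreover have "1 + 2 * (1 / 2) ^ k - 2 * \<tau> = 1 + 2 * (1 / 2) ^ Suc k" by (simp add: \<tau>_def)
    ultimately show ?case using mS[of k] unfolding \<tau>_def[symmetric] by (auto intro: bounded_below_on_mono)
  qed
  have "AE x in lborel. x \<in> cball 0 1 \<longrightarrow> m k \<le> L2_fun (u (T + 2)) x" for k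
  proof -
    have "bounded_below_on 1 (m k) (u (T + 2))"
      using claim[of k "T + 2"] by (auto intro: bounded_below_on_mono)
    then show ?thesis by (simp add: bounded_below_on_def)
  qed
  \<comment> \<open>The exceptional null sets, one for each k, are united before a point is fixed
    and k varies.\<close>
  then have "AE x in lborel. \<forall>k. x \<in> cball 0 1 \<longrightarrow> m k \<le> L2_fun (u (T + 2)) x"
    by (subst AE_all_countable) auto
  then have "AE x in lborel. x \<notin> cball (0::'a) 1"
  proof eventually_elim
    case (elim x)
    show ?case
    proof
      assume "x \<in> cball 0 1"
      then have *: "m k \<le> L2_fun (u (T + 2)) x" for k using elim by blast
      obtain k where k: "L2_fun (u (T + 2)) x < A ^ k" using real_arch_pow[OF A] by blast
      have "1 * A ^ k \<le> M * A ^ k" using M(1) A by (intro mult_right_mono) auto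
      then show False using *[of k] k by (simp add: m_def)
    qed
  qed
  then have "cball (0::'a) 1 \<in> null_sets lborel"
    by (subst AE_iff_null_sets) auto
  then have "emeasure lborel (cball (0::'a) 1) = 0" by (rule null_setsD1)
  then have "unit_ball_vol (real DIM('a)) = 0" by (subst (asm) emeasure_cball) auto
  then show False using unit_ball_vol_pos[of "real DIM('a)"] by simp
qed

section \<open>Coupling of the components and conclusion\<close>

text \<open>With m > 0 both conventions for the exponent 0 give the value 1.\<close>

lemma abs_pow_lower: "0 < m \<Longrightarrow> m \<le> x \<Longrightarrow> 0 \<le> a \<Longrightarrow> m powr a \<le> abs_pow x a"
  by (auto simp: abs_pow_def intro: powr_mono2)

lemma abs_pow_nonneg: "0 \<le> abs_pow x a"
  by (simp add: abs_pow_def)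

lemma nonlinearity_lower_bound:
  assumes u: "bounded_below_on r m1 u" and v: "bounded_below_on r m2 v" and m: "m1 > 0" "m2 > 0" and ab: "a \<ge> 0" "b \<ge> 0"
  shows "AE x in lborel. x \<in> cball 0 r \<longrightarrow> m1 powr a * m2 powr b \<le> abs_pow (L2_fun u x) a * abs_pow (L2_fun v x) b"
  using u v unfolding bounded_below_on_def
proof eventually_elim
  case (elim x)
  then show ?case using m ab by (auto intro!: mult_mono abs_pow_lower abs_pow_nonneg)
qed

text \<open>Integrating a force of size s^-\<gamma> over a time of order t gains one power of t. The
  threshold 4 T' ensures that all s >= t / 4 are past T'.\<close>

lemma powr_iteration_step:
  fixes w :: "real \<Rightarrow> 'a::euclidean_space L2"
  assumes heat: "\<And>t m. t \<ge> T \<Longrightarrow> m \<ge> 0 \<Longrightarrow>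
      (\<And>s. t / 4 \<le> s \<Longrightarrow> s \<le> t / 2 \<Longrightarrow> AE x in lborel. x \<in> cball 0 (sqrt s) \<longrightarrow> m \<le> F s x) \<Longrightarrow>
      bounded_below_on (sqrt t) (c * t * m) (w t)"
    and F: "\<And>s. s \<ge> T' \<Longrightarrow> AE x in lborel. x \<in> cball 0 (sqrt s) \<longrightarrow> k * s powr - \<gamma> \<le> F s x"
    and c: "c > 0" "T \<ge> 1" "k > 0" "T' \<ge> 1"
  shows "\<exists>c'>0. \<forall>t\<ge>max T (4 * T'). bounded_below_on (sqrt t) (c' * t powr - (\<gamma> - 1)) (w t)"
proof (intro exI conjI allI impI)
  \<comment> \<open>The ratio s / t lies between 1 / 4 and 1, so (1 / 4)^|\<gamma>| bounds its power
    - \<gamma> from below whatever the sign of \<gamma>.\<close>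
  define \<kappa> :: real where "\<kappa> = (1 / 4) powr \<bar>\<gamma>\<bar>"
  have \<kappa>: "\<kappa> > 0" by (simp add: \<kappa>_def)
  show "c * (k * \<kappa>) > 0" using c \<kappa> by simp
  fix t assume t: "t \<ge> max T (4 * T')"
  then have t0: "t > 0" using c by simp
  have "bounded_below_on (sqrt t) (c * t * (k * \<kappa> * t powr - \<gamma>)) (w t)"
  proof (rule heat)
    show "t \<ge> T" using t by simp
    show "0 \<le> k * \<kappa> * t powr - \<gamma>" using c \<kappa> by simp
    fix s assume s: "t / 4 \<le> s" "s \<le> t / 2"
    then have s0: "s > 0" using t0 by simp
    define \<theta> where "\<theta> = s / t"
    have \<theta>: "1 / 4 \<le> \<theta>" "\<theta> \<le> 1" using s t0 by (auto simp: \<theta>_def le_divide_eq divide_le_eq)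
    have "\<kappa> \<le> \<theta> powr - \<gamma>"
    proof (cases "\<gamma> \<ge> 0")
      case True
      have "\<kappa> \<le> 1" unfolding \<kappa>_def using True by (simp add: powr_le1)
      also have "1 \<le> \<theta> powr - \<gamma>"
      proof -
        have "\<theta> powr \<gamma> \<le> 1" using \<theta> True by (intro powr_le1) auto
        moreover have "\<theta> powr \<gamma> > 0" using \<theta> by simp
        ultimately show ?thesis by (simp add: powr_minus one_le_inverse)
      qed
      finally show ?thesis .
    next
      case False
      then show ?thesis unfolding \<kappa>_def using \<theta> by (simp add: powr_mono2)
    qed
    then have "\<kappa> * t powr - \<gamma> \<le> \<theta> powr - \<gamma> * t powr - \<gamma>" by (intro mult_right_mono) auto
    also have "\<dots> = s powr - \<gamma>" using s0 t0 by (simp add: \<theta>_def powr_divide)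
    finally have le: "k * \<kappa> * t powr - \<gamma> \<le> k * s powr - \<gamma>" using c by (simp add: mult.assoc)
    have "s \<ge> T'" using s t by simp
    from F[OF this] show "AE x in lborel. x \<in> cball 0 (sqrt s) \<longrightarrow> k * \<kappa> * t powr - \<gamma> \<le> F s x"
      by eventually_elim (use le in auto)
  qed
  moreover have "t * t powr - \<gamma> = t powr - (\<gamma> - 1)"
    using t0 powr_add[of t 1 "- \<gamma>"] by simp
  then have "c * t * (k * \<kappa> * t powr - \<gamma>) = c * (k * \<kappa>) * t powr - (\<gamma> - 1)" by (simp add: mult_ac)
  ultimately show "bounded_below_on (sqrt t) (c * (k * \<kappa>) * t powr - (\<gamma> - 1)) (w t)" by simp
qed

lemma bounded_below_on_powr_min:
  assumes a: "bounded_below_on r (c * t powr - a) w" "bounded_below_on r (c' * t powr - a') w"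
    and d: "d \<le> c" "d \<le> c'" and t: "t \<ge> 1"
  shows "bounded_below_on r (d * t powr - min a a') w"
proof (cases "a \<le> a'")
  case True
  then show ?thesis using a(1) d(1) by (auto intro!: bounded_below_on_mono[OF a(1)] mult_right_mono simp: min_def)
next
  case False
  then show ?thesis using a(2) d(2) by (auto intro!: bounded_below_on_mono[OF a(2)] mult_right_mono simp: min_def)
qed

lemma no_global_mild_solution:
  fixes u1 v1 :: "'a::euclidean_space \<Rightarrow> real" and p q \<alpha> \<beta> :: real
  assumes dim: "DIM('a) \<le> 3"
    and \<alpha>: "0 \<le> \<alpha>" "\<alpha> < 1" and \<beta>: "0 \<le> \<beta>" "\<beta> < 1" and p: "p > 0" "p + \<alpha> > 1" and q: "q > 0" "q + \<beta> > 1"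
    and u1: "integrable lborel u1" "in_H1 u1" "(\<integral>x. u1 x \<partial>lborel) > 0"
    and v1: "integrable lborel v1" "in_H1 v1" "(\<integral>x. v1 x \<partial>lborel) > 0"
    and crit: "real DIM('a) / 2 < (1 + max (q - \<alpha>) (p - \<beta>)) / (p * q - (1 - \<alpha>) * (1 - \<beta>))"
    and sol: "global_mild_solution \<alpha> p q \<beta> (\<lambda>x. 0) u1 (\<lambda>x. 0) v1 u v"
  shows False
proof -
  let ?n = "DIM('a)"
  define Fu where "Fu s x = abs_pow (L2_fun (u s) x) \<alpha> * abs_pow (L2_fun (v s) x) p" for s x
  define Fv where "Fv s x = abs_pow (L2_fun (u s) x) q * abs_pow (L2_fun (v s) x) \<beta>" for s x
  have Fu0: "Fu s x \<ge> 0" and Fv0: "Fv s x \<ge> 0" for s x by (simp_all add: Fu_def Fv_def abs_pow_nonneg)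
  have wu: "forced_wave u1 Fu u" and wv: "forced_wave v1 Fv v"
    using sol unfolding global_mild_solution_def mild_solution_def forced_wave_def Let_def
      Fu_def[abs_def] Fv_def[abs_def] by (auto simp: time_interval_def)
  obtain cu Tu where cu: "cu > 0" "Tu \<ge> 1"
    and lin_u: "\<And>t. t \<ge> Tu \<Longrightarrow> bounded_below_on (sqrt t) (cu / sqrt t ^ ?n) (u t)"
    and heat_u: "\<And>t m. t \<ge> Tu \<Longrightarrow> m \<ge> 0 \<Longrightarrow>
      (\<And>s. t / 4 \<le> s \<Longrightarrow> s \<le> t / 2 \<Longrightarrow> AE x in lborel. x \<in> cball 0 (sqrt s) \<longrightarrow> m \<le> Fu s x) \<Longrightarrow>
      bounded_below_on (sqrt t) (cu * t * m) (u t)"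
    and local_u: "\<And>t m r \<tau>. t \<ge> Tu \<Longrightarrow> m \<ge> 0 \<Longrightarrow> 0 < \<tau> \<Longrightarrow> \<tau> \<le> 1 \<Longrightarrow> r \<le> sqrt t \<Longrightarrow>
      (\<And>s. t - \<tau> \<le> s \<Longrightarrow> s \<le> t \<Longrightarrow> AE x in lborel. x \<in> cball 0 r \<longrightarrow> m \<le> Fu s x) \<Longrightarrow>
      bounded_below_on (r - 2 * \<tau>) (\<tau>\<^sup>2 / 8 * m) (u t)"
    by (rule forced_wave_bounds[OF dim u1 wu Fu0]) (rule that, assumption, assumption, assumption, blast, blast)
  obtain cv Tv where cv: "cv > 0" "Tv \<ge> 1"
    and lin_v: "\<And>t. t \<ge> Tv \<Longrightarrow> bounded_below_on (sqrt t) (cv / sqrt t ^ ?n) (v t)"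
    and heat_v: "\<And>t m. t \<ge> Tv \<Longrightarrow> m \<ge> 0 \<Longrightarrow>
      (\<And>s. t / 4 \<le> s \<Longrightarrow> s \<le> t / 2 \<Longrightarrow> AE x in lborel. x \<in> cball 0 (sqrt s) \<longrightarrow> m \<le> Fv s x) \<Longrightarrow>
      bounded_below_on (sqrt t) (cv * t * m) (v t)"
    and local_v: "\<And>t m r \<tau>. t \<ge> Tv \<Longrightarrow> m \<ge> 0 \<Longrightarrow> 0 < \<tau> \<Longrightarrow> \<tau> \<le> 1 \<Longrightarrow> r \<le> sqrt t \<Longrightarrow>
      (\<And>s. t - \<tau> \<le> s \<Longrightarrow> s \<le> t \<Longrightarrow> AE x in lborel. x \<in> cball 0 r \<longrightarrow> m \<le> Fv s x) \<Longrightarrow>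
      bounded_below_on (r - 2 * \<tau>) (\<tau>\<^sup>2 / 8 * m) (v t)"
    by (rule forced_wave_bounds[OF dim v1 wv Fv0]) (rule that, assumption, assumption, assumption, blast, blast)
  \<comment> \<open>Constant and starting time are quantified inside because both deteriorate with
    each iteration; finitely many iterations are used.\<close>
  define Inv where "Inv a b \<longleftrightarrow> (\<exists>c>0. \<exists>T\<ge>1. \<forall>t\<ge>T.
    bounded_below_on (sqrt t) (c * t powr - a) (u t) \<and> bounded_below_on (sqrt t) (c * t powr - b) (v t))" for a b
  have "Inv (real ?n / 2) (real ?n / 2)"
    unfolding Inv_def
  proof (intro exI conjI allI impI)
    show "min cu cv > 0" "max Tu Tv \<ge> 1" using cu cv by auto
    fix t assume t: "t \<ge> max Tu Tv"
    then have t0: "t > 0" using cu by simp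
    have e: "c * t powr - (real ?n / 2) = c / sqrt t ^ ?n" for c
    proof -
      have "sqrt t ^ ?n = (t powr (1 / 2)) powr real ?n" using t0 by (simp add: powr_half_sqrt powr_realpow)
      also have "\<dots> = t powr (real ?n / 2)" by (simp add: powr_powr)
      finally show ?thesis by (simp only: powr_minus divide_inverse)
    qed
    have s: "sqrt t ^ ?n > 0" using t0 by simp
    show "bounded_below_on (sqrt t) (min cu cv * t powr - (real ?n / 2)) (u t)"
      unfolding e using t s by (intro bounded_below_on_mono[OF lin_u]) (auto intro!: divide_right_mono)
    show "bounded_below_on (sqrt t) (min cu cv * t powr - (real ?n / 2)) (v t)"
      unfolding e using t s by (intro bounded_below_on_mono[OF lin_v]) (auto intro!: divide_right_mono)
  qed
  moreover have "Inv (min a (\<alpha> * a + p * b - 1)) (min b (q * a + \<beta> * b - 1))" if "Inv a b" for a b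
  proof -
    obtain c T where c: "c > 0" "T \<ge> 1"
      and low: "\<And>t. t \<ge> T \<Longrightarrow> bounded_below_on (sqrt t) (c * t powr - a) (u t) \<and> bounded_below_on (sqrt t) (c * t powr - b) (v t)"
      using \<open>Inv a b\<close> by (auto simp: Inv_def)
    have pw: "(c * s powr - a) powr x * (c * s powr - b) powr y = (c powr x * c powr y) * s powr - (x * a + y * b)"
      if "s > 0" for s x y
    proof -
      have "(c * s powr - a) powr x * (c * s powr - b) powr y = (c powr x * c powr y) * (s powr (- a * x) * s powr (- b * y))"
        using that c by (simp add: powr_mult powr_powr mult_ac)
      also have "s powr (- a * x) * s powr (- b * y) = s powr - (x * a + y * b)"
        by (simp add: mult.commute flip: powr_add)
      finally show ?thesis .
    qed
    have nl: "AE z in lborel. z \<in> cball 0 (sqrt s) \<longrightarrow> (c powr x * c powr y) * s powr - (x * a + y * b)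
        \<le> abs_pow (L2_fun (u s) z) x * abs_pow (L2_fun (v s) z) y"
      if "s \<ge> T" "x \<ge> 0" "y \<ge> 0" for s x y
    proof -
      have s: "s > 0" using that c by simp
      show ?thesis
        unfolding pw[OF s, symmetric] using low[OF that(1)] that s c
        by (intro nonlinearity_lower_bound) auto
    qed
    have "\<exists>c'>0. \<forall>t\<ge>max Tu (4 * T). bounded_below_on (sqrt t) (c' * t powr - (\<alpha> * a + p * b - 1)) (u t)"
    proof (rule powr_iteration_step[OF heat_u])
      show "AE z in lborel. z \<in> cball 0 (sqrt s) \<longrightarrow> (c powr \<alpha> * c powr p) * s powr - (\<alpha> * a + p * b) \<le> Fu s z"
        if "s \<ge> T" for s
        unfolding Fu_def using nl[OF that] \<alpha> p by simp
    qed (use c cu in auto)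
    then obtain c2 where c2: "c2 > 0" "\<And>t. t \<ge> max Tu (4 * T) \<Longrightarrow> bounded_below_on (sqrt t) (c2 * t powr - (\<alpha> * a + p * b - 1)) (u t)"
      by blast
    have "\<exists>c'>0. \<forall>t\<ge>max Tv (4 * T). bounded_below_on (sqrt t) (c' * t powr - (q * a + \<beta> * b - 1)) (v t)"
    proof (rule powr_iteration_step[OF heat_v])
      show "AE z in lborel. z \<in> cball 0 (sqrt s) \<longrightarrow> (c powr q * c powr \<beta>) * s powr - (q * a + \<beta> * b) \<le> Fv s z"
        if "s \<ge> T" for s
        unfolding Fv_def using nl[OF that] \<beta> q by simp
    qed (use c cv in auto)
    then obtain c3 where c3: "c3 > 0" "\<And>t. t \<ge> max Tv (4 * T) \<Longrightarrow> bounded_below_on (sqrt t) (c3 * t powr - (q * a + \<beta> * b - 1)) (v t)"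
      by blast
    show ?thesis
      unfolding Inv_def
    proof (intro exI conjI allI impI)
      show "min c (min c2 c3) > 0" "max (max Tu Tv) (4 * T) \<ge> 1" using c c2 c3 cu by auto
      fix t assume t: "t \<ge> max (max Tu Tv) (4 * T)"
      show "bounded_below_on (sqrt t) (min c (min c2 c3) * t powr - min a (\<alpha> * a + p * b - 1)) (u t)"
        using low[of t] c2(2)[of t] t c cu by (intro bounded_below_on_powr_min[of _ c t a _ c2]) auto
      show "bounded_below_on (sqrt t) (min c (min c2 c3) * t powr - min b (q * a + \<beta> * b - 1)) (v t)"
        using low[of t] c3(2)[of t] t c cu by (intro bounded_below_on_powr_min[of _ c t b _ c3]) auto
    qed
  qed
  ultimately obtain a b where ab: "a < 0" "b < 0" "Inv a b"
    using exponent_iteration[OF \<alpha> \<beta> p q crit, of Inv] by blast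
  obtain c T where c: "c > 0" "T \<ge> 1"
    and low: "\<And>t. t \<ge> T \<Longrightarrow> bounded_below_on (sqrt t) (c * t powr - a) (u t) \<and> bounded_below_on (sqrt t) (c * t powr - b) (v t)"
    using ab(3) by (auto simp: Inv_def)
  \<comment> \<open>When both components are at least m >= 1, both nonlinearities are at least
    m^\<sigma>, so \<open>blow_up\<close> can raise the two components simultaneously.\<close>
  define \<sigma> where "\<sigma> = min (p + \<alpha>) (q + \<beta>)"
  have \<sigma>: "\<sigma> > 1" "\<sigma> \<le> p + \<alpha>" "\<sigma> \<le> q + \<beta>" using p q by (auto simp: \<sigma>_def)
  \<comment> \<open>Solves the largeness condition of \<open>blow_up\<close> for M.\<close>
  define M where "M = max 1 ((32 * 4 powr (1 / (\<sigma> - 1))) powr (1 / (\<sigma> - 1)))"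
  have M: "M \<ge> 1" "M powr (\<sigma> - 1) \<ge> 32 * 4 powr (1 / (\<sigma> - 1))"
  proof -
    have "32 * 4 powr (1 / (\<sigma> - 1)) = ((32 * 4 powr (1 / (\<sigma> - 1))) powr (1 / (\<sigma> - 1))) powr (\<sigma> - 1)"
      using \<sigma> by (simp add: powr_powr)
    also have "\<dots> \<le> M powr (\<sigma> - 1)" using \<sigma> by (intro powr_mono2) (auto simp: M_def)
    finally show "M powr (\<sigma> - 1) \<ge> 32 * 4 powr (1 / (\<sigma> - 1))" .
  qed (simp add: M_def)
  \<comment> \<open>Negative decay exponents mean growth, so the level M is eventually exceeded on
    balls that contain the one of radius 3.\<close>
  have "filterlim (\<lambda>t::real. c * t powr - a) at_top at_top" using c ab by real_asymp
  then have "\<forall>\<^sub>F t in at_top. M \<le> c * t powr - a" by (simp add: filterlim_at_top)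
  moreover have "filterlim (\<lambda>t::real. c * t powr - b) at_top at_top" using c ab by real_asymp
  then have "\<forall>\<^sub>F t in at_top. M \<le> c * t powr - b" by (simp add: filterlim_at_top)
  ultimately have "\<forall>\<^sub>F t in at_top. M \<le> c * t powr - a \<and> M \<le> c * t powr - b" by eventually_elim simp
  then obtain T0 where T0: "\<And>t. t \<ge> T0 \<Longrightarrow> M \<le> c * t powr - a \<and> M \<le> c * t powr - b"
    by (auto simp: eventually_at_top_linorder)
  define T1 where "T1 = max (max T T0) (max (max Tu Tv) 9)"
  have T1: "T1 \<ge> T" "T1 \<ge> T0" "T1 \<ge> Tu" "T1 \<ge> Tv" "T1 \<ge> 9" by (auto simp: T1_def)
  show False
  proof (rule blow_up[OF \<sigma>(1) T1(5) M])
    fix t assume t: "t \<ge> T1"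
    have "3 = sqrt 9" by simp
    also have "\<dots> \<le> sqrt t" using t T1 by (intro real_sqrt_le_mono) simp
    finally have s: "3 \<le> sqrt t" .
    show "bounded_below_on 3 M (u t) \<and> bounded_below_on 3 M (v t)"
      using low[of t] T0[of t] t T1 s by (auto intro: bounded_below_on_mono)
  next
    fix t m r \<tau> assume t: "t \<ge> T1" and m: "m \<ge> 1" and \<tau>: "0 < \<tau>" "\<tau> \<le> 1" and r: "r \<le> sqrt t"
      and bb: "\<And>s. t - \<tau> \<le> s \<Longrightarrow> s \<le> t \<Longrightarrow> bounded_below_on r m (u s) \<and> bounded_below_on r m (v s)"
    have nl: "AE z in lborel. z \<in> cball 0 r \<longrightarrow> m powr \<sigma> \<le> abs_pow (L2_fun (u s) z) x * abs_pow (L2_fun (v s) z) y"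
      if s: "t - \<tau> \<le> s" "s \<le> t" and xy: "x \<ge> 0" "y \<ge> 0" "\<sigma> \<le> x + y" for s x y
    proof -
      have "m powr \<sigma> \<le> m powr (x + y)" using m xy by (intro powr_mono) auto
      then have le: "m powr \<sigma> \<le> m powr x * m powr y" by (simp add: powr_add)
      have "AE z in lborel. z \<in> cball 0 r \<longrightarrow> m powr x * m powr y \<le> abs_pow (L2_fun (u s) z) x * abs_pow (L2_fun (v s) z) y"
        using bb[OF s] m xy by (intro nonlinearity_lower_bound) auto
      then show ?thesis by eventually_elim (use le in auto)
    qed
    show "bounded_below_on (r - 2 * \<tau>) (\<tau>\<^sup>2 / 8 * m powr \<sigma>) (u t) \<and>
        bounded_below_on (r - 2 * \<tau>) (\<tau>\<^sup>2 / 8 * m powr \<sigma>) (v t)"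
    proof
      show "bounded_below_on (r - 2 * \<tau>) (\<tau>\<^sup>2 / 8 * m powr \<sigma>) (u t)"
      proof (rule local_u)
        show "AE x in lborel. x \<in> cball 0 r \<longrightarrow> m powr \<sigma> \<le> Fu s x" if "t - \<tau> \<le> s" "s \<le> t" for s
          unfolding Fu_def by (rule nl[OF that]) (use \<sigma> \<alpha> p in auto)
      qed (use t T1 \<tau> r in auto)
      show "bounded_below_on (r - 2 * \<tau>) (\<tau>\<^sup>2 / 8 * m powr \<sigma>) (v t)"
      proof (rule local_v)
        show "AE x in lborel. x \<in> cball 0 r \<longrightarrow> m powr \<sigma> \<le> Fv s x" if "t - \<tau> \<le> s" "s \<le> t" for s
          unfolding Fv_def by (rule nl[OF that]) (use \<sigma> \<beta> q in auto)
      qed (use t T1 \<tau> r in auto)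
    qed
  qed
qed

theorem theorem1p2:
  fixes u0 u1 v0 v1 :: "real ^ 'n \<Rightarrow> real" and p q \<alpha> \<beta> :: real
  assumes "1 \<le> CARD('n)" and "CARD('n) \<le> 3"
    and "p > 0" and "q > 0" and "\<alpha> \<in> {0..<1}" and "\<beta> \<in> {0..<1}"
    and "min (p + \<alpha>) (q + \<beta>) > 1"
    and "u0 = (\<lambda>x. 0)" and "v0 = (\<lambda>x. 0)"
    and "integrable lborel u1" and "in_H1 u1"
    and "integrable lborel v1" and "in_H1 v1"
    and "(\<integral>x. u1 x \<partial>lborel) > 0" and "(\<integral>x. v1 x \<partial>lborel) > 0"
    and "(1 + max (q - \<alpha>) (p - \<beta>)) / (p * q - (1 - \<alpha>) * (1 - \<beta>)) > real CARD('n) / 2"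
  shows "\<not> (\<exists>u v. global_mild_solution \<alpha> p q \<beta> u0 u1 v0 v1 u v)"
proof
  assume "\<exists>u v. global_mild_solution \<alpha> p q \<beta> u0 u1 v0 v1 u v"
  then obtain u v where sol: "global_mild_solution \<alpha> p q \<beta> (\<lambda>x. 0) u1 (\<lambda>x. 0) v1 u v"
    using assms(8,9) by blast
  show False
    by (rule no_global_mild_solution[OF _ _ _ _ _ assms(3) _ assms(4) _ assms(10,11,14) assms(12,13,15) _ sol])
      (use assms in auto)
qed

end
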